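(* Let $S \subset [m] \times [n]$ be a set of indices with associated bipartite graph $G_S$ and quasi-independence model $\mathcal{M}_S$. Then $\mathcal{M}_S$ has rational maximum likelihood estimate if and only if $G_S$ is doubly chordal bipartite. In particular, when $G_S$ is doubly chordal bipartite and $u = (u_{ij} \mid (i,j)\in S)$ is a generic matrix of counts, the maximum likelihood estimate for $u$ in $\mathcal{M}_S$ has $ij$-th entry, for each $(i,j) \in S$, \[ \hat{p}_{ij} = \frac{u_{i+}\,u_{+j}\displaystyle\prod_{C \in \mathrm{Int}(ij)} C^+}{u_{++} \displaystyle\prod_{D \in \mathrm{Max}(ij)} D^+}. \]
   Context: Notation: $[k] = \{1,\dots,k\}$; $\mathbb{R}^S$ is the real vector space with coordinates indexed by $S$; $\Delta_{r-1} = \{x \in \mathbb{R}^r \mid x_i > 0 \text{ for all } i,\ \sum_i x_i = 1\}$. Quasi-independence model: define $\phi^S : \mathbb{R}^{m+n} \to \mathbb{R}^S$ by $\phi^S_{ij}(s_1,\dots,s_m,t_1,\dots,t_n) = s_i t_j$ for $(i,j)\in S$. Then $\mathcal{M}_S := \phi^S(\mathbb{R}^{m+n}) \cap \Delta_{\#S-1}$. Graph: $G_S$ is the bipartite graph with independent sets $[m]$ and $[n]$ (regarded as disjoint) and an edge between $i \in [m]$ and $j\in[n]$ if and only if $(i,j) \in S$. A bipartite graph is doubly chordal bipartite if every cycle of length at least $6$ has at least two chords. Maximum likelihood: for a vector of counts $u \in \mathbb{N}^S$, the maximum likelihood estimate (MLE) for $u$ in $\mathcal{M}_S$ is the distribution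 $\hat p \in \mathcal{M}_S$ maximizing $\prod_{(i,j)\in S} p_{ij}^{u_{ij}}$ over $p \in \mathcal{M}_S$. The model has rational MLE if, for generic $u$, the coordinates of the MLE are given by rational functions of the entries of $u$. Cliques: a clique in $S$ is a set $C = I \times J \subset S$ with $I\subset[m]$, $J\subset[n]$ nonempty; it is maximal if it is not contained in any other clique in $S$. For $(i,j)\in S$, $\mathrm{Max}(ij)$ is the set of all maximal cliques in $S$ containing $(i,j)$, and $\mathrm{Int}(ij)$ is the set of all containment-maximal sets among the pairwise intersections $D \cap D'$ of two distinct elements $D, D'$ of $\mathrm{Max}(ij)$. Sums: for $C \subset S$, $C^+ = \sum_{(i,j)\in C} u_{ij}$; $u_{i+} = \sum_{j : (i,j)\in S} u_{ij}$; $u_{+j} = \sum_{i:(i,j)\in S} u_{ij}$; $u_{++} = \sum_{(i,j)\in S} u_{ij}$. Empty products equal $1$. *)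

theory Defs
  imports Complex_Main "HOL-Library.FuncSet"
begin

text \<open>Points of \<open>\<real>\<^sup>S\<close> and \<open>\<nat>\<^sup>S\<close> are extensional functions, i.e. elements of
  \<open>S \<rightarrow>\<^sub>E UNIV\<close>, so that equality of points is equality of functions.\<close>

type_synonym index = "nat \<times> nat"

section \<open>Quasi-independence models\<close>

definition open_simplex :: "index set \<Rightarrow> (index \<Rightarrow> real) set" where
  "open_simplex S = {p \<in> S \<rightarrow>\<^sub>E UNIV. (\<forall>e\<in>S. 0 < p e) \<and> (\<Sum>e\<in>S. p e) = 1}"

definition qi_map :: "index set \<Rightarrow> (nat \<Rightarrow> real) \<times> (nat \<Rightarrow> real) \<Rightarrow> index \<Rightarrow> real" where
  "qi_map S = (\<lambda>(s, t). \<lambda>(i, j)\<in>S. s i * t j)"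

definition qi_model :: "nat \<Rightarrow> nat \<Rightarrow> index set \<Rightarrow> (index \<Rightarrow> real) set" where
  "qi_model m n S =
     qi_map S ` (({1..m} \<rightarrow>\<^sub>E UNIV) \<times> ({1..n} \<rightarrow>\<^sub>E UNIV)) \<inter> open_simplex S"

section \<open>Maximum likelihood estimation\<close>

definition likelihood :: "index set \<Rightarrow> (index \<Rightarrow> nat) \<Rightarrow> (index \<Rightarrow> real) \<Rightarrow> real" where
  "likelihood S u p = (\<Prod>e\<in>S. p e ^ u e)"

text \<open>\<open>p\<close> is \<^emph>\<open>the\<close> maximum likelihood estimate: it is the only maximizer in the model.\<close>

definition is_mle :: "nat \<Rightarrow> nat \<Rightarrow> index set \<Rightarrow> (index \<Rightarrow> nat) \<Rightarrow> (index \<Rightarrow> real) \<Rightarrow> bool" where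
  "is_mle m n S u p \<longleftrightarrow>
     {q. is_arg_max (likelihood S u) (\<lambda>q. q \<in> qi_model m n S) q} = {p}"

text \<open>Polynomials with real coefficients in the coordinates indexed by \<open>S\<close>. Since \<open>\<real>\<close> is
  infinite, a polynomial is nonzero iff its polynomial function is not identically zero.\<close>

inductive polynomial_fun :: "index set \<Rightarrow> ((index \<Rightarrow> real) \<Rightarrow> real) \<Rightarrow> bool" for S where
  const: "polynomial_fun S (\<lambda>x. c)"
| coord: "e \<in> S \<Longrightarrow> polynomial_fun S (\<lambda>x. x e)"
| add: "polynomial_fun S f \<Longrightarrow> polynomial_fun S g \<Longrightarrow> polynomial_fun S (\<lambda>x. f x + g x)"
| mult: "polynomial_fun S f \<Longrightarrow> polynomial_fun S g \<Longrightarrow> polynomial_fun S (\<lambda>x. f x * g x)"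

text \<open>A property holds for generic \<open>u \<in> \<nat>\<^sup>S\<close> if it holds off the zero set of some nonzero
  polynomial.\<close>

definition generically :: "index set \<Rightarrow> ((index \<Rightarrow> nat) \<Rightarrow> bool) \<Rightarrow> bool" where
  "generically S P \<longleftrightarrow>
     (\<exists>h. polynomial_fun S h \<and> (\<exists>x. h x \<noteq> 0) \<and>
          (\<forall>u \<in> S \<rightarrow>\<^sub>E UNIV. h (\<lambda>e. real (u e)) \<noteq> 0 \<longrightarrow> P u))"

definition has_rational_mle :: "nat \<Rightarrow> nat \<Rightarrow> index set \<Rightarrow> bool" where
  "has_rational_mle m n S \<longleftrightarrow>
     (\<exists>f g. (\<forall>e\<in>S. polynomial_fun S (f e) \<and> polynomial_fun S (g e) \<and> (\<exists>x. g e x \<noteq> 0)) \<and>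
            generically S (\<lambda>u.
              (\<forall>e\<in>S. g e (\<lambda>e'. real (u e')) \<noteq> 0) \<and>
              is_mle m n S u
                (\<lambda>e\<in>S. f e (\<lambda>e'. real (u e')) / g e (\<lambda>e'. real (u e')))))"

section \<open>Doubly chordal bipartite graphs\<close>

text \<open>A simple graph is a pair of a vertex set and a set of two-element edges.\<close>

type_synonym 'v graph = "'v set \<times> 'v set set"

definition bipartite_graph :: "nat \<Rightarrow> nat \<Rightarrow> index set \<Rightarrow> (nat + nat) graph" where
  "bipartite_graph m n S = ({1..m} <+> {1..n}, {{Inl i, Inr j} | i j. (i, j) \<in> S})"

definition bipartite :: "'v graph \<Rightarrow> bool" where
  "bipartite G \<longleftrightarrow>
     (\<exists>A B. A \<union> B = fst G \<and> A \<inter> B = {} \<and> (\<forall>e\<in>snd G. \<exists>a\<in>A. \<exists>b\<in>B. e = {a, b}))"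

definition cycle_edges :: "'v list \<Rightarrow> 'v set set" where
  "cycle_edges vs = {{vs ! k, vs ! (Suc k mod length vs)} | k. k < length vs}"

definition is_cycle :: "'v graph \<Rightarrow> 'v list \<Rightarrow> bool" where
  "is_cycle G vs \<longleftrightarrow>
     3 \<le> length vs \<and> distinct vs \<and> set vs \<subseteq> fst G \<and> cycle_edges vs \<subseteq> snd G"

definition chords :: "'v graph \<Rightarrow> 'v list \<Rightarrow> 'v set set" where
  "chords G vs = {e \<in> snd G. e \<subseteq> set vs \<and> e \<notin> cycle_edges vs}"

definition doubly_chordal_bipartite :: "'v graph \<Rightarrow> bool" where
  "doubly_chordal_bipartite G \<longleftrightarrow>
     bipartite G \<and> (\<forall>vs. is_cycle G vs \<and> 6 \<le> length vs \<longrightarrow> 2 \<le> card (chords G vs))"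

section \<open>Cliques\<close>

text \<open>For \<open>S \<subseteq> {1..m} \<times> {1..n}\<close> the bounds \<open>I \<subseteq> {1..m}\<close> and \<open>J \<subseteq> {1..n}\<close> follow from
  \<open>I \<times> J \<subseteq> S\<close> and nonemptiness.\<close>

definition clique :: "index set \<Rightarrow> index set \<Rightarrow> bool" where
  "clique S C \<longleftrightarrow> C \<subseteq> S \<and> (\<exists>I J. I \<noteq> {} \<and> J \<noteq> {} \<and> C = I \<times> J)"

definition maximal_clique :: "index set \<Rightarrow> index set \<Rightarrow> bool" where
  "maximal_clique S C \<longleftrightarrow> clique S C \<and> (\<forall>C'. clique S C' \<longrightarrow> \<not> C \<subset> C')"

definition Max_cliques :: "index set \<Rightarrow> index \<Rightarrow> index set set" where
  "Max_cliques S e = {D. maximal_clique S D \<and> e \<in> D}"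

definition pairwise_ints :: "index set \<Rightarrow> index \<Rightarrow> index set set" where
  "pairwise_ints S e =
     {D \<inter> D' | D D'. D \<in> Max_cliques S e \<and> D' \<in> Max_cliques S e \<and> D \<noteq> D'}"

definition Int_cliques :: "index set \<Rightarrow> index \<Rightarrow> index set set" where
  "Int_cliques S e = {C \<in> pairwise_ints S e. \<forall>C'\<in>pairwise_ints S e. \<not> C \<subset> C'}"

section \<open>Sums of counts\<close>

definition count_sum :: "(index \<Rightarrow> nat) \<Rightarrow> index set \<Rightarrow> real" where
  "count_sum u C = (\<Sum>e\<in>C. real (u e))"

definition row_sum :: "index set \<Rightarrow> (index \<Rightarrow> nat) \<Rightarrow> nat \<Rightarrow> real" where
  "row_sum S u i = (\<Sum>j | (i, j) \<in> S. real (u (i, j)))"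

definition col_sum :: "index set \<Rightarrow> (index \<Rightarrow> nat) \<Rightarrow> nat \<Rightarrow> real" where
  "col_sum S u j = (\<Sum>i | (i, j) \<in> S. real (u (i, j)))"

end

theory Submission
  imports Defs "HOL-Computational_Algebra.Polynomial" "HOL-Library.Landau_Symbols"
begin

text \<open>By Birch's theorem a point of the model is the maximum likelihood estimate iff it has the
  same row and column sums as the normalised data.

  A doubly chordal bipartite graph can be dismantled by repeatedly deleting a pendant vertex or one
  of two twin vertices: take a maximal connected vertex set \<open>B\<close> that has vertices at distance two;
  each such vertex is adjacent to all of \<open>N(B) - B\<close> and to nothing else, and the vertices of
  \<open>N(B) - B\<close> are pairwise twins. Adding a pendant vertex does not change the clique formula on the old
  edges, and duplicating a vertex distributes the value of the formula proportionally. So by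
  induction the clique formula factors as \<open>s\<^sub>i t\<^sub>j\<close> and has the right margins.

  Conversely, along a cycle of length at least six with at most one chord one can choose counts that
  are monomials in \<open>N\<close> such that a coordinate of the estimate, scaled by the sample size, grows
  like the square root of \<open>N\<close>. No rational function does.\<close>

section \<open>Birch's theorem\<close>

text \<open>Necessity cannot simply restrict the model to the bad cycle: a rational estimate is only
  promised off the zero set of some polynomial, and all counts supported on the cycle may lie in
  that set. So every count stays positive, and the counts off the cycle merely stay bounded. The
  coefficients of the monomials come from a point where the excluding polynomial is nonzero, so only
  finitely many \<open>N\<close> are lost. The square root arises from two fitted values whose
  difference is bounded and whose product grows like \<open>N\<close>.

  Sufficiency is run on fitted counts, that is, without dividing by the sample size, and for
  arbitrary positive real weights. A pendant step exchanges or adds one maximal clique, a twin step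
  puts the maximal cliques in bijection, so the formula can be followed factor by factor. Positive
  counts are already generic, being cut out by the product of all coordinates.\<close>

definition same_margins :: "index set \<Rightarrow> (index \<Rightarrow> real) \<Rightarrow> (index \<Rightarrow> real) \<Rightarrow> bool" where
  "same_margins S P Q \<longleftrightarrow>
     (\<forall>i. (\<Sum>e | e \<in> S \<and> fst e = i. P e) = (\<Sum>e | e \<in> S \<and> fst e = i. Q e)) \<and>
     (\<forall>j. (\<Sum>e | e \<in> S \<and> snd e = j. P e) = (\<Sum>e | e \<in> S \<and> snd e = j. Q e))"

lemma sum_weighted_by_fibre:
  fixes P :: "'a \<Rightarrow> real"
  assumes "finite S"
  shows "(\<Sum>e\<in>S. P e * a (g e)) = (\<Sum>y\<in>g ` S. a y * (\<Sum>e | e \<in> S \<and> g e = y. P e))"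
proof -
  have "(\<Sum>e\<in>S. P e * a (g e)) = (\<Sum>y\<in>g ` S. \<Sum>e | e \<in> S \<and> g e = y. P e * a (g e))"
    by (rule sum.image_gen[OF assms])
  also have "\<dots> = (\<Sum>y\<in>g ` S. a y * (\<Sum>e | e \<in> S \<and> g e = y. P e))"
    by (rule sum.cong) (auto simp: sum_distrib_left intro!: sum.cong)
  finally show ?thesis .
qed

text \<open>Margins are the sufficient statistic: they fix the pairing with every function of the
  form \<open>a i + b j\<close>, and the logarithm of the ratio of two points of the model has this
  form.\<close>

lemma same_margins_sum:
  assumes "finite S" "same_margins S P Q"
  shows "(\<Sum>e\<in>S. P e * (a (fst e) + b (snd e))) = (\<Sum>e\<in>S. Q e * (a (fst e) + b (snd e)))"
  using assms(2) sum_weighted_by_fibre[OF assms(1), where g = fst and a = a]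
    sum_weighted_by_fibre[OF assms(1), where g = snd and a = b]
  by (simp add: distrib_left sum.distrib same_margins_def)

lemma qi_modelE:
  assumes "p \<in> qi_model m n S"
  obtains s t where "s \<in> {1..m} \<rightarrow>\<^sub>E UNIV" "t \<in> {1..n} \<rightarrow>\<^sub>E UNIV" "p = qi_map S (s, t)"
    "\<And>e. e \<in> S \<Longrightarrow> p e = s (fst e) * t (snd e)" "\<And>e. e \<in> S \<Longrightarrow> 0 < p e" "sum p S = 1"
    "p \<in> S \<rightarrow>\<^sub>E UNIV"
proof -
  from assms obtain s t where *: "s \<in> {1..m} \<rightarrow>\<^sub>E UNIV" "t \<in> {1..n} \<rightarrow>\<^sub>E UNIV" "p = qi_map S (s, t)"
    "p \<in> open_simplex S"
    unfolding qi_model_def by auto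
  moreover have "p e = s (fst e) * t (snd e)" if "e \<in> S" for e
    using that *(3) by (cases e) (simp add: qi_map_def)
  ultimately show thesis
    by (intro that[of s t]) (auto simp: open_simplex_def)
qed

lemma qi_modelI:
  assumes "S \<subseteq> {1..m} \<times> {1..n}" "p \<in> S \<rightarrow>\<^sub>E UNIV" "\<And>e. e \<in> S \<Longrightarrow> p e = s (fst e) * t (snd e)"
    "\<And>e. e \<in> S \<Longrightarrow> 0 < p e" "sum p S = 1"
  shows "p \<in> qi_model m n S"
proof -
  have "p = qi_map S (restrict s {1..m}, restrict t {1..n})"
  proof
    fix e
    show "p e = qi_map S (restrict s {1..m}, restrict t {1..n}) e"
    proof (cases "e \<in> S")
      case True
      then have "fst e \<in> {1..m}" "snd e \<in> {1..n}"
        using assms(1) by auto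
      with True show ?thesis
        by (simp add: assms(3) qi_map_def case_prod_beta)
    next
      case False
      then show ?thesis
        using PiE_arb[OF assms(2) False] by (simp add: qi_map_def)
    qed
  qed
  moreover have "p \<in> open_simplex S"
    using assms(2,4,5) unfolding open_simplex_def by simp
  ultimately show ?thesis
    unfolding qi_model_def by auto
qed

lemma is_mle_mem: "is_mle m n S u p \<Longrightarrow> p \<in> qi_model m n S"
proof -
  assume "is_mle m n S u p"
  then have "p \<in> {q. is_arg_max (likelihood S u) (\<lambda>q. q \<in> qi_model m n S) q}"
    unfolding is_mle_def by simp
  then show ?thesis
    unfolding is_arg_max_def by simp
qed

lemma likelihood_pos: "(\<And>e. e \<in> S \<Longrightarrow> 0 < p e) \<Longrightarrow> 0 < likelihood S u p"
  unfolding likelihood_def by (rule prod_pos) simp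

lemma ln_likelihood:
  assumes "\<And>e. e \<in> S \<Longrightarrow> 0 < p e"
  shows "ln (likelihood S u p) = (\<Sum>e\<in>S. real (u e) * ln (p e))"
proof (cases "finite S")
  case True
  have "ln (likelihood S u p) = (\<Sum>e\<in>S. ln (p e ^ u e))"
    unfolding likelihood_def
    using True assms by (intro ln_prod) force+
  also have "\<dots> = (\<Sum>e\<in>S. real (u e) * ln (p e))"
    using assms by (intro sum.cong) (auto simp: ln_realpow)
  finally show ?thesis .
qed (simp add: likelihood_def)

text \<open>Equal margins allow the counts in the log-likelihood ratio of \<open>q\<close> and
  \<open>p\<close> to be replaced by \<open>U * p\<close>; Gibbs' inequality then applies. It is
  strict at an entry where \<open>q\<close> and \<open>p\<close> differ, which makes the maximizer
  unique.\<close>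

lemma is_mle_if_same_margins:
  assumes S: "S \<subseteq> {1..m} \<times> {1..n}"
    and p: "p \<in> qi_model m n S"
    and marg: "same_margins S (\<lambda>e. real (u e)) (\<lambda>e. U * p e)" and U: "0 < U"
  shows "is_mle m n S u p"
proof -
  have fin: "finite S"
    using S finite_subset by blast
  obtain s t where st: "\<And>e. e \<in> S \<Longrightarrow> p e = s (fst e) * t (snd e)"
    and p0: "\<And>e. e \<in> S \<Longrightarrow> 0 < p e" and p1: "sum p S = 1" and pS: "p \<in> S \<rightarrow>\<^sub>E UNIV"
    using qi_modelE[OF p] by metis
  have less: "likelihood S u q < likelihood S u p" if q: "q \<in> qi_model m n S" and neq: "q \<noteq> p" for q
  proof -
    obtain s' t' where st': "\<And>e. e \<in> S \<Longrightarrow> q e = s' (fst e) * t' (snd e)"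
      and q0: "\<And>e. e \<in> S \<Longrightarrow> 0 < q e" and q1: "sum q S = 1" and qS: "q \<in> S \<rightarrow>\<^sub>E UNIV"
      using qi_modelE[OF q] by metis
    \<comment> \<open>Only the products of parameters are known to be positive; two negative
      parameters may meet, hence the absolute values.\<close>
    have split: "ln (q e) - ln (p e) = (ln \<bar>s' (fst e)\<bar> - ln \<bar>s (fst e)\<bar>) + (ln \<bar>t' (snd e)\<bar> - ln \<bar>t (snd e)\<bar>)"
      if "e \<in> S" for e
    proof -
      have "q e = \<bar>s' (fst e)\<bar> * \<bar>t' (snd e)\<bar>" "p e = \<bar>s (fst e)\<bar> * \<bar>t (snd e)\<bar>"
        using st[OF that] st'[OF that] p0[OF that] q0[OF that] by (metis abs_mult abs_of_pos)+
      moreover have "s' (fst e) \<noteq> 0" "t' (snd e) \<noteq> 0" "s (fst e) \<noteq> 0" "t (snd e) \<noteq> 0"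
        using st[OF that] st'[OF that] p0[OF that] q0[OF that] by auto
      ultimately show ?thesis
        by (simp add: ln_mult)
    qed
    obtain e0 where e0: "e0 \<in> S" "q e0 \<noteq> p e0"
      using neq pS qS by (meson PiE_ext)
    have gibbs: "p e * (ln (q e) - ln (p e)) \<le> q e - p e" if "e \<in> S" for e
    proof -
      have "ln (q e / p e) \<le> q e / p e - 1"
        using p0[OF that] q0[OF that] by (intro ln_le_minus_one) auto
      then have "p e * ln (q e / p e) \<le> p e * (q e / p e - 1)"
        using p0[OF that] by (intro mult_left_mono) auto
      then show ?thesis
        using p0[OF that] q0[OF that] by (simp add: ln_div right_diff_distrib)
    qed
    have gibbs0: "p e0 * (ln (q e0) - ln (p e0)) < q e0 - p e0"
    proof -
      have "q e0 / p e0 \<noteq> 1"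
        using e0 p0[OF e0(1)] by simp
      then have "ln (q e0 / p e0) < q e0 / p e0 - 1"
        using divide_pos_pos[OF q0 p0, OF e0(1) e0(1)] ln_le_minus_one[of "q e0 / p e0"] ln_eq_minus_one[of "q e0 / p e0"]
        by linarith
      then have "p e0 * ln (q e0 / p e0) < p e0 * (q e0 / p e0 - 1)"
        using p0[OF e0(1)] by (intro mult_strict_left_mono) auto
      then show ?thesis
        using p0[OF e0(1)] q0[OF e0(1)] by (simp add: ln_div right_diff_distrib)
    qed
    have "ln (likelihood S u q) - ln (likelihood S u p) = (\<Sum>e\<in>S. real (u e) * (ln (q e) - ln (p e)))"
      using p0 q0 by (simp add: ln_likelihood sum_subtractf right_diff_distrib)
    also have "\<dots> = (\<Sum>e\<in>S. real (u e) * ((ln \<bar>s' (fst e)\<bar> - ln \<bar>s (fst e)\<bar>) + (ln \<bar>t' (snd e)\<bar> - ln \<bar>t (snd e)\<bar>)))"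
      using split by (intro sum.cong) auto
    also have "\<dots> = (\<Sum>e\<in>S. U * p e * ((ln \<bar>s' (fst e)\<bar> - ln \<bar>s (fst e)\<bar>) + (ln \<bar>t' (snd e)\<bar> - ln \<bar>t (snd e)\<bar>)))"
      by (rule same_margins_sum[OF fin marg, where a = "\<lambda>i. ln \<bar>s' i\<bar> - ln \<bar>s i\<bar>" and b = "\<lambda>j. ln \<bar>t' j\<bar> - ln \<bar>t j\<bar>"])
    also have "\<dots> = (\<Sum>e\<in>S. U * p e * (ln (q e) - ln (p e)))"
      using split by (intro sum.cong) auto
    also have "\<dots> = U * (\<Sum>e\<in>S. p e * (ln (q e) - ln (p e)))"
      by (simp add: sum_distrib_left mult.assoc)
    also have "\<dots> < U * (\<Sum>e\<in>S. q e - p e)"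
      using U gibbs gibbs0 e0 fin by (intro mult_strict_left_mono sum_strict_mono_ex1) auto
    also have "\<dots> = 0"
      by (simp add: sum_subtractf p1 q1)
    finally have "ln (likelihood S u q) < ln (likelihood S u p)"
      by simp
    then show ?thesis
      using likelihood_pos[of S p u] likelihood_pos[of S q u] p0 q0 by simp
  qed
  have not_less: "\<not> likelihood S u p < likelihood S u q" if "q \<in> qi_model m n S" for q
    using less[OF that] by (cases "q = p") auto
  show ?thesis
    unfolding is_mle_def is_arg_max_def
    using less p not_less by auto
qed

text \<open>Stationarity of the likelihood along the curve that rescales the entries in \<open>T\<close>; for
  \<open>T\<close> a row or a column the curve stays in the model.\<close>

lemma mle_margin:
  assumes mle: "is_mle m n S u p" and T: "T \<subseteq> S" and fin: "finite S"
    and scale: "\<And>x Z. 0 < x \<Longrightarrow> 0 < Z \<Longrightarrow> (\<Sum>e\<in>S. (if e \<in> T then x else 1) * p e / Z) = 1 \<Longrightarrow>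
      (\<lambda>e\<in>S. (if e \<in> T then x else 1) * p e / Z) \<in> qi_model m n S"
  shows "(\<Sum>e\<in>T. real (u e)) = (\<Sum>e\<in>T. (\<Sum>e\<in>S. real (u e)) * p e)"
proof -
  have p: "p \<in> qi_model m n S"
    and max: "\<And>q. q \<in> qi_model m n S \<Longrightarrow> likelihood S u q \<le> likelihood S u p"
  proof -
    have "p \<in> {q. is_arg_max (likelihood S u) (\<lambda>q. q \<in> qi_model m n S) q}"
      using mle unfolding is_mle_def by simp
    then show "p \<in> qi_model m n S" "\<And>q. q \<in> qi_model m n S \<Longrightarrow> likelihood S u q \<le> likelihood S u p"
      unfolding is_arg_max_def by (simp_all add: not_less)
  qed
  obtain p0: "\<And>e. e \<in> S \<Longrightarrow> 0 < p e" and p1: "sum p S = 1"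
    using qi_modelE[OF p] by metis
  define a where "a = sum u T"
  define U where "U = sum u S"
  define Z where "Z x = 1 + (x - 1) * sum p T" for x :: real
  \<comment> \<open>Up to a positive factor \<open>\<phi> x\<close> is the likelihood of
    \<open>p\<close> minus that of the rescaled point. So \<open>\<phi>\<close> has a minimum with
    value 0 at 1, and its derivative there is the margin equation.\<close>
  define \<phi> where "\<phi> x = Z x ^ U - x ^ a" for x
  have sumT: "(\<Sum>e\<in>S. (if e \<in> T then f e else 0)) = (\<Sum>e\<in>T. f e)" for f :: "index \<Rightarrow> real"
    using T fin by (intro sum.mono_neutral_cong_right) auto
  have Z: "(\<Sum>e\<in>S. (if e \<in> T then x else 1) * p e) = Z x" for x
  proof -
    have "(\<Sum>e\<in>S. (if e \<in> T then x else 1) * p e) = (\<Sum>e\<in>S. p e + (if e \<in> T then (x - 1) * p e else 0))"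
      by (intro sum.cong) (auto simp: algebra_simps)
    then show ?thesis
      by (simp add: sum.distrib p1 Z_def sum_distrib_left sumT)
  qed
  have "S \<noteq> {}"
    using p1 by auto
  have Zpos: "0 < Z x" if "0 < x" for x
    unfolding Z[symmetric] using that p0 fin \<open>S \<noteq> {}\<close> by (intro sum_pos) auto
  have ge: "0 \<le> \<phi> x" if x: "0 < x" for x
  proof -
    let ?q = "\<lambda>e\<in>S. (if e \<in> T then x else 1) * p e / Z x"
    have "?q \<in> qi_model m n S"
      using scale[OF x Zpos[OF x]] Zpos[OF x] Z[of x] by (simp add: sum_divide_distrib[symmetric])
    then have "likelihood S u ?q \<le> likelihood S u p"
      by (rule max)
    moreover have "likelihood S u ?q = x ^ a / Z x ^ U * likelihood S u p"
    proof -
      have "likelihood S u ?q = (\<Prod>e\<in>S. (if e \<in> T then x ^ u e else 1) * p e ^ u e / Z x ^ u e)"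
        unfolding likelihood_def by (intro prod.cong) (auto simp: power_mult_distrib power_divide)
      also have "\<dots> = (\<Prod>e\<in>S. if e \<in> T then x ^ u e else 1) * likelihood S u p / (\<Prod>e\<in>S. Z x ^ u e)"
        by (simp add: prod.distrib prod_dividef likelihood_def)
      also have "(\<Prod>e\<in>S. if e \<in> T then x ^ u e else 1) = (\<Prod>e\<in>T. x ^ u e)"
        using T fin by (intro prod.mono_neutral_cong_right) auto
      also have "(\<Prod>e\<in>T. x ^ u e) = x ^ a"
        by (simp add: power_sum a_def)
      also have "(\<Prod>e\<in>S. Z x ^ u e) = Z x ^ U"
        by (simp add: power_sum U_def)
      finally show ?thesis
        by (simp add: restrict_def)
    qed
    moreover have "0 < likelihood S u p"
      using p0 by (rule likelihood_pos)
    ultimately have "x ^ a / Z x ^ U \<le> 1"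
      using mult_right_le_imp_le[of "x ^ a / Z x ^ U" "likelihood S u p" 1] by simp
    then show ?thesis
      using Zpos[OF x] by (simp add: \<phi>_def divide_le_eq)
  qed
  have D: "(\<phi> has_real_derivative (real U * sum p T - real a)) (at 1)"
    unfolding \<phi>_def Z_def by (auto intro!: derivative_eq_intros)
  have "real U * sum p T - real a = 0"
  proof (rule DERIV_local_min[OF D])
    show "0 < (1::real)" by simp
    show "\<forall>y. \<bar>1 - y\<bar> < 1 \<longrightarrow> \<phi> 1 \<le> \<phi> y"
      using ge by (auto simp: \<phi>_def Z_def abs_if split: if_splits)
  qed
  then show ?thesis
    by (simp add: U_def a_def sum_distrib_left)
qed

text \<open>Scaling one row by \<open>x\<close> and dividing everything by \<open>Z\<close> only
  changes the row parameters, and likewise for columns; so \<open>mle_margin\<close> applies to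
  every row and every column.\<close>

lemma same_margins_if_is_mle:
  assumes S: "S \<subseteq> {1..m} \<times> {1..n}" and mle: "is_mle m n S u p"
  shows "same_margins S (\<lambda>e. real (u e)) (\<lambda>e. (\<Sum>e\<in>S. real (u e)) * p e)"
proof -
  have fin: "finite S"
    using S finite_subset by blast
  from qi_modelE[OF is_mle_mem[OF mle]] obtain s t where st: "\<And>e. e \<in> S \<Longrightarrow> p e = s (fst e) * t (snd e)"
    and p0: "\<And>e. e \<in> S \<Longrightarrow> 0 < p e"
    by metis
  show ?thesis
    unfolding same_margins_def
  proof (intro conjI allI)
    fix i
    show "(\<Sum>e | e \<in> S \<and> fst e = i. real (u e)) = (\<Sum>e | e \<in> S \<and> fst e = i. (\<Sum>e\<in>S. real (u e)) * p e)"
    proof (rule mle_margin[OF mle _ fin])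
      fix x Z :: real
      let ?q = "\<lambda>e. (if e \<in> {e \<in> S. fst e = i} then x else 1) * p e / Z"
      assume *: "0 < x" "0 < Z" "(\<Sum>e\<in>S. ?q e) = 1"
      have pos: "0 < ?q e" if "e \<in> S" for e
        using *(1,2) p0[OF that] by (cases "fst e = i") simp_all
      show "restrict ?q S \<in> qi_model m n S"
      proof (rule qi_modelI[OF S, where s = "\<lambda>i'. (if i' = i then x else 1) * s i' / Z" and t = t])
        show "sum (restrict ?q S) S = 1"
          using *(3) by simp
      qed (use pos in \<open>simp_all add: st\<close>)
    qed auto
  next
    fix j
    show "(\<Sum>e | e \<in> S \<and> snd e = j. real (u e)) = (\<Sum>e | e \<in> S \<and> snd e = j. (\<Sum>e\<in>S. real (u e)) * p e)"
    proof (rule mle_margin[OF mle _ fin])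
      fix x Z :: real
      let ?q = "\<lambda>e. (if e \<in> {e \<in> S. snd e = j} then x else 1) * p e / Z"
      assume *: "0 < x" "0 < Z" "(\<Sum>e\<in>S. ?q e) = 1"
      have pos: "0 < ?q e" if "e \<in> S" for e
        using *(1,2) p0[OF that] by (cases "snd e = j") simp_all
      show "restrict ?q S \<in> qi_model m n S"
      proof (rule qi_modelI[OF S, where s = s and t = "\<lambda>j'. (if j' = j then x else 1) * t j' / Z"])
        show "sum (restrict ?q S) S = 1"
          using *(3) by simp
      qed (use pos in \<open>simp_all add: st\<close>)
    qed auto
  qed
qed

section \<open>The clique formula\<close>

text \<open>Rectangles as a closure condition, with \<open>Domain C\<close> and
  \<open>Range C\<close> as sides. In this form unions of cliques can be checked entry by
  entry.\<close>

lemma clique_iff: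
  "clique S C \<longleftrightarrow> C \<subseteq> S \<and> C \<noteq> {} \<and> (\<forall>i j i' j'. (i, j) \<in> C \<and> (i', j') \<in> C \<longrightarrow> (i, j') \<in> C)" (is "_ \<longleftrightarrow> ?R")
proof
  assume "clique S C"
  then obtain I J where "C \<subseteq> S" "I \<noteq> {}" "J \<noteq> {}" "C = I \<times> J"
    unfolding clique_def by blast
  then show ?R
    by simp
next
  assume R: ?R
  have "C \<subseteq> Domain C \<times> Range C"
    by auto
  moreover have "Domain C \<times> Range C \<subseteq> C"
  proof
    fix e assume "e \<in> Domain C \<times> Range C"
    then obtain j i' where "(fst e, j) \<in> C" "(i', snd e) \<in> C"
      by auto
    with R have "(fst e, snd e) \<in> C" by blast
    then show "e \<in> C" by simp
  qed
  ultimately have "C = Domain C \<times> Range C" by (rule equalityI)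
  moreover have "C \<noteq> {}" "C \<subseteq> S"
    using R by simp_all
  moreover from this(1) have "Domain C \<noteq> {}" "Range C \<noteq> {}"
    by auto
  ultimately show "clique S C"
    unfolding clique_def by blast
qed

lemma clique_subset: "clique S C \<Longrightarrow> C \<subseteq> S"
  by (simp add: clique_def)

lemma clique_nonempty: "clique S C \<Longrightarrow> C \<noteq> {}"
  by (auto simp: clique_def)

lemma cliqueI: "C = I \<times> J \<Longrightarrow> I \<noteq> {} \<Longrightarrow> J \<noteq> {} \<Longrightarrow> C \<subseteq> S \<Longrightarrow> clique S C"
  unfolding clique_def by (intro conjI exI)

lemma clique_rectangle: "clique S C \<Longrightarrow> (i, j) \<in> C \<Longrightarrow> (i', j') \<in> C \<Longrightarrow> (i, j') \<in> C"
  unfolding clique_iff by blast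

lemma maximal_clique_eqI: "maximal_clique S D \<Longrightarrow> clique S C \<Longrightarrow> D \<subseteq> C \<Longrightarrow> D = C"
  unfolding maximal_clique_def by blast

lemma maximal_clique_exists:
  assumes "finite S" "clique S C"
  obtains D where "maximal_clique S D" "C \<subseteq> D"
proof -
  have fin: "finite {D. clique S D \<and> C \<subseteq> D}"
    by (rule finite_subset[of _ "Pow S"]) (use assms in \<open>auto dest: clique_subset\<close>)
  moreover have "C \<in> {D. clique S D \<and> C \<subseteq> D}"
    using assms by simp
  ultimately have "\<exists>D\<in>{D. clique S D \<and> C \<subseteq> D}. C \<subseteq> D \<and>
      (\<forall>D'\<in>{D. clique S D \<and> C \<subseteq> D}. D \<subseteq> D' \<longrightarrow> D = D')"
    by (rule finite_has_maximal2)
  then obtain D where D: "clique S D" "C \<subseteq> D" "\<And>D'. clique S D' \<Longrightarrow> C \<subseteq> D' \<Longrightarrow> D \<subseteq> D' \<Longrightarrow> D = D'"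
    by auto
  have "maximal_clique S D"
    unfolding maximal_clique_def
  proof (intro conjI allI impI notI)
    fix C' assume C': "clique S C'" "D \<subset> C'"
    then have "D \<subseteq> C'"
      by (rule_tac psubset_imp_subset)
    moreover have "C \<subseteq> C'"
      using D(2) \<open>D \<subseteq> C'\<close> by (rule subset_trans)
    ultimately have "D = C'"
      using D(3) C'(1) by simp
    then show False
      using C'(2) by simp
  qed (rule D(1))
  then show thesis
    using D(2) by (rule that)
qed

lemma Max_cliques_subset: "D \<in> Max_cliques S e \<Longrightarrow> D \<subseteq> S"
  by (simp add: Max_cliques_def maximal_clique_def clique_subset)

lemma pairwise_ints_subset: "C \<in> pairwise_ints S e \<Longrightarrow> C \<subseteq> S"
  by (auto simp: pairwise_ints_def dest: Max_cliques_subset)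

lemma finite_Max_cliques: "finite S \<Longrightarrow> finite (Max_cliques S e)"
  by (rule finite_subset[of _ "Pow S"]) (auto dest: Max_cliques_subset)

lemma finite_Int_cliques: "finite S \<Longrightarrow> finite (Int_cliques S e)"
  by (rule finite_subset[of _ "Pow S"]) (auto simp: Int_cliques_def dest: pairwise_ints_subset)

lemma mem_Max_cliques: "D \<in> Max_cliques S e \<Longrightarrow> e \<in> D"
  by (simp add: Max_cliques_def)

lemma Int_cliques_subset: "C \<in> Int_cliques S e \<Longrightarrow> C \<subseteq> S"
  by (auto simp: Int_cliques_def dest: pairwise_ints_subset)

lemma Max_prod_pos:
  fixes u :: "index \<Rightarrow> real"
  assumes "finite S" "\<And>e. e \<in> S \<Longrightarrow> 0 < u e"
  shows "0 < (\<Prod>D\<in>Max_cliques S e. sum u D)"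
proof (rule prod_pos)
  fix D assume D: "D \<in> Max_cliques S e"
  have "finite D" "D \<noteq> {}"
    using assms(1) finite_subset[OF Max_cliques_subset[OF D]] mem_Max_cliques[OF D] by auto
  then show "0 < sum u D"
    using assms(2) Max_cliques_subset[OF D] by (intro sum_pos) auto
qed

lemma Int_cliques_cong: "Max_cliques S e = Max_cliques S' e' \<Longrightarrow> Int_cliques S e = Int_cliques S' e'"
  by (simp add: Int_cliques_def pairwise_ints_def)

text \<open>\<open>Int_cliques\<close> depends only on the maximal cliques through the entry and on
  inclusions among their intersections. Two maps are needed because a maximal clique may grow while
  its intersections with the others stay the same, as in \<open>transfer_maximal\<close>.\<close>

lemma Int_cliques_transfer:
  assumes Max: "Max_cliques S' e' = \<beta> ` Max_cliques S e" and inj: "inj_on \<beta> (Max_cliques S e)"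
    and int: "\<And>D D'. D \<in> Max_cliques S e \<Longrightarrow> D' \<in> Max_cliques S e \<Longrightarrow> D \<noteq> D' \<Longrightarrow> \<beta> D \<inter> \<beta> D' = \<gamma> (D \<inter> D')"
    and ord: "\<And>X Y. X \<subseteq> S \<Longrightarrow> Y \<subseteq> S \<Longrightarrow> \<gamma> X \<subset> \<gamma> Y \<longleftrightarrow> X \<subset> Y"
  shows "Int_cliques S' e' = \<gamma> ` Int_cliques S e"
proof -
  have pw: "pairwise_ints S' e' = \<gamma> ` pairwise_ints S e"
  proof (intro equalityI subsetI)
    fix C assume "C \<in> pairwise_ints S' e'"
    then obtain D D' where "D \<in> Max_cliques S e" "D' \<in> Max_cliques S e" "\<beta> D \<noteq> \<beta> D'" "C = \<beta> D \<inter> \<beta> D'"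
      unfolding pairwise_ints_def Max by blast
    moreover from this have "D \<noteq> D'" by blast
    ultimately show "C \<in> \<gamma> ` pairwise_ints S e"
      unfolding pairwise_ints_def using int by blast
  next
    fix C assume "C \<in> \<gamma> ` pairwise_ints S e"
    then obtain D D' where D: "D \<in> Max_cliques S e" "D' \<in> Max_cliques S e" "D \<noteq> D'" "C = \<gamma> (D \<inter> D')"
      unfolding pairwise_ints_def by blast
    then have "\<beta> D \<noteq> \<beta> D'" "C = \<beta> D \<inter> \<beta> D'"
      using inj int by (auto dest: inj_onD)
    with D show "C \<in> pairwise_ints S' e'"
      unfolding pairwise_ints_def Max by blast
  qed
  have "(\<forall>C'\<in>pairwise_ints S e. \<not> \<gamma> C \<subset> \<gamma> C') \<longleftrightarrow> (\<forall>C'\<in>pairwise_ints S e. \<not> C \<subset> C')"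
    if "C \<in> pairwise_ints S e" for C
    using ord that pairwise_ints_subset by meson
  then show ?thesis
    unfolding Int_cliques_def pw by (auto simp: image_iff)
qed

text \<open>Fitted counts instead of probabilities: the factor \<open>count_sum u S\<close> is left
  out, so that margins can be compared with \<open>u\<close> directly.\<close>

definition clique_formula :: "index set \<Rightarrow> (index \<Rightarrow> real) \<Rightarrow> index \<Rightarrow> real" where
  "clique_formula S u e =
     ((\<Sum>e' | e' \<in> S \<and> fst e' = fst e. u e') * (\<Sum>e' | e' \<in> S \<and> snd e' = snd e. u e') *
       (\<Prod>C\<in>Int_cliques S e. sum u C)) / (\<Prod>D\<in>Max_cliques S e. sum u D)"

text \<open>Positivity is demanded also for the parameters of absent rows and columns: a pendant row
  may be attached to a new column \<open>j0\<close>, and its parameter is found by dividing by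
  \<open>t j0\<close>.\<close>

definition fits :: "index set \<Rightarrow> (index \<Rightarrow> real) \<Rightarrow> bool" where
  "fits S u \<longleftrightarrow>
     (\<exists>s t. (\<forall>i. 0 < s i) \<and> (\<forall>j. 0 < t j) \<and> (\<forall>e\<in>S. clique_formula S u e = s (fst e) * t (snd e))) \<and>
     same_margins S u (clique_formula S u)"

subsection \<open>Transposition\<close>

lemma clique_converse: "clique (S\<inverse>) (C\<inverse>) \<longleftrightarrow> clique S C"
proof -
  have imp: "clique (S\<inverse>) (C\<inverse>)" if C: "clique S C" for S C
  proof -
    from C obtain I J where "I \<noteq> {}" "J \<noteq> {}" "C = I \<times> J"
      unfolding clique_def by blast
    then have "J \<noteq> {} \<and> I \<noteq> {} \<and> C\<inverse> = J \<times> I"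
      by auto
    moreover have "C\<inverse> \<subseteq> S\<inverse>"
      using clique_subset[OF C] by simp
    ultimately show ?thesis
      unfolding clique_def by blast
  qed
  from imp[of "S\<inverse>" "C\<inverse>"] imp[of S C] show ?thesis
    by auto
qed

lemma psubset_converse: "X\<inverse> \<subset> Y\<inverse> \<longleftrightarrow> X \<subset> Y"
  by (simp add: psubset_eq)

lemma maximal_clique_converse: "maximal_clique (S\<inverse>) (D\<inverse>) \<longleftrightarrow> maximal_clique S D"
proof -
  have all: "(\<forall>C' :: index set. P C') \<longleftrightarrow> (\<forall>C'. P (C'\<inverse>))" for P
    by (metis converse_converse)
  show ?thesis
    unfolding maximal_clique_def all[of "\<lambda>C'. clique (S\<inverse>) C' \<longrightarrow> \<not> D\<inverse> \<subset> C'"]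
      clique_converse psubset_converse ..
qed

lemma Max_cliques_converse: "Max_cliques (S\<inverse>) (prod.swap e) = converse ` Max_cliques S e"
proof (intro equalityI subsetI)
  fix D assume "D \<in> Max_cliques (S\<inverse>) (prod.swap e)"
  then have "D\<inverse> \<in> Max_cliques S e"
    using maximal_clique_converse[of S "D\<inverse>"] by (cases e) (auto simp: Max_cliques_def)
  then show "D \<in> converse ` Max_cliques S e"
    by (metis converse_converse imageI)
next
  fix D assume "D \<in> converse ` Max_cliques S e"
  then show "D \<in> Max_cliques (S\<inverse>) (prod.swap e)"
    using maximal_clique_converse[of S] by (cases e) (auto simp: Max_cliques_def)
qed

lemma inj_on_converse: "inj_on converse A"
  by (rule inj_onI) (metis converse_converse)

lemma Int_cliques_converse: "Int_cliques (S\<inverse>) (prod.swap e) = converse ` Int_cliques S e"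
proof (rule Int_cliques_transfer[OF Max_cliques_converse inj_on_converse])
qed (auto simp: psubset_converse)

lemma sum_converse: "(\<Sum>e\<in>C\<inverse>. f e) = (\<Sum>e\<in>C. f (prod.swap e))"
  by (rule sum.reindex_bij_witness[where i = prod.swap and j = prod.swap]) auto

lemma sum_row_converse: "(\<Sum>e | e \<in> S\<inverse> \<and> fst e = i. f e) = (\<Sum>e | e \<in> S \<and> snd e = i. f (prod.swap e))"
  by (rule sum.reindex_bij_witness[where i = prod.swap and j = prod.swap]) auto

lemma sum_col_converse: "(\<Sum>e | e \<in> S\<inverse> \<and> snd e = j. f e) = (\<Sum>e | e \<in> S \<and> fst e = j. f (prod.swap e))"
  by (rule sum.reindex_bij_witness[where i = prod.swap and j = prod.swap]) auto

lemma clique_formula_converse: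
  "clique_formula (S\<inverse>) u (prod.swap e) = clique_formula S (\<lambda>e. u (prod.swap e)) e"
  unfolding clique_formula_def
  by (simp add: Int_cliques_converse Max_cliques_converse prod.reindex inj_on_converse sum_converse
      sum_row_converse sum_col_converse mult_ac del: converse_iff)

text \<open>Transposition exchanges the two families of parameters; with it, only new rows have to
  be studied below.\<close>

lemma fits_converse:
  assumes "fits S (\<lambda>e. u (prod.swap e))"
  shows "fits (S\<inverse>) u"
proof -
  from assms obtain s t where st: "\<forall>i. 0 < s i" "\<forall>j. 0 < t j"
    "\<forall>e\<in>S. clique_formula S (\<lambda>e. u (prod.swap e)) e = s (fst e) * t (snd e)"
    and marg: "same_margins S (\<lambda>e. u (prod.swap e)) (clique_formula S (\<lambda>e. u (prod.swap e)))"
    unfolding fits_def by blast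
  have "\<forall>e\<in>S\<inverse>. clique_formula (S\<inverse>) u e = t (fst e) * s (snd e)"
  proof
    fix e assume "e \<in> S\<inverse>"
    then show "clique_formula (S\<inverse>) u e = t (fst e) * s (snd e)"
      using st(3) clique_formula_converse[of S u "prod.swap e"] by (cases e) (auto simp: mult_ac)
  qed
  moreover have "same_margins (S\<inverse>) u (clique_formula (S\<inverse>) u)"
    using marg unfolding same_margins_def sum_row_converse sum_col_converse clique_formula_converse
    by blast
  ultimately show ?thesis
    unfolding fits_def using st by blast
qed

subsection \<open>Adding a pendant row\<close>

lemma maximal_cliqueD: "maximal_clique S D \<Longrightarrow> clique S D"
  by (simp add: maximal_clique_def)

lemma clique_mono: "clique S C \<Longrightarrow> C \<subseteq> S' \<Longrightarrow> clique S' C"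
  by (auto simp: clique_def)

lemma clique_section: "J \<noteq> {} \<Longrightarrow> J \<times> {j} \<subseteq> S \<Longrightarrow> clique S (J \<times> {j})"
  unfolding clique_def by blast

lemma clique_insert_col:
  assumes "clique S D" "\<And>i j'. (i, j') \<in> D \<Longrightarrow> (i, j) \<in> S"
  shows "clique S (D \<union> Domain D \<times> {j})"
proof -
  obtain I J where IJ: "I \<noteq> {}" "J \<noteq> {}" "D = I \<times> J"
    using assms(1) unfolding clique_def by blast
  then have "D \<union> Domain D \<times> {j} = I \<times> insert j J"
    by auto
  moreover have "D \<union> Domain D \<times> {j} \<subseteq> S"
    using clique_subset[OF assms(1)] assms(2) by auto
  ultimately show ?thesis
    unfolding clique_def using IJ(1) by blast
qed

locale pendant =
  fixes S :: "index set" and i0 j0 :: nat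
  assumes fin: "finite S" and new: "i0 \<notin> Domain S"
begin

abbreviation "S1 \<equiv> insert (i0, j0) S"
text \<open>The column \<open>j0\<close> before the new entry is added; it is empty, and then not a
  clique, if that column is new too.\<close>

abbreviation "K \<equiv> {i. (i, j0) \<in> S} \<times> {j0}"
abbreviation "K1 \<equiv> insert (i0, j0) K"

lemma new': "(i0, j) \<notin> S"
  using new by auto

lemma clique_with_pendant:
  assumes "clique S1 C" "(i0, j0) \<in> C"
  shows "C \<subseteq> K1"
proof
  fix e assume e: "e \<in> C"
  then have "(i0, snd e) \<in> C"
    using clique_rectangle[OF assms, of "fst e" "snd e"] by simp
  then have "snd e = j0"
    using clique_subset[OF assms(1)] new' by auto
  then show "e \<in> K1"
    using clique_subset[OF assms(1)] e by (cases e) auto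
qed

lemma clique_without_pendant: "clique S1 C \<Longrightarrow> (i0, j0) \<notin> C \<Longrightarrow> clique S C"
  by (rule clique_mono) (auto dest: clique_subset)

lemma clique_K1: "clique S1 K1"
proof -
  have "K1 = insert i0 {i. (i, j0) \<in> S} \<times> {j0}"
    by auto
  then show ?thesis
    using clique_section[of "insert i0 {i. (i, j0) \<in> S}" j0 S1] by auto
qed

lemma maximal_K1: "maximal_clique S1 K1"
  unfolding maximal_clique_def
proof (intro conjI allI impI notI)
  fix C' assume C': "clique S1 C'" "K1 \<subset> C'"
  then have "C' \<subseteq> K1"
    by (intro clique_with_pendant) auto
  then show False
    using C'(2) by simp
qed (rule clique_K1)

text \<open>A clique through the new entry cannot leave column \<open>j0\<close>, so
  \<open>K1\<close> is the only maximal clique gained. The only one that can be lost is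
  \<open>K\<close>, which \<open>K1\<close> properly contains.\<close>

lemma maximal_clique_pendant_iff:
  "maximal_clique S1 D \<longleftrightarrow> D = K1 \<or> maximal_clique S D \<and> D \<noteq> K"
proof
  assume D: "maximal_clique S1 D"
  show "D = K1 \<or> maximal_clique S D \<and> D \<noteq> K"
  proof (cases "(i0, j0) \<in> D")
    case True
    then have "D \<subseteq> K1"
      using clique_with_pendant maximal_cliqueD[OF D] by blast
    then show ?thesis
      using maximal_clique_eqI[OF D clique_K1] by simp
  next
    case False
    have "clique S D"
      using clique_without_pendant maximal_cliqueD[OF D] False by blast
    moreover have "\<not> D \<subset> C'" if "clique S C'" for C'
    proof -
      have "C' \<subseteq> S1"
        using clique_subset[OF that] by (rule subset_insertI2)
      then have "clique S1 C'"
        by (rule clique_mono[OF that])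
      then show ?thesis
        using D unfolding maximal_clique_def by simp
    qed
    moreover have "D \<noteq> K"
    proof
      assume "D = K"
      then have "D = K1"
        using maximal_clique_eqI[OF D clique_K1] by blast
      with False show False by simp
    qed
    ultimately show ?thesis
      unfolding maximal_clique_def by blast
  qed
next
  assume "D = K1 \<or> maximal_clique S D \<and> D \<noteq> K"
  then show "maximal_clique S1 D"
  proof
    assume D: "maximal_clique S D \<and> D \<noteq> K"
    have cD: "clique S D"
      using D maximal_cliqueD by blast
    have "\<not> D \<subset> C'" if C': "clique S1 C'" for C'
    proof
      assume sub: "D \<subset> C'"
      show False
      proof (cases "(i0, j0) \<in> C'")
        case True
        have "D \<subseteq> K"
          using clique_with_pendant[OF C' True] sub clique_subset[OF cD] new' by blast
        moreover have "clique S K"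
          using \<open>D \<subseteq> K\<close> clique_nonempty[OF cD] by (intro clique_section) auto
        ultimately show False
          using D maximal_clique_eqI by blast
      next
        case False
        then show False
          using D clique_without_pendant[OF C'] sub unfolding maximal_clique_def by blast
      qed
    qed
    moreover have "clique S1 D"
      using clique_subset[OF cD] by (intro clique_mono[OF cD] subset_insertI2)
    ultimately show ?thesis
      unfolding maximal_clique_def by simp
  qed (use maximal_K1 in simp)
qed

lemma Max_cliques_new: "Max_cliques S1 (i0, j0) = {K1}"
proof -
  have "(i0, j0) \<notin> D" if "maximal_clique S D" for D
    using clique_subset[OF maximal_cliqueD[OF that]] new' by blast
  then show ?thesis
    unfolding Max_cliques_def maximal_clique_pendant_iff by auto
qed

lemma Int_cliques_new: "Int_cliques S1 (i0, j0) = {}"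
  by (simp add: Int_cliques_def pairwise_ints_def Max_cliques_new)

lemma Max_cliques_other: "j \<noteq> j0 \<Longrightarrow> Max_cliques S1 (i, j) = Max_cliques S (i, j)"
  unfolding Max_cliques_def maximal_clique_pendant_iff by auto

context
  fixes i :: nat
  assumes i: "(i, j0) \<in> S"
begin

lemma Max_cliques_col: "Max_cliques S1 (i, j0) = insert K1 (Max_cliques S (i, j0) - {K})"
  unfolding Max_cliques_def maximal_clique_pendant_iff using i by auto

lemma Max_cliques_col_row: "D \<in> Max_cliques S (i, j0) \<Longrightarrow> (a, b) \<in> D \<Longrightarrow> (a, j0) \<in> D"
  unfolding Max_cliques_def using clique_rectangle maximal_cliqueD by blast

lemma K1_Int: "D \<in> Max_cliques S (i, j0) \<Longrightarrow> K1 \<inter> D = K \<inter> D"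
  using Max_cliques_subset new' by blast

lemma K1_notin: "K1 \<notin> Max_cliques S (i, j0)"
  using Max_cliques_subset new' by blast

lemma clique_K: "clique S K"
  using i by (intro clique_section) auto

text \<open>\<open>K1\<close> takes over the role of \<open>K\<close>. No old clique contains the
  new entry, so intersections with \<open>K1\<close> and with \<open>K\<close> coincide; the product
  over maximal cliques changes in one factor only.\<close>

lemma transfer_maximal:
  assumes "K \<in> Max_cliques S (i, j0)"
  shows "Int_cliques S1 (i, j0) = Int_cliques S (i, j0)"
    and "(\<Prod>D\<in>Max_cliques S1 (i, j0). f D) * f K = (\<Prod>D\<in>Max_cliques S (i, j0). f D :: real) * f K1"
proof -
  let ?\<beta> = "\<lambda>D. if D = K then K1 else D"
  have Max: "Max_cliques S1 (i, j0) = ?\<beta> ` Max_cliques S (i, j0)"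
    unfolding Max_cliques_col using assms by auto
  have inj: "inj_on ?\<beta> (Max_cliques S (i, j0))"
    using K1_notin by (auto intro!: inj_onI split: if_splits)
  have "Int_cliques S1 (i, j0) = (\<lambda>C. C) ` Int_cliques S (i, j0)"
  proof (rule Int_cliques_transfer[OF Max inj])
    fix D D' assume D: "D \<in> Max_cliques S (i, j0)" "D' \<in> Max_cliques S (i, j0)" "D \<noteq> D'"
    then show "?\<beta> D \<inter> ?\<beta> D' = D \<inter> D'"
      using K1_Int[OF D(1)] K1_Int[OF D(2)] by (cases "D = K"; cases "D' = K") (simp_all add: Int_commute)
  qed simp
  then show "Int_cliques S1 (i, j0) = Int_cliques S (i, j0)"
    by simp
  have "K1 \<notin> Max_cliques S (i, j0) - {K}" "finite (Max_cliques S (i, j0) - {K})"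
    using K1_notin finite_Max_cliques[OF fin] by auto
  then show "(\<Prod>D\<in>Max_cliques S1 (i, j0). f D) * f K = (\<Prod>D\<in>Max_cliques S (i, j0). f D) * f K1"
    unfolding Max_cliques_col using finite_Max_cliques[OF fin] assms
    by (simp add: prod.remove[of "Max_cliques S (i, j0)" K] mult_ac)
qed

text \<open>Now \<open>K1\<close> is an additional maximal clique, and it meets an old maximal
  clique above \<open>K\<close> exactly in \<open>K\<close>. It remains to see that \<open>K\<close>
  is incomparable with all old pairwise intersections, so that it joins them without displacing
  any.\<close>

lemma transfer_not_maximal:
  assumes K: "K \<notin> Max_cliques S (i, j0)"
  shows "Int_cliques S1 (i, j0) = insert K (Int_cliques S (i, j0))" "K \<notin> Int_cliques S (i, j0)"
    and "Max_cliques S1 (i, j0) = insert K1 (Max_cliques S (i, j0))"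
proof -
  show Max: "Max_cliques S1 (i, j0) = insert K1 (Max_cliques S (i, j0))"
    unfolding Max_cliques_col using K by auto
  obtain D0 where D0: "maximal_clique S D0" "K \<subseteq> D0"
    using maximal_clique_exists[OF fin clique_K] .
  have D0': "D0 \<in> Max_cliques S (i, j0)"
    using D0 i by (auto simp: Max_cliques_def)
  then have "D0 \<noteq> K"
    using K by blast
  with D0 obtain a j1 where a: "(a, j1) \<in> D0" "(a, j1) \<notin> K"
    by auto
  have j1: "j1 \<noteq> j0"
    using a Max_cliques_subset[OF D0'] by auto
  \<comment> \<open>\<open>j1\<close> is adjacent to every row that is adjacent to \<open>j0\<close>, hence occurs in every
    maximal clique through \<open>(i, j0)\<close>.\<close>
  have common: "(i, j1) \<in> D" if D: "D \<in> Max_cliques S (i, j0)" for D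
  proof -
    have "(x, j1) \<in> S" if "(x, y) \<in> D" for x y
    proof -
      have "(x, j0) \<in> K"
        using Max_cliques_col_row[OF D that] Max_cliques_subset[OF D] by auto
      then have "(x, j1) \<in> D0"
        using D0 a(1) clique_rectangle[OF maximal_cliqueD] by blast
      then show ?thesis
        using Max_cliques_subset[OF D0'] by blast
    qed
    moreover have "maximal_clique S D"
      using D by (simp add: Max_cliques_def)
    ultimately have "D = D \<union> Domain D \<times> {j1}"
      using clique_insert_col[of S D j1] maximal_cliqueD maximal_clique_eqI by blast
    moreover have "(i, j1) \<in> Domain D \<times> {j1}"
      using mem_Max_cliques[OF D] by auto
    ultimately show ?thesis by blast
  qed
  \<comment> \<open>All old intersections contain \<open>(i, j1)\<close>, which lies outside column
    \<open>j0\<close>.\<close>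
  have notsub: "\<not> C \<subseteq> K" if "C \<in> pairwise_ints S (i, j0)" for C
  proof -
    from that have "(i, j1) \<in> C"
      unfolding pairwise_ints_def using common by blast
    then show ?thesis using j1 by blast
  qed
  \<comment> \<open>A clique through \<open>(i, j0)\<close> only uses rows of \<open>K\<close>. Two
    of them that contain \<open>K\<close> therefore have the same rows, and their union is again a
    rectangle. Hence no intersection of two distinct maximal ones contains \<open>K\<close>.\<close>
  have sub_unique: "D = D'" if D: "D \<in> Max_cliques S (i, j0)" "D' \<in> Max_cliques S (i, j0)"
    and sub: "K \<subseteq> D" "K \<subseteq> D'" for D D'
  proof -
    have cl: "clique S (D \<union> D')"
      unfolding clique_iff
    proof (intro conjI allI impI)
      show "D \<union> D' \<subseteq> S" "D \<union> D' \<noteq> {}"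
        using D Max_cliques_subset mem_Max_cliques by blast+
      fix x y x' y' assume *: "(x, y) \<in> D \<union> D' \<and> (x', y') \<in> D \<union> D'"
      then have "(x, j0) \<in> K"
        using Max_cliques_col_row D Max_cliques_subset by blast
      then have x: "(x, j0) \<in> D" "(x, j0) \<in> D'"
        using sub by blast+
      have c: "clique S D" "clique S D'"
        using D by (simp_all add: Max_cliques_def maximal_cliqueD)
      from * have "(x', y') \<in> D \<or> (x', y') \<in> D'"
        by simp
      then show "(x, y') \<in> D \<union> D'"
        using clique_rectangle[OF c(1) x(1)] clique_rectangle[OF c(2) x(2)] by blast
    qed
    have "D = D \<union> D'" "D' = D \<union> D'"
      using D maximal_clique_eqI[OF _ cl] by (simp_all add: Max_cliques_def)
    then show ?thesis by simp
  qed
  have pw: "pairwise_ints S1 (i, j0) = pairwise_ints S (i, j0) \<union> (\<lambda>D. K \<inter> D) ` Max_cliques S (i, j0)"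
  proof (intro equalityI subsetI)
    fix C assume "C \<in> pairwise_ints S1 (i, j0)"
    then obtain D D' where D: "D \<in> insert K1 (Max_cliques S (i, j0))" "D' \<in> insert K1 (Max_cliques S (i, j0))"
      "D \<noteq> D'" "C = D \<inter> D'"
      unfolding pairwise_ints_def Max by blast
    then consider "D = K1" "D' \<in> Max_cliques S (i, j0)" | "D' = K1" "D \<in> Max_cliques S (i, j0)"
      | "D \<in> Max_cliques S (i, j0)" "D' \<in> Max_cliques S (i, j0)"
      by blast
    then show "C \<in> pairwise_ints S (i, j0) \<union> (\<lambda>D. K \<inter> D) ` Max_cliques S (i, j0)"
    proof cases
      case 1
      then have "C = K \<inter> D'"
        using D(4) K1_Int by simp
      with 1 show ?thesis by blast
    next
      case 2
      then have "C = K \<inter> D"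
        using D(4) K1_Int by (simp add: Int_commute)
      with 2 show ?thesis by blast
    next
      case 3
      with D show ?thesis
        unfolding pairwise_ints_def by blast
    qed
  next
    fix C assume "C \<in> pairwise_ints S (i, j0) \<union> (\<lambda>D. K \<inter> D) ` Max_cliques S (i, j0)"
    then show "C \<in> pairwise_ints S1 (i, j0)"
    proof
      assume "C \<in> pairwise_ints S (i, j0)"
      then show ?thesis
        unfolding pairwise_ints_def Max by blast
    next
      assume "C \<in> (\<lambda>D. K \<inter> D) ` Max_cliques S (i, j0)"
      then obtain D where D: "D \<in> Max_cliques S (i, j0)" "C = K \<inter> D"
        by blast
      then have "C = K1 \<inter> D" "K1 \<noteq> D"
        using K1_Int K1_notin by blast+
      with D show ?thesis
        unfolding pairwise_ints_def Max by blast
    qed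
  qed
  show "K \<notin> Int_cliques S (i, j0)"
    using notsub unfolding Int_cliques_def by blast
  show "Int_cliques S1 (i, j0) = insert K (Int_cliques S (i, j0))"
  proof (intro equalityI subsetI)
    fix C assume C: "C \<in> Int_cliques S1 (i, j0)"
    then have max: "\<not> C \<subset> C'" if "C' \<in> pairwise_ints S1 (i, j0)" for C'
      using that unfolding Int_cliques_def by blast
    from C consider "C \<in> pairwise_ints S (i, j0)" | D where "D \<in> Max_cliques S (i, j0)" "C = K \<inter> D"
      unfolding Int_cliques_def pw by blast
    then show "C \<in> insert K (Int_cliques S (i, j0))"
    proof cases
      case 1
      then show ?thesis
        using max unfolding pw Int_cliques_def by blast
    next
      case 2
      have "K \<in> pairwise_ints S1 (i, j0)"
        unfolding pw using D0(2) D0' by blast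
      then have "\<not> C \<subset> K"
        by (rule max)
      with 2 show ?thesis by blast
    qed
  next
    fix C assume "C \<in> insert K (Int_cliques S (i, j0))"
    then show "C \<in> Int_cliques S1 (i, j0)"
    proof
      assume C: "C = K"
      have "\<not> K \<subset> C'" if "C' \<in> pairwise_ints S1 (i, j0)" for C'
      proof -
        have "\<not> K \<subset> C'" if C': "C' \<in> pairwise_ints S (i, j0)"
        proof
          assume "K \<subset> C'"
          moreover obtain D D' where "D \<in> Max_cliques S (i, j0)" "D' \<in> Max_cliques S (i, j0)" "D \<noteq> D'" "C' = D \<inter> D'"
            using C' unfolding pairwise_ints_def by blast
          ultimately show False
            using sub_unique[of D D'] by blast
        qed
        then show ?thesis
          using that unfolding pw by blast
      qed
      moreover have "K \<in> pairwise_ints S1 (i, j0)"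
        unfolding pw using D0(2) D0' by blast
      ultimately show ?thesis
        unfolding Int_cliques_def C by blast
    next
      assume C: "C \<in> Int_cliques S (i, j0)"
      then have Cpw: "C \<in> pairwise_ints S (i, j0)" and max: "\<And>C'. C' \<in> pairwise_ints S (i, j0) \<Longrightarrow> \<not> C \<subset> C'"
        unfolding Int_cliques_def by blast+
      have "\<not> C \<subset> C'" if "C' \<in> pairwise_ints S1 (i, j0)" for C'
        using that max notsub[OF Cpw] unfolding pw by blast
      then show ?thesis
        unfolding Int_cliques_def using Cpw by (simp add: pw)
    qed
  qed
qed

end

lemma sum_S1_row: "(\<Sum>e | e \<in> S1 \<and> fst e = i. f e) = (if i = i0 then f (i0, j0) else (\<Sum>e | e \<in> S \<and> fst e = i. f e :: real))"
proof (cases "i = i0")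
  case True
  have "{e. e \<in> S1 \<and> fst e = i} = {(i0, j0)}"
    using new' True by auto
  then show ?thesis using True by simp
next
  case False
  then have "{e. e \<in> S1 \<and> fst e = i} = {e. e \<in> S \<and> fst e = i}"
    by auto
  then show ?thesis using False by simp
qed

lemma sum_S1_col: "(\<Sum>e | e \<in> S1 \<and> snd e = j. f e) =
    (if j = j0 then f (i0, j0) else 0) + (\<Sum>e | e \<in> S \<and> snd e = j. f e :: real)"
proof (cases "j = j0")
  case True
  have "{e. e \<in> S1 \<and> snd e = j} = insert (i0, j0) {e. e \<in> S \<and> snd e = j}"
    using True by auto
  then show ?thesis using True fin new' by simp
next
  case False
  then have "{e. e \<in> S1 \<and> snd e = j} = {e. e \<in> S \<and> snd e = j}"
    by auto
  then show ?thesis using False by simp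
qed

lemma K_eq: "K = {e \<in> S. snd e = j0}"
  by auto

lemma sum_K1: "sum u K1 = (\<Sum>e | e \<in> S1 \<and> snd e = j0. u e)"
  by (rule sum.cong) auto

text \<open>Only column \<open>j0\<close> needs work, where the column sum grows from
  \<open>sum u K\<close> to \<open>sum u K1\<close>. If \<open>K\<close> was maximal, the
  denominator grows in the same ratio; otherwise the formula gains \<open>sum u K\<close> above and
  \<open>sum u K1\<close> below. Either way everything cancels.\<close>

lemma clique_formula_pendant:
  assumes pos: "\<And>e. e \<in> S1 \<Longrightarrow> 0 < u e"
  shows "clique_formula S1 u (i0, j0) = u (i0, j0)"
    and "e \<in> S \<Longrightarrow> clique_formula S1 u e = clique_formula S u e"
proof -
  have K1pos: "0 < sum u K1"
    using fin pos by (intro sum_pos) (auto simp: K_eq)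
  then show "clique_formula S1 u (i0, j0) = u (i0, j0)"
    unfolding clique_formula_def Max_cliques_new Int_cliques_new fst_conv snd_conv sum_S1_row
      sum_K1[symmetric] by simp
  assume e: "e \<in> S"
  obtain i j where ij: "e = (i, j)"
    by (cases e)
  have i: "i \<noteq> i0"
    using e ij new' by auto
  show "clique_formula S1 u e = clique_formula S u e"
  proof (cases "j = j0")
    case False
    then show ?thesis
      unfolding clique_formula_def ij fst_conv snd_conv sum_S1_row sum_S1_col
        Int_cliques_cong[OF Max_cliques_other[OF False]] Max_cliques_other[OF False]
      using i by simp
  next
    case True
    have iS: "(i, j0) \<in> S"
      using e ij True by simp
    have Kpos: "0 < sum u K"
      using fin pos iS by (intro sum_pos) (auto simp: K_eq)
    have col: "(\<Sum>e | e \<in> S1 \<and> snd e = j0. u e) = sum u K1" "(\<Sum>e | e \<in> S \<and> snd e = j0. u e) = sum u K"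
      by (rule sum_K1[symmetric], simp only: K_eq)
    have row: "(\<Sum>e | e \<in> S1 \<and> fst e = i. u e) = (\<Sum>e | e \<in> S \<and> fst e = i. u e)"
      unfolding sum_S1_row using i by simp
    have Maxpos: "0 < (\<Prod>D\<in>Max_cliques S (i, j0). sum u D)"
      "0 < (\<Prod>D\<in>Max_cliques S1 (i, j0). sum u D)"
      using fin pos by (auto intro!: Max_prod_pos)
    show ?thesis
    proof (cases "K \<in> Max_cliques S (i, j0)")
      case mx: True
      show ?thesis
        unfolding clique_formula_def ij True fst_conv snd_conv col row
        using transfer_maximal(2)[OF iS mx, of "sum u"] Maxpos K1pos Kpos
        by (simp add: transfer_maximal(1)[OF iS mx] frac_eq_eq mult_ac)
    next
      case mx: False
      have "(\<Prod>C\<in>Int_cliques S1 (i, j0). sum u C) = sum u K * (\<Prod>C\<in>Int_cliques S (i, j0). sum u C)"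
        using transfer_not_maximal(1,2)[OF iS mx] finite_Int_cliques[OF fin] by simp
      moreover have "(\<Prod>D\<in>Max_cliques S1 (i, j0). sum u D) = sum u K1 * (\<Prod>D\<in>Max_cliques S (i, j0). sum u D)"
        using transfer_not_maximal(3)[OF iS mx] finite_Max_cliques[OF fin] K1_notin[OF iS] by simp
      ultimately show ?thesis
        unfolding clique_formula_def ij True fst_conv snd_conv col row
        using Maxpos K1pos Kpos by simp
    qed
  qed
qed

lemma fits_pendant:
  assumes pos: "\<And>e. e \<in> S1 \<Longrightarrow> 0 < u e" and "fits S u"
  shows "fits S1 u"
proof -
  from assms(2) obtain s t where st: "\<forall>i. 0 < s i" "\<forall>j. 0 < t j"
    "\<forall>e\<in>S. clique_formula S u e = s (fst e) * t (snd e)"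
    and marg: "same_margins S u (clique_formula S u)"
    unfolding fits_def by blast
  \<comment> \<open>The new row has one entry, so its parameter is free to match that entry.\<close>
  let ?s = "s(i0 := u (i0, j0) / t j0)"
  have "\<forall>i. 0 < ?s i"
    using st pos by simp
  moreover have "clique_formula S1 u e = ?s (fst e) * t (snd e)" if "e \<in> S1" for e
  proof (cases "e = (i0, j0)")
    case True
    then show ?thesis
      using clique_formula_pendant(1)[OF pos] st(2)[rule_format, of j0] by simp
  next
    case False
    then have "e \<in> S" "fst e \<noteq> i0"
      using that new' by (auto simp: prod_eq_iff) (metis new' prod.collapse)
    then show ?thesis
      using clique_formula_pendant(2)[OF pos] st(3) by simp
  qed
  moreover have "(\<Sum>e | e \<in> S \<and> fst e = i. clique_formula S1 u e) = (\<Sum>e | e \<in> S \<and> fst e = i. clique_formula S u e)"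
    "(\<Sum>e | e \<in> S \<and> snd e = i. clique_formula S1 u e) = (\<Sum>e | e \<in> S \<and> snd e = i. clique_formula S u e)" for i
    using clique_formula_pendant(2)[OF pos] by (auto intro!: sum.cong)
  then have "same_margins S1 u (clique_formula S1 u)"
    using marg clique_formula_pendant(1)[OF pos] unfolding same_margins_def sum_S1_row sum_S1_col
    by simp
  ultimately show ?thesis
    unfolding fits_def using st(2) by blast
qed

end

subsection \<open>Adding a twin row\<close>

locale twin =
  fixes S :: "index set" and i1 i2 :: nat
  assumes fin: "finite S" and old: "i1 \<in> Domain S" and new: "i2 \<notin> Domain S"
begin

text \<open>One map in two roles: on \<open>S\<close> it duplicates the row \<open>i1\<close>, on a
  clique of \<open>S\<close> it gives the corresponding clique of the larger set.\<close>

definition ext :: "index set \<Rightarrow> index set" where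
  "ext D = D \<union> {i2} \<times> D `` {i1}"

abbreviation "S2 \<equiv> ext S"

lemma new': "(i2, j) \<notin> S"
  using new by auto

lemma neq: "i1 \<noteq> i2"
  using old new by auto

lemma mem_ext: "(i, j) \<in> ext D \<longleftrightarrow> (i, j) \<in> D \<or> i = i2 \<and> (i1, j) \<in> D"
  by (auto simp: ext_def)

lemma ext_restrict: "D \<subseteq> S \<Longrightarrow> ext D \<inter> (- {i2}) \<times> UNIV = D"
  using new' by (auto simp: ext_def)

lemma ext_subset_iff: "X \<subseteq> S \<Longrightarrow> Y \<subseteq> S \<Longrightarrow> ext X \<subseteq> ext Y \<longleftrightarrow> X \<subseteq> Y"
proof
  assume XY: "X \<subseteq> S" "Y \<subseteq> S" "ext X \<subseteq> ext Y"
  then have "ext X \<inter> (- {i2}) \<times> UNIV \<subseteq> ext Y \<inter> (- {i2}) \<times> UNIV"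
    by (rule_tac Int_mono) auto
  with XY show "X \<subseteq> Y"
    by (simp add: ext_restrict)
next
  show "X \<subseteq> Y \<Longrightarrow> ext X \<subseteq> ext Y"
    by (auto simp: ext_def)
qed

lemma ext_eq_iff: "X \<subseteq> S \<Longrightarrow> Y \<subseteq> S \<Longrightarrow> ext X = ext Y \<longleftrightarrow> X = Y"
  by (simp add: set_eq_subset ext_subset_iff)

lemma ext_psubset_iff: "X \<subseteq> S \<Longrightarrow> Y \<subseteq> S \<Longrightarrow> ext X \<subset> ext Y \<longleftrightarrow> X \<subset> Y"
  by (simp add: psubset_eq ext_subset_iff ext_eq_iff)

lemma ext_Int: "X \<subseteq> S \<Longrightarrow> Y \<subseteq> S \<Longrightarrow> ext X \<inter> ext Y = ext (X \<inter> Y)"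
  using new' by (auto simp: ext_def)

lemma clique_ext: "clique S D \<Longrightarrow> clique S2 (ext D)"
proof -
  assume D: "clique S D"
  then obtain I J where IJ: "I \<noteq> {}" "J \<noteq> {}" "D = I \<times> J"
    unfolding clique_def by blast
  have "ext D = (if i1 \<in> I then insert i2 I else I) \<times> J"
    using IJ by (auto simp: ext_def)
  moreover have "(if i1 \<in> I then insert i2 I else I) \<noteq> {}"
    using IJ by simp
  moreover have "ext D \<subseteq> S2"
    using clique_subset[OF D] by (auto simp: ext_def)
  ultimately show ?thesis
    using IJ(2) by (intro cliqueI)
qed

text \<open>Twins have the same neighbours, so replacing \<open>i2\<close> by \<open>i1\<close>
  turns a clique of \<open>S2\<close> into one of \<open>S\<close>, whose extension covers the
  original. Consequently the maximal cliques of \<open>S2\<close> are exactly the extensions of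
  those of \<open>S\<close>.\<close>

lemma clique_below_ext:
  assumes C: "clique S2 C"
  obtains D where "clique S D" "C \<subseteq> ext D"
proof -
  obtain I J where IJ: "I \<noteq> {}" "J \<noteq> {}" "C = I \<times> J" "C \<subseteq> S2"
    using C unfolding clique_def by blast
  let ?I = "(if i2 \<in> I then insert i1 I else I) - {i2}"
  have "?I \<noteq> {}"
    using IJ(1) neq by auto
  moreover have "?I \<times> J \<subseteq> S"
  proof
    fix e assume e: "e \<in> ?I \<times> J"
    then have "fst e \<noteq> i2" "e \<in> C \<or> fst e = i1 \<and> (i2, snd e) \<in> C"
      using IJ(3) by (auto split: if_splits)
    then show "e \<in> S"
      using IJ(4) new' mem_ext[of "fst e" "snd e" S] mem_ext[of "i2" "snd e" S] by (cases e) auto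
  qed
  ultimately have "clique S (?I \<times> J)"
    using IJ(2) by (intro cliqueI[OF refl])
  moreover have "C \<subseteq> ext (?I \<times> J)"
    using IJ(3) neq by (auto simp: ext_def)
  ultimately show thesis
    by (rule that)
qed

lemma maximal_clique_ext: "D \<subseteq> S \<Longrightarrow> maximal_clique S2 (ext D) \<longleftrightarrow> maximal_clique S D"
proof
  assume D: "D \<subseteq> S" "maximal_clique S2 (ext D)"
  obtain D' where D': "clique S D'" "ext D \<subseteq> ext D'"
    using clique_below_ext[OF maximal_cliqueD[OF D(2)]] .
  then have "ext D = ext D'"
    using maximal_clique_eqI[OF D(2) clique_ext] by simp
  then have cD: "clique S D"
    using D'(1) D(1) clique_subset[OF D'(1)] by (simp add: ext_eq_iff)
  have "\<not> D \<subset> C" if C: "clique S C" for C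
    using D(2) clique_ext[OF C] ext_psubset_iff[OF D(1) clique_subset[OF C]]
    unfolding maximal_clique_def by simp
  with cD show "maximal_clique S D"
    unfolding maximal_clique_def by simp
next
  assume D: "D \<subseteq> S" "maximal_clique S D"
  have "\<not> ext D \<subset> C" if C: "clique S2 C" for C
  proof
    assume sub: "ext D \<subset> C"
    obtain D' where D': "clique S D'" "C \<subseteq> ext D'"
      using clique_below_ext[OF C] .
    then have "D \<subset> D'"
      using sub ext_psubset_iff[OF D(1) clique_subset[OF D'(1)]] by (simp add: psubset_subset_trans)
    with D(2) D'(1) show False
      unfolding maximal_clique_def by simp
  qed
  then show "maximal_clique S2 (ext D)"
    using clique_ext[OF maximal_cliqueD[OF D(2)]] unfolding maximal_clique_def by simp
qed

lemma maximal_clique_S2E: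
  assumes "maximal_clique S2 C"
  obtains D where "maximal_clique S D" "C = ext D"
proof -
  obtain D where D: "clique S D" "C \<subseteq> ext D"
    using clique_below_ext[OF maximal_cliqueD[OF assms]] .
  then have "C = ext D"
    using maximal_clique_eqI[OF assms clique_ext] by simp
  moreover have "maximal_clique S D"
    using assms calculation maximal_clique_ext[OF clique_subset[OF D(1)]] by simp
  ultimately show thesis
    using that by simp
qed

lemma Max_cliques_ext:
  assumes "i \<noteq> i2"
  shows "Max_cliques S2 (i, j) = ext ` Max_cliques S (i, j)"
proof (intro equalityI subsetI)
  fix C assume C: "C \<in> Max_cliques S2 (i, j)"
  then obtain D where "maximal_clique S D" "C = ext D"
    using maximal_clique_S2E by (auto simp: Max_cliques_def)
  then show "C \<in> ext ` Max_cliques S (i, j)"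
    using C assms by (auto simp: Max_cliques_def mem_ext)
next
  fix C assume "C \<in> ext ` Max_cliques S (i, j)"
  then show "C \<in> Max_cliques S2 (i, j)"
    using maximal_clique_ext[OF Max_cliques_subset] by (auto simp: Max_cliques_def mem_ext)
qed

lemma Max_cliques_twin: "Max_cliques S2 (i2, j) = Max_cliques S2 (i1, j)"
proof -
  have "(i2, j) \<in> D \<longleftrightarrow> (i1, j) \<in> D" if D: "maximal_clique S2 D" for D
  proof -
    obtain D' where D': "maximal_clique S D'" "D = ext D'"
      using maximal_clique_S2E[OF D] .
    then have "(i2, j) \<notin> D'"
      using clique_subset[OF maximal_cliqueD[OF D'(1)]] new' by blast
    then show ?thesis
      using neq by (simp add: D'(2) mem_ext)
  qed
  then show ?thesis
    unfolding Max_cliques_def by blast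
qed

lemma Int_cliques_ext:
  assumes "i \<noteq> i2"
  shows "Int_cliques S2 (i, j) = ext ` Int_cliques S (i, j)"
proof (rule Int_cliques_transfer[OF Max_cliques_ext[OF assms]])
  show "inj_on ext (Max_cliques S (i, j))"
    using ext_eq_iff Max_cliques_subset by (auto intro!: inj_onI)
  show "X \<subseteq> S \<Longrightarrow> Y \<subseteq> S \<Longrightarrow> ext X \<subset> ext Y \<longleftrightarrow> X \<subset> Y" for X Y
    by (rule ext_psubset_iff)
qed (simp add: ext_Int Max_cliques_subset)

text \<open>Chosen so that every clique of \<open>S\<close> has the same sum as its extension has
  under \<open>u\<close>, see \<open>sum_ext\<close>.\<close>

definition merge :: "(index \<Rightarrow> real) \<Rightarrow> index \<Rightarrow> real" where
  "merge u e = u e + (if fst e = i1 then u (i2, snd e) else 0)"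

lemma sum_ext:
  assumes "D \<subseteq> S"
  shows "sum u (ext D) = sum (merge u) D"
proof -
  have finD: "finite D"
    using assms fin finite_subset by blast
  have "sum u (ext D) = sum u D + sum u ({i2} \<times> D `` {i1})"
    unfolding ext_def
    by (rule sum.union_disjoint) (use finD assms new' in auto)
  also have "sum u ({i2} \<times> D `` {i1}) = (\<Sum>e | e \<in> D \<and> fst e = i1. u (i2, snd e))"
    by (rule sum.reindex_bij_witness[where i = "\<lambda>e. (i2, snd e)" and j = "\<lambda>e. (i1, snd e)"]) auto
  also have "\<dots> = (\<Sum>e\<in>D. if fst e = i1 then u (i2, snd e) else 0)"
    using finD by (rule sum.inter_filter)
  finally show ?thesis
    by (simp add: merge_def sum.distrib)
qed

text \<open>The share of each twin in the merged row; by \<open>merged_row\<close> the two shares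
  add up to 1.\<close>

definition weight :: "(index \<Rightarrow> real) \<Rightarrow> nat \<Rightarrow> real" where
  "weight u i = (if i = i1 \<or> i = i2
     then (\<Sum>e | e \<in> S2 \<and> fst e = i. u e) / (\<Sum>e | e \<in> S \<and> fst e = i1. merge u e) else 1)"

definition base :: "nat \<Rightarrow> nat" where
  "base i = (if i = i2 then i1 else i)"

lemma sum_S2_row:
  assumes "i \<noteq> i2"
  shows "(\<Sum>e | e \<in> S2 \<and> fst e = i. f e) = (\<Sum>e | e \<in> S \<and> fst e = i. f e)"
proof -
  have "{e. e \<in> S2 \<and> fst e = i} = {e. e \<in> S \<and> fst e = i}"
    using assms by (auto simp: ext_def)
  then show ?thesis by simp
qed

lemma sum_S2_row2:
  shows "(\<Sum>e | e \<in> S2 \<and> fst e = i2. f e) = (\<Sum>e | e \<in> S \<and> fst e = i1. f (i2, snd e))"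
  by (rule sum.reindex_bij_witness[where i = "\<lambda>e. (i2, snd e)" and j = "\<lambda>e. (i1, snd e)"])
    (use new' in \<open>auto simp: ext_def\<close>)

lemma sum_S2_col: "(\<Sum>e | e \<in> S2 \<and> snd e = j. u e) = (\<Sum>e | e \<in> S \<and> snd e = j. merge u e)"
proof -
  have "{e. e \<in> S2 \<and> snd e = j} = ext {e. e \<in> S \<and> snd e = j}"
    by (auto simp: ext_def)
  then show ?thesis
    using sum_ext[of "{e. e \<in> S \<and> snd e = j}" u] by auto
qed

lemma merged_row:
  "(\<Sum>e | e \<in> S \<and> fst e = i1. merge u e) =
    (\<Sum>e | e \<in> S2 \<and> fst e = i1. u e) + (\<Sum>e | e \<in> S2 \<and> fst e = i2. u e)"
  unfolding sum_S2_row2 sum_S2_row[OF neq] by (simp add: merge_def sum.distrib[symmetric])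

lemma merge_other: "i \<noteq> i1 \<Longrightarrow> (\<Sum>e | e \<in> S \<and> fst e = i. merge u e) = (\<Sum>e | e \<in> S \<and> fst e = i. u e)"
  by (rule sum.cong) (auto simp: merge_def)

lemma row_positive:
  fixes u :: "index \<Rightarrow> real"
  assumes pos: "\<And>e. e \<in> S2 \<Longrightarrow> 0 < u e" and "i = i1 \<or> i = i2"
  shows "0 < (\<Sum>e | e \<in> S2 \<and> fst e = i. u e)"
proof (rule sum_pos)
  obtain j where "(i1, j) \<in> S"
    using old by auto
  then have "(i, j) \<in> S2"
    using assms(2) by (auto simp: mem_ext)
  then show "{e. e \<in> S2 \<and> fst e = i} \<noteq> {}"
    by auto
  have "finite S2"
    using fin by (auto simp: ext_def intro!: finite_Image)
  then show "finite {e. e \<in> S2 \<and> fst e = i}"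
    by simp
qed (use pos in auto)

text \<open>The maximal cliques through \<open>(i, j)\<close> are the extensions of those through
  \<open>(base i, j)\<close>, so clique sums and column sums agree with the merged ones. The row sum
  is the only factor that distinguishes the twins.\<close>

lemma clique_formula_twin:
  assumes pos: "\<And>e. e \<in> S2 \<Longrightarrow> 0 < u e" and e: "(i, j) \<in> S2"
  shows "clique_formula S2 u (i, j) = weight u i * clique_formula S (merge u) (base i, j)"
proof -
  have b: "base i \<noteq> i2"
    using neq by (simp add: base_def)
  have Max: "Max_cliques S2 (i, j) = ext ` Max_cliques S (base i, j)"
    using Max_cliques_ext[OF b] Max_cliques_twin by (cases "i = i2") (simp_all add: base_def)
  have "Int_cliques S2 (i, j) = Int_cliques S2 (base i, j)"
    using Int_cliques_cong[OF Max_cliques_twin] by (cases "i = i2") (simp_all add: base_def)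
  then have Int: "Int_cliques S2 (i, j) = ext ` Int_cliques S (base i, j)"
    using Int_cliques_ext[OF b] by simp
  have "inj_on ext (Max_cliques S (base i, j))" "inj_on ext (Int_cliques S (base i, j))"
    using ext_eq_iff Max_cliques_subset Int_cliques_subset by (auto intro!: inj_onI)
  then have prods: "(\<Prod>C\<in>Int_cliques S2 (i, j). sum u C) = (\<Prod>C\<in>Int_cliques S (base i, j). sum (merge u) C)"
      "(\<Prod>D\<in>Max_cliques S2 (i, j). sum u D) = (\<Prod>D\<in>Max_cliques S (base i, j). sum (merge u) D)"
    unfolding Max Int
    by (simp_all add: prod.reindex sum_ext Max_cliques_subset Int_cliques_subset cong: prod.cong)
  have row: "(\<Sum>e | e \<in> S2 \<and> fst e = i. u e) = weight u i * (\<Sum>e | e \<in> S \<and> fst e = base i. merge u e)"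
  proof (cases "i = i1 \<or> i = i2")
    case True
    moreover have "0 < (\<Sum>e | e \<in> S \<and> fst e = i1. merge u e)"
      unfolding merged_row using row_positive[OF pos] by (intro add_pos_pos) auto
    ultimately show ?thesis
      by (auto simp: weight_def base_def)
  next
    case False
    then show ?thesis
      using sum_S2_row[of i u] merge_other[of i u] by (simp add: weight_def base_def)
  qed
  show ?thesis
    unfolding clique_formula_def prods fst_conv snd_conv row sum_S2_col by simp
qed

lemma fits_twin:
  assumes pos: "\<And>e. e \<in> S2 \<Longrightarrow> 0 < u e" and "fits S (merge u)"
  shows "fits S2 u"
proof -
  from assms(2) obtain s t where st: "\<forall>i. 0 < s i" "\<forall>j. 0 < t j"
    "\<forall>e\<in>S. clique_formula S (merge u) e = s (fst e) * t (snd e)"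
    and marg: "same_margins S (merge u) (clique_formula S (merge u))"
    unfolding fits_def by blast
  have F: "clique_formula S2 u (i, j) = weight u i * clique_formula S (merge u) (base i, j)"
    if "(i, j) \<in> S2" for i j
    by (rule clique_formula_twin) (use pos that in auto)
  have row_pos: "0 < (\<Sum>e | e \<in> S2 \<and> fst e = i. u e)" if "i = i1 \<or> i = i2" for i
    by (rule row_positive) (use pos that in auto)
  have w: "0 < weight u i" for i
    using row_pos by (simp add: weight_def merged_row add_pos_pos)
  have "weight u i1 + weight u i2 = 1"
    using row_pos[of i1] row_pos[of i2]
    by (simp add: weight_def merged_row add_divide_distrib[symmetric])
  then have w2: "weight u i2 = 1 - weight u i1"
    by simp
  have base_S: "(i, j) \<in> S2 \<longleftrightarrow> (base i, j) \<in> S" for i j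
    using new' by (auto simp: base_def mem_ext)
  let ?s = "\<lambda>i. weight u i * s (base i)"
  have "clique_formula S2 u e = ?s (fst e) * t (snd e)" if "e \<in> S2" for e
    using F[of "fst e" "snd e"] that st(3) base_S[of "fst e" "snd e"] by simp
  moreover have "\<forall>i. 0 < ?s i"
    using st w by simp
  moreover have "same_margins S2 u (clique_formula S2 u)"
    unfolding same_margins_def
  proof (intro conjI allI)
    fix i
    have "(\<Sum>e | e \<in> S2 \<and> fst e = i. clique_formula S2 u e) =
        weight u i * (\<Sum>e | e \<in> S \<and> fst e = base i. clique_formula S (merge u) e)"
    proof -
      have "(\<Sum>e | e \<in> S2 \<and> fst e = i. clique_formula S2 u e) =
          (\<Sum>e | e \<in> S2 \<and> fst e = i. weight u i * clique_formula S (merge u) (base i, snd e))"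
        using F by (intro sum.cong) auto
      also have "\<dots> = (\<Sum>e | e \<in> S \<and> fst e = base i. weight u i * clique_formula S (merge u) e)"
        using neq new'
        by (intro sum.reindex_bij_witness[where i = "\<lambda>e. (i, snd e)" and j = "\<lambda>e. (base i, snd e)"])
          (auto simp: base_S)
      finally show ?thesis
        by (simp add: sum_distrib_left)
    qed
    also have "\<dots> = weight u i * (\<Sum>e | e \<in> S \<and> fst e = base i. merge u e)"
      using marg unfolding same_margins_def by simp
    also have "\<dots> = (\<Sum>e | e \<in> S2 \<and> fst e = i. u e)"
    proof (cases "i = i1 \<or> i = i2")
      case True
      moreover have "0 < (\<Sum>e | e \<in> S \<and> fst e = i1. merge u e)"
        unfolding merged_row using row_pos by (intro add_pos_pos) auto
      ultimately show ?thesis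
        by (auto simp: weight_def base_def)
    next
      case False
      then show ?thesis
        using sum_S2_row[of i u] merge_other[of i u] by (simp add: weight_def base_def)
    qed
    finally show "(\<Sum>e | e \<in> S2 \<and> fst e = i. u e) = (\<Sum>e | e \<in> S2 \<and> fst e = i. clique_formula S2 u e)"
      by simp
  next
    fix j
    \<comment> \<open>The twin values add up with shares of total 1, which reduces column sums to
      those of the smaller set.\<close>
    have "merge (clique_formula S2 u) e = clique_formula S (merge u) e" if e: "e \<in> S" for e
    proof -
      obtain a b where ab: "e = (a, b)" by (cases e)
      then have a: "a \<noteq> i2" "(a, b) \<in> S2"
        using e new' by (auto simp: mem_ext)
      show ?thesis
      proof (cases "a = i1")
        case True
        then have "(i2, b) \<in> S2"
          using e ab by (simp add: mem_ext)
        then show ?thesis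
          using F[OF a(2)] F[of i2 b] True neq by (simp add: merge_def ab base_def w2 algebra_simps)
      next
        case False
        then show ?thesis
          using F[OF a(2)] a by (simp add: merge_def ab base_def weight_def)
      qed
    qed
    then have "(\<Sum>e | e \<in> S \<and> snd e = j. merge (clique_formula S2 u) e) =
        (\<Sum>e | e \<in> S \<and> snd e = j. clique_formula S (merge u) e)"
      by (intro sum.cong) auto
    then show "(\<Sum>e | e \<in> S2 \<and> snd e = j. u e) = (\<Sum>e | e \<in> S2 \<and> snd e = j. clique_formula S2 u e)"
      unfolding sum_S2_col using marg unfolding same_margins_def by simp
  qed
  ultimately show ?thesis
    unfolding fits_def using st(2) by (intro conjI exI[of _ ?s] exI[of _ t]) simp_all
qed

end

section \<open>Index sets built by pendant and twin steps\<close>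

inductive constructible :: "index set \<Rightarrow> bool" where
  empty: "constructible {}"
| pendant: "constructible S \<Longrightarrow> i \<notin> Domain S \<Longrightarrow> constructible (insert (i, j) S)"
| twin: "constructible S \<Longrightarrow> i \<in> Domain S \<Longrightarrow> i' \<notin> Domain S \<Longrightarrow> constructible (S \<union> {i'} \<times> S `` {i})"
| converse: "constructible S \<Longrightarrow> constructible (S\<inverse>)"

lemma constructible_finite: "constructible S \<Longrightarrow> finite S"
  by (induction rule: constructible.induct) (auto intro!: finite_Image)

text \<open>The weights are generalised in the induction because the twin step needs the hypothesis
  for the merged weights. Column steps arise as row steps between two applications of
  \<open>converse\<close>.\<close>

theorem constructible_fits:
  assumes "constructible S" "\<And>e. e \<in> S \<Longrightarrow> 0 < u e"
  shows "fits S u"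
  using assms
proof (induction arbitrary: u rule: constructible.induct)
  case empty
  have "\<exists>(s :: nat \<Rightarrow> real) (t :: nat \<Rightarrow> real). (\<forall>i. 0 < s i) \<and> (\<forall>j. 0 < t j)"
    by (intro exI[of _ "\<lambda>_ :: nat. 1 :: real"]) simp
  then show ?case
    by (simp add: fits_def same_margins_def)
next
  case (pendant S i j)
  interpret pendant S i j
    by unfold_locales (use pendant constructible_finite in auto)
  show ?case
    by (rule fits_pendant) (use pendant in auto)
next
  case (twin S i i')
  interpret twin S i i'
    by unfold_locales (use twin constructible_finite in auto)
  have pos: "0 < u e" if "e \<in> ext S" for e
    using that twin.prems by (simp add: ext_def)
  have "fits S (merge u)"
  proof (rule twin.IH)
    fix e assume "e \<in> S"
    then have "e \<in> ext S" "fst e = i \<Longrightarrow> (i', snd e) \<in> ext S"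
      by (cases e; simp add: mem_ext)+
    then show "0 < merge u e"
      using pos by (simp add: merge_def add_pos_pos)
  qed
  then show ?case
    using fits_twin[OF pos] by (simp add: ext_def)
next
  case (converse S)
  show ?case
    by (rule fits_converse, rule converse.IH) (use converse.prems in auto)
qed

section \<open>Elimination orders of doubly chordal bipartite graphs\<close>

definition internally_connected :: "('v \<times> 'v) set \<Rightarrow> 'v set \<Rightarrow> bool" where
  "internally_connected E B \<longleftrightarrow> (\<forall>a\<in>B. \<forall>b\<in>B. (a, b) \<in> (E \<inter> B \<times> B)\<^sup>*)"

definition at_distance_two :: "('v \<times> 'v) set \<Rightarrow> 'v set \<Rightarrow> 'v set" where
  "at_distance_two E B = E `` (E `` B) - E `` B - B"

lemma internally_connected_insert:
  assumes B: "internally_connected E B" and E: "sym E" "(b, y) \<in> E" "b \<in> B"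
  shows "internally_connected E (insert y B)"
proof -
  let ?R = "E \<inter> insert y B \<times> insert y B"
  have R: "(E \<inter> B \<times> B)\<^sup>* \<subseteq> ?R\<^sup>*"
    by (rule rtrancl_mono) auto
  have yb: "(y, b) \<in> ?R" "(b, y) \<in> ?R"
    using E by (auto dest: symD)
  have to: "(a, b) \<in> ?R\<^sup>*" and fro: "(b, a) \<in> ?R\<^sup>*" if "a \<in> insert y B" for a
  proof -
    have "a = y \<or> a \<in> B" using that by simp
    then show "(a, b) \<in> ?R\<^sup>*"
      using B E(3) R yb unfolding internally_connected_def by blast
    show "(b, a) \<in> ?R\<^sup>*"
      using \<open>a = y \<or> a \<in> B\<close> B E(3) R yb unfolding internally_connected_def by blast
  qed
  show ?thesis
    unfolding internally_connected_def using to fro rtrancl_trans by metis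
qed

lemma relpow_segment:
  assumes "\<forall>i<n. (f i, f (Suc i)) \<in> R" "i \<le> j" "j \<le> n"
  shows "(f i, f j) \<in> R ^^ (j - i)"
  unfolding relpow_fun_conv using assms by (intro exI[of _ "\<lambda>k. f (i + k)"]) auto

lemma cycle_edgesI: "k < length vs \<Longrightarrow> {vs ! k, vs ! (Suc k mod length vs)} \<in> cycle_edges vs"
  unfolding cycle_edges_def by blast

text \<open>The cycle is closed up from a shortest path inside \<open>B\<close> from the neighbours of \<open>y\<close> that
  are not neighbours of \<open>y'\<close> to the neighbours of \<open>y'\<close>; only \<open>y\<close> and the end of the path can
  form a chord.\<close>

lemma neighbours_subset_or_cycle:
  fixes E :: "('v \<times> 'v) set" and c :: "'v \<Rightarrow> bool"
  assumes sym: "sym E" and bip: "\<And>v w. (v, w) \<in> E \<Longrightarrow> c v \<noteq> c w"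
    and conn: "internally_connected E B"
    and xB: "x \<notin> B" "y \<notin> B" "y' \<notin> B"
    and xy: "(x, y) \<in> E" "(x, y') \<in> E" and xnot: "\<And>b. b \<in> B \<Longrightarrow> (x, b) \<notin> E"
    and w: "w \<in> B" "(y, w) \<in> E" "(y', w) \<notin> E"
    and w': "w' \<in> B" "(y', w') \<in> E"
  obtains vs a b where "distinct vs" "6 \<le> length vs"
    "\<And>k. k < length vs \<Longrightarrow> (vs ! k, vs ! (Suc k mod length vs)) \<in> E"
    "\<And>p q. p \<in> set vs \<Longrightarrow> q \<in> set vs \<Longrightarrow> (p, q) \<in> E \<Longrightarrow> {p, q} \<in> cycle_edges vs \<or> {p, q} = {a, b}"
proof -
  let ?R = "E \<inter> B \<times> B"
  \<comment> \<open>The start \<open>a\<close> must miss \<open>y'\<close>, but the end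
    \<open>b\<close> may be adjacent to \<open>y\<close> as well; that edge is the one chord that
    cannot be excluded.\<close>
  define P where "P k \<longleftrightarrow> (\<exists>a b. a \<in> B \<and> b \<in> B \<and> (y, a) \<in> E \<and> (y', a) \<notin> E \<and> (y', b) \<in> E \<and> (a, b) \<in> ?R ^^ k)" for k
  have "(w, w') \<in> ?R\<^sup>*"
    using conn w w' unfolding internally_connected_def by blast
  then obtain k where "P k"
    unfolding rtrancl_power P_def using w w' by blast
  define n where "n = (LEAST k. P k)"
  have "P n"
    unfolding n_def using \<open>P k\<close> by (rule LeastI)
  have least: "n \<le> k" if "P k" for k
    unfolding n_def using that by (rule Least_le)
  from \<open>P n\<close> obtain a b f where ab: "a \<in> B" "b \<in> B" "(y, a) \<in> E" "(y', a) \<notin> E" "(y', b) \<in> E"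
    and f: "f 0 = a" "f n = b" "\<forall>i<n. (f i, f (Suc i)) \<in> ?R"
    unfolding P_def relpow_fun_conv by blast
  have fB: "f i \<in> B" if "i \<le> n" for i
    using f(2,3) ab(2) that by (cases "i = n") auto
  have seg: "(f i, f j) \<in> ?R ^^ (j - i)" if "i \<le> j" "j \<le> n" for i j
    using relpow_segment[OF f(3) that] .
  \<comment> \<open>A neighbour of \<open>y'\<close> before the end would cut the path short there;
    given this, an inner neighbour of \<open>y\<close> would be a later start of a shorter
    path.\<close>
  have y'f: "(y', f i) \<notin> E" if "i < n" for i
  proof
    assume "(y', f i) \<in> E"
    moreover have "(a, f i) \<in> ?R ^^ i"
      using seg[of 0 i] that f(1) by simp
    ultimately have "P i"
      unfolding P_def using ab fB[of i] that by auto
    then show False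
      using least[of i] that by simp
  qed
  have yf: "(y, f i) \<notin> E" if "0 < i" "i < n" for i
  proof
    assume "(y, f i) \<in> E"
    moreover have "(f i, b) \<in> ?R ^^ (n - i)"
      using seg[of i n] that f(2) by simp
    ultimately have "P (n - i)"
      unfolding P_def using ab fB[of i] that y'f[of i] by auto
    then show False
      using least[of "n - i"] that by simp
  qed
  have chordless: "j = Suc i" if "i < j" "j \<le> n" "(f i, f j) \<in> E" for i j
  proof (rule ccontr)
    assume "j \<noteq> Suc i"
    have "(f i, f j) \<in> ?R"
      using that fB[of i] fB[of j] by simp
    then have "(a, f j) \<in> ?R ^^ Suc i"
      using seg[of 0 i] that f(1) by auto
    then have "(a, b) \<in> ?R ^^ (Suc i + (n - j))"
      using seg[of j n] that f(2) unfolding relpow_add by blast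
    then have "P (Suc i + (n - j))"
      unfolding P_def using ab by blast
    then show False
      using least that \<open>j \<noteq> Suc i\<close> by fastforce
  qed
  have distinct_less: "f i \<noteq> f j" if "i < j" "j \<le> n" for i j
  proof
    assume "f i = f j"
    have "(a, f i) \<in> ?R ^^ i" "(f j, b) \<in> ?R ^^ (n - j)"
      using seg[of 0 i] seg[of j n] that f(1,2) by auto
    then have "(a, b) \<in> ?R ^^ (i + (n - j))"
      unfolding relpow_add using \<open>f i = f j\<close> by auto
    then have "P (i + (n - j))"
      unfolding P_def using ab by blast
    then show False
      using least[of "i + (n - j)"] that by simp
  qed
  \<comment> \<open>\<open>a\<close> and \<open>b\<close> have the same colour, so \<open>n\<close>
    is not 1, and \<open>a\<close> is no neighbour of \<open>y'\<close>, so \<open>n\<close> is not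
    0. The cycle has length \<open>n + 4\<close>, hence at least 6.\<close>
  have col: "c y = c y'" "c a = c b" "c a \<noteq> c y"
    using bip[OF xy(1)] bip[OF xy(2)] bip[OF ab(3)] bip[OF ab(5)] by auto
  have "n \<noteq> 0"
    using ab(4,5) f(1,2) by metis
  moreover have "n \<noteq> 1"
    using f bip[of a b] col by auto
  ultimately have n2: "2 \<le> n"
    by simp
  define vs where "vs = x # y # map f [0..<Suc n] @ [y']"
  have len: "length vs = n + 4"
    by (simp add: vs_def)
  have nth: "vs ! 0 = x" "vs ! 1 = y" "\<And>k. k \<le> n \<Longrightarrow> vs ! (k + 2) = f k" "vs ! (n + 3) = y'"
    by (simp_all add: vs_def nth_append del: upt_Suc)
  have setvs: "set vs = {x, y, y'} \<union> f ` {..n}"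
    by (auto simp: vs_def atLeast0AtMost[symmetric] atLeastLessThanSuc_atLeastAtMost simp del: upt_Suc)
  have inj: "inj_on f {..n}"
    using distinct_less by (intro linorder_inj_onI) auto
  have "y \<noteq> y'"
    using ab by auto
  moreover have "x \<noteq> y" "x \<noteq> y'"
    using bip[OF xy(1)] bip[OF xy(2)] by auto
  moreover have "x \<notin> f ` {..n}" "y \<notin> f ` {..n}" "y' \<notin> f ` {..n}"
    using fB xB by auto
  ultimately have dist: "distinct vs"
    using inj by (simp add: vs_def distinct_map atLeast0AtMost atLeastLessThanSuc_atLeastAtMost
        del: upt_Suc)
  have E': "(q, p) \<in> E" if "(p, q) \<in> E" for p q
    using sym that by (rule symD)
  have steps: "(vs ! k, vs ! (Suc k mod length vs)) \<in> E" if "k < length vs" for k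
  proof -
    have "k = 0 \<or> k = 1 \<or> (k = (k - 2) + 2 \<and> k - 2 < n) \<or> k = n + 2 \<or> k = n + 3"
      using that len by linarith
    then consider "k = 0" | "k = 1" | i where "k = i + 2" "i < n" | "k = n + 2" | "k = n + 3"
      by blast
    then show ?thesis
    proof cases
      case 3
      then have "Suc k mod length vs = Suc i + 2"
        by (simp add: len)
      with 3 f(3) nth(3)[of i] nth(3)[of "Suc i"] show ?thesis by simp
    next
      case 5
      then have "Suc k = length vs"
        by (simp add: len)
      then have "Suc k mod length vs = 0"
        by simp
      with 5 nth(1,4) E'[OF xy(2)] show ?thesis by simp
    qed (use nth nth(3)[of 0] nth(3)[of n] xy ab f E' in \<open>auto simp: len numeral_2_eq_2 numeral_3_eq_3\<close>)
  qed
  have edges: "{x, y} \<in> cycle_edges vs" "{y, f 0} \<in> cycle_edges vs" "{f n, y'} \<in> cycle_edges vs"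
      "{y', x} \<in> cycle_edges vs" "\<And>i. i < n \<Longrightarrow> {f i, f (Suc i)} \<in> cycle_edges vs"
  proof -
    show "{x, y} \<in> cycle_edges vs" "{y, f 0} \<in> cycle_edges vs"
      using cycle_edgesI[of 0 vs] cycle_edgesI[of 1 vs] nth(1,2) nth(3)[of 0] by (simp_all add: len numeral_2_eq_2)
    show "{f n, y'} \<in> cycle_edges vs"
      using cycle_edgesI[of "n + 2" vs] nth(4) nth(3)[of n] by (simp add: len numeral_2_eq_2 numeral_3_eq_3)
    have "Suc (n + 3) mod length vs = 0"
      by (simp add: len[unfolded numeral_eq_Suc] numeral_eq_Suc)
    then show "{y', x} \<in> cycle_edges vs"
      using cycle_edgesI[of "n + 3" vs] nth(1,4) by (simp add: len del: mod_Suc_eq)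
    fix i assume "i < n"
    then show "{f i, f (Suc i)} \<in> cycle_edges vs"
      using cycle_edgesI[of "i + 2" vs] nth(3)[of i] nth(3)[of "Suc i"] by (simp add: len)
  qed
  define Q where "Q p q \<longleftrightarrow> {p, q} \<in> cycle_edges vs \<or> {p, q} = {y, f n}" for p q
  have Qsym: "Q p q \<longleftrightarrow> Q q p" for p q
    by (simp add: Q_def insert_commute)
  have Qx: "Q x q" if "q \<in> set vs" "(x, q) \<in> E" for q
    using that edges xnot[OF fB] bip[of x x] by (auto simp: setvs Q_def insert_commute)
  have Qf: "Q (f i) (f j)" if "i \<le> n" "j \<le> n" "(f i, f j) \<in> E" for i j
  proof (cases i j rule: linorder_cases)
    case less
    then show ?thesis
      using chordless[OF less] that edges(5)[of i] by (simp add: Q_def)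
  next
    case equal
    then show ?thesis using that bip by blast
  next
    case greater
    then show ?thesis
      using chordless[OF greater] that E' edges(5)[of j] by (simp add: Q_def insert_commute)
  qed
  have Qy: "Q y (f i)" if "i \<le> n" "(y, f i) \<in> E" for i
    using that yf[of i] edges(2) by (cases "i = 0"; cases "i = n") (auto simp: Q_def)
  have Qy': "Q y' (f i)" if "i \<le> n" "(y', f i) \<in> E" for i
    using that y'f[of i] edges(3) by (cases "i = n") (auto simp: Q_def insert_commute)
  have noE: "(y, y') \<notin> E" "(y', y) \<notin> E" "(y, y) \<notin> E" "(y', y') \<notin> E"
    using bip col(1) by blast+
  have chord: "Q p q" if pq: "p \<in> set vs" "q \<in> set vs" "(p, q) \<in> E" for p q
  proof -
    consider "p = x" | "q = x" | i j where "i \<le> n" "j \<le> n" "p = f i" "q = f j"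
      | i where "i \<le> n" "p = y" "q = f i" | i where "i \<le> n" "q = y" "p = f i"
      | i where "i \<le> n" "p = y'" "q = f i" | i where "i \<le> n" "q = y'" "p = f i"
      | "p \<in> {y, y'}" "q \<in> {y, y'}"
      using pq(1,2) unfolding setvs by (elim UnE insertE imageE emptyE) auto
    then show ?thesis
    proof cases
      case 1 then show ?thesis using Qx pq by simp
    next
      case 2 then show ?thesis using Qx[of p] E'[OF pq(3)] pq(1) Qsym by simp
    next
      case 3 then show ?thesis using Qf pq(3) by simp
    next
      case 4 then show ?thesis using Qy pq(3) by simp
    next
      case 5 then show ?thesis using Qy E'[OF pq(3)] Qsym by simp
    next
      case 6 then show ?thesis using Qy' pq(3) by simp
    next
      case 7 then show ?thesis using Qy' E'[OF pq(3)] Qsym by simp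
    next
      case 8 then show ?thesis using noE pq(3) by auto
    qed
  qed
  show thesis
    by (rule that[OF dist _ steps, of y "f n"]) (use len n2 chord in \<open>auto simp: Q_def\<close>)
qed

lemma pendant_or_twins:
  fixes E :: "('v \<times> 'v) set" and c :: "'v \<Rightarrow> bool"
  assumes fin: "finite E" and ne: "E \<noteq> {}" and sym: "sym E" and bip: "\<And>v w. (v, w) \<in> E \<Longrightarrow> c v \<noteq> c w"
    and no_cycle: "\<And>vs a b. distinct vs \<Longrightarrow> 6 \<le> length vs \<Longrightarrow>
      (\<And>k. k < length vs \<Longrightarrow> (vs ! k, vs ! (Suc k mod length vs)) \<in> E) \<Longrightarrow>
      (\<And>p q. p \<in> set vs \<Longrightarrow> q \<in> set vs \<Longrightarrow> (p, q) \<in> E \<Longrightarrow> {p, q} \<in> cycle_edges vs \<or> {p, q} = {a, b}) \<Longrightarrow> False"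
  shows "(\<exists>v w. E `` {v} = {w}) \<or> (\<exists>v v'. v \<noteq> v' \<and> E `` {v} = E `` {v'} \<and> E `` {v} \<noteq> {})"
proof -
  have E': "(q, p) \<in> E" if "(p, q) \<in> E" for p q
    using sym that by (rule symD)
  define good where "good B \<longleftrightarrow> B \<subseteq> Field E \<and> internally_connected E B \<and> at_distance_two E B \<noteq> {}" for B
  show ?thesis
  proof (cases "\<exists>B. good B")
    case False
    obtain v w where vw: "(v, w) \<in> E"
      using ne by auto
    \<comment> \<open>Not even a singleton has a vertex at distance two, so \<open>v\<close> can
      have no neighbour besides \<open>w\<close>.\<close>
    have "internally_connected E {w}" "{w} \<subseteq> Field E"
      using vw by (auto simp: internally_connected_def Field_def)
    with False have "at_distance_two E {w} = {}"
      unfolding good_def by blast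
    moreover have "z \<in> at_distance_two E {w}" if "(v, z) \<in> E" "z \<noteq> w" for z
      using that vw E'[OF vw] bip[OF vw] bip[OF that(1)] bip[of w z] unfolding at_distance_two_def by auto
    ultimately have "E `` {v} = {w}"
      using vw by auto
    then show ?thesis by blast
  next
    case True
    have "finite {B. good B}"
      by (rule finite_subset[of _ "Pow (Field E)"]) (use fin in \<open>auto simp: good_def finite_Field\<close>)
    then obtain B where B: "good B" and max: "\<And>B'. good B' \<Longrightarrow> B \<subseteq> B' \<Longrightarrow> B = B'"
      using finite_has_maximal[of "{B. good B}"] True by auto
    have conn: "internally_connected E B" and BF: "B \<subseteq> Field E"
      using B by (simp_all add: good_def)
    define L where "L = E `` B - B"
    \<comment> \<open>Adding \<open>y\<close> keeps the set connected, so by maximality of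
      \<open>B\<close> no vertex at distance two may remain. The neighbourhood of \<open>x\<close>
      is read off from this.\<close>
    have empty: "at_distance_two E (insert y B) = {}" if y: "y \<in> L" for y
    proof (rule ccontr)
      assume "at_distance_two E (insert y B) \<noteq> {}"
      moreover obtain b where b: "b \<in> B" "(b, y) \<in> E"
        using y by (auto simp: L_def)
      moreover have "insert y B \<subseteq> Field E"
        using b(2) BF by (auto simp: Field_def)
      ultimately have "good (insert y B)"
        unfolding good_def using internally_connected_insert[OF conn sym b(2,1)] by simp
      then show False
        using max[of "insert y B"] y by (auto simp: L_def)
    qed
    have complete: "(x, y) \<in> E" if x: "x \<in> at_distance_two E B" and y: "y \<in> L" for x y
    proof (rule ccontr)
      assume "(x, y) \<notin> E"
      then have "x \<in> at_distance_two E (insert y B)"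
        using x y E'[of y x] unfolding at_distance_two_def L_def by auto
      then show False
        using empty[OF y] by simp
    qed
    obtain x where x: "x \<in> at_distance_two E B"
      using B unfolding good_def by blast
    obtain y where y: "y \<in> L" "(y, x) \<in> E"
      using x unfolding at_distance_two_def L_def by auto
    have xnot: "x \<notin> B" "\<And>b. b \<in> B \<Longrightarrow> (x, b) \<notin> E"
      using x E' unfolding at_distance_two_def by auto
    have nbrs: "E `` {x} = L"
    proof (intro equalityI subsetI)
      fix z assume "z \<in> E `` {x}"
      then have xz: "(x, z) \<in> E" by simp
      have "z \<notin> B"
        using xz xnot by blast
      show "z \<in> L"
      proof (rule ccontr)
        assume z: "z \<notin> L"
        have "(y, z) \<notin> E"
          using bip[OF xz] bip[OF y(2)] bip[of y z] by auto
        then have "z \<in> at_distance_two E (insert y B)"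
          using z \<open>z \<notin> B\<close> y xz unfolding at_distance_two_def L_def by auto
        then show False
          using empty[OF y(1)] by simp
      qed
    qed (use complete[OF x] in simp)
    have sub: "E `` {v} \<subseteq> E `` {v'}" if v: "v \<in> L" "v' \<in> L" for v v'
    proof
      fix w assume "w \<in> E `` {v}"
      then have vw: "(v, w) \<in> E" by simp
      show "w \<in> E `` {v'}"
      proof (rule ccontr)
        assume "w \<notin> E `` {v'}"
        then have v'w: "(v', w) \<notin> E" by simp
        have xv: "(x, v) \<in> E" "(x, v') \<in> E"
          using complete[OF x] v by auto
        \<comment> \<open>Outside \<open>B\<close> the vertex \<open>w\<close> would be at distance
          two and hence adjacent to all of \<open>L\<close>, including \<open>v'\<close>. Inside
          \<open>B\<close> it leads to the excluded cycle.\<close>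
        have wB: "w \<in> B"
        proof (rule ccontr)
          assume "w \<notin> B"
          have "w \<notin> L"
            using complete[OF x] bip[OF vw] bip[OF xv(1)] bip[of x w] by auto
          then have "w \<in> at_distance_two E B"
            using \<open>w \<notin> B\<close> vw v unfolding at_distance_two_def L_def by auto
          then show False
            using complete[OF _ v(2)] v'w E' by blast
        qed
        obtain w' where w': "w' \<in> B" "(v', w') \<in> E"
          using v(2) E' unfolding L_def by blast
        have notB: "v \<notin> B" "v' \<notin> B"
          using v by (auto simp: L_def)
        show False
          by (rule neighbours_subset_or_cycle[where E = E and B = B and c = c and x = x and y = v
                and y' = v' and w = w and w' = w'])
            (fact sym bip conn xnot notB xv wB vw v'w w' no_cycle)+
      qed
    qed
    show ?thesis
    proof (cases "L = {y}")
      case True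
      then show ?thesis using nbrs by blast
    next
      case False
      then obtain y' where "y' \<in> L" "y \<noteq> y'"
        using y(1) by blast
      moreover from this have "E `` {y} = E `` {y'}"
        using sub y(1) by (intro equalityI) auto
      moreover have "E `` {y} \<noteq> {}"
        using y(2) by blast
      ultimately show ?thesis by blast
    qed
  qed
qed

subsection \<open>From graphs to index sets\<close>

definition adjacency :: "index set \<Rightarrow> ((nat + nat) \<times> (nat + nat)) set" where
  "adjacency S = (\<lambda>(i, j). (Inl i, Inr j)) ` S \<union> (\<lambda>(i, j). (Inr j, Inl i)) ` S"

lemma adjacency_simps [simp]:
  "(Inl i, Inr j) \<in> adjacency S \<longleftrightarrow> (i, j) \<in> S" "(Inr j, Inl i) \<in> adjacency S \<longleftrightarrow> (i, j) \<in> S"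
  "(Inl i, Inl i') \<notin> adjacency S" "(Inr j, Inr j') \<notin> adjacency S"
  by (auto simp: adjacency_def)

lemma adjacency_iff: "(v, w) \<in> adjacency S \<longleftrightarrow> {v, w} \<in> snd (bipartite_graph m n S)"
  by (cases v; cases w) (auto simp: bipartite_graph_def doubleton_eq_iff)

lemma adjacency_Image: "adjacency S `` {Inl i} = Inr ` (S `` {i})" "adjacency S `` {Inr j} = Inl ` (S\<inverse> `` {j})"
  by (auto simp: adjacency_def)

lemma sym_adjacency: "sym (adjacency S)"
  by (auto simp: adjacency_def sym_def)

lemma adjacency_isl: "(v, w) \<in> adjacency S \<Longrightarrow> isl v \<noteq> isl w"
  by (auto simp: adjacency_def)

lemma bipartite_bipartite_graph:
  assumes "S \<subseteq> {1..m} \<times> {1..n}"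
  shows "bipartite (bipartite_graph m n S)"
  unfolding bipartite_def bipartite_graph_def
  by (rule exI[of _ "Inl ` {1..m}"], rule exI[of _ "Inr ` {1..n}"]) (use assms in \<open>fastforce simp: Plus_def\<close>)

lemma cycle_vertex_edge:
  assumes "is_cycle G vs" "v \<in> set vs"
  obtains w where "{v, w} \<in> snd G"
proof -
  obtain k where k: "k < length vs" "v = vs ! k"
    using assms(2) by (auto simp: in_set_conv_nth)
  have "{v, vs ! (Suc k mod length vs)} \<in> snd G"
    using assms(1) cycle_edgesI[OF k(1)] k(2) unfolding is_cycle_def by auto
  then show thesis by (rule that)
qed

text \<open>Dropped rows and columns remain as isolated vertices. A cycle of the smaller graph
  avoids them, so all chords it has in the larger graph survive.\<close>

lemma doubly_chordal_bipartite_restrict: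
  assumes S: "S \<subseteq> {1..m} \<times> {1..n}" and dcb: "doubly_chordal_bipartite (bipartite_graph m n S)"
  shows "doubly_chordal_bipartite (bipartite_graph m n (S \<inter> A \<times> B))"
  unfolding doubly_chordal_bipartite_def
proof (intro conjI allI impI)
  show "bipartite (bipartite_graph m n (S \<inter> A \<times> B))"
    using S by (intro bipartite_bipartite_graph) auto
  fix vs assume vs: "is_cycle (bipartite_graph m n (S \<inter> A \<times> B)) vs \<and> 6 \<le> length vs"
  let ?G = "bipartite_graph m n S" and ?H = "bipartite_graph m n (S \<inter> A \<times> B)"
  have sub: "snd ?H \<subseteq> snd ?G" "fst ?H = fst ?G"
    by (auto simp: bipartite_graph_def)
  have "is_cycle ?G vs"
    using vs sub unfolding is_cycle_def by auto
  then have "2 \<le> card (chords ?G vs)"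
    using dcb vs unfolding doubly_chordal_bipartite_def by blast
  moreover have "chords ?G vs = chords ?H vs"
  proof -
    have "e \<in> snd ?H" if e: "e \<in> snd ?G" "e \<subseteq> set vs" for e
    proof -
      obtain i j where ij: "e = {Inl i, Inr j}" "(i, j) \<in> S"
        using e(1) by (auto simp: bipartite_graph_def)
      have "i \<in> A"
        using cycle_vertex_edge[of ?H vs "Inl i"] vs ij(1) e(2)
        by (auto simp: bipartite_graph_def doubleton_eq_iff)
      moreover have "j \<in> B"
        using cycle_vertex_edge[of ?H vs "Inr j"] vs ij(1) e(2)
        by (auto simp: bipartite_graph_def doubleton_eq_iff)
      ultimately show ?thesis
        using ij by (auto simp: bipartite_graph_def)
    qed
    then show ?thesis
      using sub unfolding chords_def by auto
  qed
  ultimately show "2 \<le> card (chords ?H vs)"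
    by simp
qed

lemma pendant_or_twins_adjacency:
  assumes S: "S \<subseteq> {1..m} \<times> {1..n}" "S \<noteq> {}" and dcb: "doubly_chordal_bipartite (bipartite_graph m n S)"
  shows "(\<exists>v w. adjacency S `` {v} = {w}) \<or>
    (\<exists>v v'. v \<noteq> v' \<and> adjacency S `` {v} = adjacency S `` {v'} \<and> adjacency S `` {v} \<noteq> {})"
proof (rule pendant_or_twins[OF _ _ sym_adjacency adjacency_isl])
  have "finite S"
    using S(1) finite_subset by blast
  then show "finite (adjacency S)" "adjacency S \<noteq> {}"
    using S(2) by (auto simp: adjacency_def)
  let ?G = "bipartite_graph m n S"
  fix vs a b
  assume vs: "distinct vs" "6 \<le> length vs"
    "\<And>k. k < length vs \<Longrightarrow> (vs ! k, vs ! (Suc k mod length vs)) \<in> adjacency S"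
    and chord: "\<And>p q. p \<in> set vs \<Longrightarrow> q \<in> set vs \<Longrightarrow> (p, q) \<in> adjacency S \<Longrightarrow> {p, q} \<in> cycle_edges vs \<or> {p, q} = {a, b}"
  have "set vs \<subseteq> fst ?G"
  proof
    fix v assume "v \<in> set vs"
    then obtain w where "(v, w) \<in> adjacency S"
      using vs(3) by (auto simp: in_set_conv_nth)
    then show "v \<in> fst ?G"
      using S(1) by (auto simp: adjacency_def bipartite_graph_def)
  qed
  moreover have "cycle_edges vs \<subseteq> snd ?G"
    using vs(3) by (auto simp: cycle_edges_def adjacency_iff[where m = m and n = n])
  ultimately have "is_cycle ?G vs"
    using vs unfolding is_cycle_def by simp
  then have "2 \<le> card (chords ?G vs)"
    using dcb vs(2) unfolding doubly_chordal_bipartite_def by blast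
  moreover have "chords ?G vs \<subseteq> {{a, b}}"
  proof
    fix e assume e: "e \<in> chords ?G vs"
    then obtain i j where "e = {Inl i, Inr j}"
      by (auto simp: chords_def bipartite_graph_def)
    then show "e \<in> {{a, b}}"
      using e chord[of "Inl i" "Inr j"] by (auto simp: chords_def adjacency_iff[where m = m and n = n])
  qed
  then have "card (chords ?G vs) \<le> 1"
    using card_mono[of "{{a, b}}" "chords ?G vs"] by simp
  ultimately show False
    by simp
qed

lemma constructible_row_step:
  assumes "constructible (S \<inter> (- {i'}) \<times> UNIV)"
    and "(\<exists>j. S `` {i'} = {j}) \<or> (i \<noteq> i' \<and> S `` {i} = S `` {i'} \<and> S `` {i} \<noteq> {})"
  shows "constructible S"
  using assms(2)
proof
  assume "\<exists>j. S `` {i'} = {j}"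
  then obtain j where "S `` {i'} = {j}" ..
  then have "S = insert (i', j) (S \<inter> (- {i'}) \<times> UNIV)"
    by auto
  then show ?thesis
    using pendant[OF assms(1), of i' j] by auto
next
  let ?S = "S \<inter> (- {i'}) \<times> UNIV"
  assume *: "i \<noteq> i' \<and> S `` {i} = S `` {i'} \<and> S `` {i} \<noteq> {}"
  then have "S = ?S \<union> {i'} \<times> ?S `` {i}"
    by auto
  moreover have "i \<in> Domain ?S" "i' \<notin> Domain ?S"
    using * by auto
  ultimately show ?thesis
    using twin[OF assms(1), of i i'] by simp
qed

lemma constructible_col_step:
  assumes "constructible (S \<inter> UNIV \<times> (- {j'}))"
    and "(\<exists>i. S\<inverse> `` {j'} = {i}) \<or> (j \<noteq> j' \<and> S\<inverse> `` {j} = S\<inverse> `` {j'} \<and> S\<inverse> `` {j} \<noteq> {})"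
  shows "constructible S"
proof -
  have "S\<inverse> \<inter> (- {j'}) \<times> UNIV = (S \<inter> UNIV \<times> (- {j'}))\<inverse>"
    by auto
  then have "constructible (S\<inverse>)"
    using constructible_row_step[OF _ assms(2)] converse[OF assms(1)] by simp
  then show ?thesis
    using converse[of "S\<inverse>"] by simp
qed

theorem doubly_chordal_bipartite_constructible:
  assumes "S \<subseteq> {1..m} \<times> {1..n}" "doubly_chordal_bipartite (bipartite_graph m n S)"
  shows "constructible S"
  using assms
proof (induction "card S" arbitrary: S rule: less_induct)
  case less
  have fin: "finite S"
    using less.prems(1) finite_subset by blast
  have IH: "constructible (S \<inter> A \<times> B)" if "e \<in> S" "e \<notin> A \<times> B" for A B e
  proof (rule less.hyps)
    show "card (S \<inter> A \<times> B) < card S"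
      using that fin by (intro psubset_card_mono) auto
    show "doubly_chordal_bipartite (bipartite_graph m n (S \<inter> A \<times> B))"
      by (rule doubly_chordal_bipartite_restrict[OF less.prems])
  qed (use less.prems in auto)
  have row: "constructible (S \<inter> (- {i}) \<times> UNIV)" if "S `` {i} \<noteq> {}" for i
    using that IH[of _ "- {i}" UNIV] by auto
  have col: "constructible (S \<inter> UNIV \<times> (- {j}))" if "S\<inverse> `` {j} \<noteq> {}" for j
    using that IH[of _ UNIV "- {j}"] by auto
  have eq: "Inr ` A = Inr ` B \<longleftrightarrow> A = B" "Inl ` A = Inl ` B \<longleftrightarrow> A = B" for A B :: "nat set"
    by (auto simp: inj_image_eq_iff)
  have single: "Inr ` A = {w} \<Longrightarrow> \<exists>x. A = {x}" "Inl ` A = {w} \<Longrightarrow> \<exists>x. A = {x}" for A :: "nat set" and w :: "nat + nat"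
    by (metis card_1_singletonE card_image inj_Inr is_singletonI is_singleton_altdef,
        metis card_1_singletonE card_image inj_Inl is_singletonI is_singleton_altdef)
  show ?case
  proof (cases "S = {}")
    case True
    then show ?thesis by (simp add: empty)
  next
    case False
    from pendant_or_twins_adjacency[OF less.prems(1) False less.prems(2)] show ?thesis
    proof (elim disjE exE conjE)
      fix v w assume v: "adjacency S `` {v} = {w}"
      show ?thesis
      proof (cases v)
        case (Inl i)
        then have "Inr ` (S `` {i}) = {w}"
          using v by (simp add: adjacency_Image del: converse_iff)
        from single(1)[OF this] obtain j where "S `` {i} = {j}"
          by blast
        then show ?thesis
          using constructible_row_step[OF row] by blast
      next
        case (Inr j)
        then have "Inl ` (S\<inverse> `` {j}) = {w}"
          using v by (simp add: adjacency_Image del: converse_iff)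
        from single(2)[OF this] obtain i where "S\<inverse> `` {j} = {i}"
          by blast
        then show ?thesis
          using constructible_col_step[OF col] by blast
      qed
    next
      fix v v' assume v: "v \<noteq> v'" "adjacency S `` {v} = adjacency S `` {v'}" "adjacency S `` {v} \<noteq> {}"
      then obtain w where "(v, w) \<in> adjacency S" "(v', w) \<in> adjacency S"
        by auto
      then have "isl v = isl v'"
        using adjacency_isl by blast
      then show ?thesis
      proof (cases v; cases v')
        fix i i' assume i: "v = Inl i" "v' = Inl i'"
        then have "i \<noteq> i'" "S `` {i} = S `` {i'}" "S `` {i} \<noteq> {}"
          using v by (auto simp: adjacency_Image eq simp del: Image_singleton_iff)
        then show ?thesis
          using constructible_row_step[OF row, of i' i] by simp
      next
        fix j j' assume j: "v = Inr j" "v' = Inr j'"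
        then have "j \<noteq> j'" "S\<inverse> `` {j} = S\<inverse> `` {j'}" "S\<inverse> `` {j} \<noteq> {}"
          using v by (auto simp: adjacency_Image eq simp del: Image_singleton_iff)
        then show ?thesis
          using constructible_col_step[OF col, of j' j] by simp
      qed auto
    qed
  qed
qed

section \<open>Polynomials along a monomial curve\<close>

lemma polynomial_fun_cong: "polynomial_fun S h \<Longrightarrow> (\<And>e. e \<in> S \<Longrightarrow> x e = y e) \<Longrightarrow> h x = h y"
  by (induction rule: polynomial_fun.induct) auto

lemma polynomial_fun_along_curve:
  assumes "polynomial_fun S h" "\<And>e. e \<in> S \<Longrightarrow> \<exists>q. \<forall>t. x t e = poly q t"
  shows "\<exists>q. \<forall>t. h (x t) = poly q (t :: real)"
  using assms(1)
proof induction
  case (const c)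
  show ?case by (rule exI[of _ "[:c:]"]) simp
next
  case (coord e)
  then show ?case using assms(2) by blast
next
  case (add f g)
  then obtain p q where "\<forall>t. f (x t) = poly p t" "\<forall>t. g (x t) = poly q t"
    by blast
  then show ?case by (intro exI[of _ "p + q"]) simp
next
  case (mult f g)
  then obtain p q where "\<forall>t. f (x t) = poly p t" "\<forall>t. g (x t) = poly q t"
    by blast
  then show ?case by (intro exI[of _ "p * q"]) simp
qed

lemma polynomial_fun_sum: "finite A \<Longrightarrow> (\<And>a. a \<in> A \<Longrightarrow> polynomial_fun S (f a)) \<Longrightarrow> polynomial_fun S (\<lambda>x. \<Sum>a\<in>A. f a x)"
  by (induction rule: finite_induct) (auto intro: polynomial_fun.intros)

lemma polynomial_fun_prod: "finite A \<Longrightarrow> (\<And>a. a \<in> A \<Longrightarrow> polynomial_fun S (f a)) \<Longrightarrow> polynomial_fun S (\<lambda>x. \<Prod>a\<in>A. f a x)"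
  by (induction rule: finite_induct) (auto intro: polynomial_fun.intros)

text \<open>Coordinates are made natural one at a time: in a single coordinate \<open>h\<close> is a
  nonzero polynomial with finitely many roots. The result supplies the leading coefficients of the
  counts used for necessity.\<close>

lemma polynomial_fun_nonzero_at_nat:
  assumes h: "polynomial_fun S h" "h x \<noteq> 0" and "finite S"
  obtains w :: "index \<Rightarrow> nat" where "\<And>e. 1 \<le> w e" "h (\<lambda>e. real (w e)) \<noteq> 0"
proof -
  have "\<exists>y. h y \<noteq> 0 \<and> (\<forall>e\<in>T. \<exists>k\<ge>1. y e = real k)" if "T \<subseteq> S" for T
    using finite_subset[OF that \<open>finite S\<close>]
  proof (induction T rule: finite_induct)
    case empty
    then show ?case using h by auto
  next
    case (insert a T)
    then obtain y where y: "h y \<noteq> 0" "\<forall>e\<in>T. \<exists>k\<ge>1. y e = real k"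
      by blast
    have "\<exists>q. \<forall>t. h (y(a := t)) = poly q t"
    proof (rule polynomial_fun_along_curve[OF h(1)])
      fix e
      show "\<exists>q. \<forall>t. (y(a := t)) e = poly q t"
        by (cases "e = a") (auto intro: exI[of _ "[:0, 1:]"] exI[of _ "[:y e:]"])
    qed
    then obtain q where q: "h (y(a := t)) = poly q t" for t
      by blast
    have "poly q (y a) \<noteq> 0"
      using q[of "y a"] y(1) by simp
    then have "q \<noteq> 0"
      by auto
    then have "finite {t. poly q t = 0}"
      by (rule poly_roots_finite)
    moreover have "infinite (real ` {1..})"
      using finite_imageD[of real "{1..}"] infinite_Ici[of "1::nat"] by auto
    ultimately obtain k :: nat where k: "1 \<le> k" "poly q (real k) \<noteq> 0"
      using finite_subset[of "real ` {1..}" "{t. poly q t = 0}"] by auto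
    have "h (y(a := real k)) \<noteq> 0"
      using k(2) q by simp
    moreover have "\<forall>e\<in>insert a T. \<exists>l\<ge>1. (y(a := real k)) e = real l"
      using y(2) k(1) by auto
    ultimately show ?case by blast
  qed
  from this[of S] obtain y where y: "h y \<noteq> 0" "\<forall>e\<in>S. \<exists>k\<ge>1. y e = real k"
    by auto
  then obtain w where w: "\<And>e. e \<in> S \<Longrightarrow> 1 \<le> w e \<and> y e = real (w e)"
    by metis
  have "h (\<lambda>e. real (if e \<in> S then w e else 1)) = h y"
    using w by (intro polynomial_fun_cong[OF h(1)]) auto
  then show thesis
    using y w by (intro that[of "\<lambda>e. if e \<in> S then w e else 1"]) auto
qed

subsection \<open>Orders of growth\<close>

text \<open>A constant of its own keeps the simplifier from rewriting the exponents \<open>0\<close> and \<open>1\<close>.\<close>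

definition pw :: "real \<Rightarrow> nat \<Rightarrow> real" where
  "pw a n = real n powr a"

lemma pw_mult: "pw a n * pw b n = pw (a + b) n"
  by (simp add: pw_def powr_add)

lemma pw_0: "0 < n \<Longrightarrow> pw 0 n = 1"
  by (simp add: pw_def)

lemma pw_1: "pw 1 n = real n"
  by (simp add: pw_def)

lemma pw_nonneg: "0 \<le> pw a n"
  by (simp add: pw_def)

lemma pw_mono: "1 \<le> n \<Longrightarrow> a \<le> b \<Longrightarrow> pw a n \<le> pw b n"
  by (simp add: pw_def powr_mono)

lemma pw_smallo_pw: "a < b \<Longrightarrow> pw a \<in> o(pw b)"
  unfolding pw_def[abs_def] using powr_smallo_iff[OF filterlim_real_sequentially] by simp

lemma pw_bigo_pw: "a \<le> b \<Longrightarrow> pw a \<in> O(pw b)"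
  using pw_smallo_pw[of a b] landau_o.small_imp_big by (cases "a = b") auto

lemma pw_bigtheta_iff: "pw a \<in> \<Theta>(pw b) \<longleftrightarrow> a = b"
  unfolding pw_def[abs_def] using powr_bigtheta_iff[OF filterlim_real_sequentially] by simp

lemma bigo_pw_mono: "f \<in> O(pw a) \<Longrightarrow> a \<le> b \<Longrightarrow> f \<in> O(pw b)"
  using pw_bigo_pw landau_o.big_trans by blast

lemma bigo_pw_smallo: "f \<in> O(pw a) \<Longrightarrow> a < b \<Longrightarrow> f \<in> o(pw b)"
  using pw_smallo_pw landau_o.big_small_trans by blast

lemma const_bigtheta_pw: "c \<noteq> (0 :: real) \<Longrightarrow> (\<lambda>n. c) \<in> \<Theta>(pw 0)"
proof (rule bigthetaI')
  assume "c \<noteq> 0"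
  then show "0 < \<bar>c\<bar>" "0 < \<bar>c\<bar>"
    by simp_all
  show "\<forall>\<^sub>F n in sequentially. \<bar>c\<bar> * norm (pw 0 n) \<le> norm c \<and> norm c \<le> \<bar>c\<bar> * norm (pw 0 n)"
    using eventually_gt_at_top[of 0] by eventually_elim (simp add: pw_0)
qed

lemma const_bigo_pw: "(\<lambda>n. c :: real) \<in> O(pw 0)"
  using const_bigtheta_pw[of c] by (cases "c = 0") (auto dest: bigthetaD1)

lemma pw_eventually_nonzero: "\<forall>\<^sub>F n in sequentially. pw a n \<noteq> 0"
  using eventually_gt_at_top[of "0::nat"] by eventually_elim (simp add: pw_def)

lemma bigtheta_perturb:
  assumes "g \<in> \<Theta>(h)" "(\<lambda>n. f n - g n) \<in> o(h)"
  shows "(f :: nat \<Rightarrow> real) \<in> \<Theta>(h)"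
proof -
  have "(\<lambda>n. f n - g n) \<in> o(g)"
    using assms(2) landau_o.small.cong_bigtheta[OF assms(1)] by simp
  then have "\<Theta>(\<lambda>n. (f n - g n) + g n) = \<Theta>(g)"
    by (rule landau_theta.plus_absorb1)
  then have "f \<in> \<Theta>(g)"
    using bigtheta_refl[of f sequentially] by simp
  then show ?thesis
    using assms(1) landau_theta.bigtheta_trans1 by blast
qed

lemma poly_bigtheta:
  fixes p :: "real poly"
  assumes "p \<noteq> 0"
  shows "(\<lambda>n. poly p (real n)) \<in> \<Theta>(pw (real (degree p)))"
  using assms
proof (induction p)
  case (pCons a q)
  show ?case
  proof (cases "q = 0")
    case True
    then show ?thesis
      using pCons.hyps const_bigtheta_pw[of a] by simp
  next
    case False
    have "(\<lambda>n. pw 1 n * poly q (real n)) \<in> \<Theta>(\<lambda>n. pw 1 n * pw (real (degree q)) n)"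
      by (intro landau_theta.mult pCons.IH False bigtheta_refl)
    then have "(\<lambda>n. real n * poly q (real n)) \<in> \<Theta>(pw (real (Suc (degree q))))"
      by (simp add: pw_mult) (simp add: pw_1)
    moreover have "(\<lambda>n. a) \<in> o(pw (real (Suc (degree q))))"
      by (rule bigo_pw_smallo[OF const_bigo_pw]) simp
    ultimately have "(\<lambda>n. poly (pCons a q) (real n)) \<in> \<Theta>(pw (real (Suc (degree q))))"
      by (rule_tac bigtheta_perturb) auto
    then show ?thesis
      using False by simp
  qed
qed simp

lemma poly_eventually_nonzero:
  fixes p :: "real poly"
  assumes "p \<noteq> 0"
  shows "\<forall>\<^sub>F n in sequentially. poly p (real n) \<noteq> 0"
  using eventually_nonzero_bigtheta[OF poly_bigtheta[OF assms]] pw_eventually_nonzero by simp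

text \<open>The square of a rational function has even order of growth.\<close>

lemma rational_square_not_linear:
  fixes p q :: "real poly"
  assumes "q \<noteq> 0" and pq: "(\<lambda>n. (poly p (real n) / poly q (real n)) ^ 2) \<in> \<Theta>(\<lambda>n. pw 1 n)"
  shows False
proof -
  have sq: "(\<lambda>n. poly r (real n) ^ 2) \<in> \<Theta>(\<lambda>n. pw (2 * real (degree r)) n)" if "r \<noteq> 0" for r :: "real poly"
    using landau_theta.mult[OF poly_bigtheta[OF that] poly_bigtheta[OF that]]
    by (simp add: power2_eq_square pw_mult)
  have nz: "\<forall>\<^sub>F n in sequentially. poly q (real n) \<noteq> 0"
    by (rule poly_eventually_nonzero[OF assms(1)])
  have "(\<lambda>n. (poly p (real n) / poly q (real n)) ^ 2 * poly q (real n) ^ 2) \<in> \<Theta>(\<lambda>n. pw 1 n * pw (2 * real (degree q)) n)"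
    by (intro landau_theta.mult pq sq assms(1))
  moreover have "\<forall>\<^sub>F n in sequentially. (poly p (real n) / poly q (real n)) ^ 2 * poly q (real n) ^ 2 = poly p (real n) ^ 2"
    using nz by eventually_elim (simp add: power_divide)
  ultimately have p2: "(\<lambda>n. poly p (real n) ^ 2) \<in> \<Theta>(\<lambda>n. pw (1 + 2 * real (degree q)) n)"
    by (subst (asm) landau_theta.in_cong) (simp_all add: pw_mult)
  have "p \<noteq> 0"
  proof
    assume "p = 0"
    then have "\<forall>\<^sub>F n in sequentially. pw (1 + 2 * real (degree q)) n = 0"
      using p2 by simp
    with pw_eventually_nonzero[of "1 + 2 * real (degree q)"] have "\<forall>\<^sub>F n :: nat in sequentially. False"
      by eventually_elim simp
    then show False by simp
  qed
  have "(\<lambda>n. pw (2 * real (degree p)) n) \<in> \<Theta>(\<lambda>n. pw (1 + 2 * real (degree q)) n)"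
    using sq[OF \<open>p \<noteq> 0\<close>] p2 landau_theta.bigtheta_trans1 bigtheta_sym by blast
  then have "2 * real (degree p) = 1 + 2 * real (degree q)"
    using pw_bigtheta_iff by simp
  then have "2 * degree p = 1 + 2 * degree q"
    by linarith
  then show False by presburger
qed

section \<open>Cycles with at most one chord\<close>

locale theta_cycle =
  fixes S :: "index set" and v :: "nat \<Rightarrow> nat + nat" and L d :: nat
  assumes fin: "finite S"
    and d: "odd d" "3 \<le> d" and L: "even L" "d + 3 \<le> L"
    and closed: "v L = v 0"
    and inj: "inj_on v {..<L}"
    and adj: "\<And>k. k < L \<Longrightarrow> (v k, v (Suc k)) \<in> adjacency S"
    and chord: "\<And>p q. p \<in> v ` {..<L} \<Longrightarrow> q \<in> v ` {..<L} \<Longrightarrow> (p, q) \<in> adjacency S \<Longrightarrow>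
      (\<exists>k<L. {p, q} = {v k, v (Suc k)}) \<or> {p, q} = {v 0, v d}"

lemma theta_cycle_if_few_chords:
  assumes S: "S \<subseteq> {1..m} \<times> {1..n}" and cyc: "is_cycle (bipartite_graph m n S) vs" "6 \<le> length vs"
    and few: "\<not> 2 \<le> card (chords (bipartite_graph m n S) vs)"
  shows "\<exists>v L d. theta_cycle S v L d"
proof -
  let ?G = "bipartite_graph m n S"
  define L where "L = length vs"
  have finS: "finite S"
    using S finite_subset by blast
  have L0: "0 < L"
    using cyc(2) unfolding L_def by linarith
  have edge: "(vs ! (k mod L), vs ! (Suc k mod L)) \<in> adjacency S" for k
  proof -
    have "{vs ! (k mod L), vs ! (Suc (k mod L) mod L)} \<in> cycle_edges vs"
      using cycle_edgesI[of "k mod L" vs] L0 by (simp add: L_def)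
    then show ?thesis
      using cyc(1) unfolding is_cycle_def adjacency_iff[where m = m and n = n] by (auto simp: mod_Suc_eq)
  qed
  have par: "isl (vs ! (k mod L)) \<longleftrightarrow> (isl (vs ! 0) \<longleftrightarrow> even k)" for k
  proof (induction k)
    case (Suc k)
    then show ?case using adjacency_isl[OF edge[of k]] by auto
  qed simp
  have evenL: "even L"
    using par[of L] by (simp, blast)
  have chord: "{p, q} \<in> cycle_edges vs \<or> {p, q} \<in> chords ?G vs"
    if "p \<in> set vs" "q \<in> set vs" "(p, q) \<in> adjacency S" for p q
    using that unfolding chords_def adjacency_iff[where m = m and n = n] by auto
  have rotated: "theta_cycle S (\<lambda>k. vs ! ((a + k) mod L)) L d"
    if d: "odd d" "3 \<le> d" "d + 3 \<le> L"
      and ch: "chords ?G vs \<subseteq> {{vs ! (a mod L), vs ! ((a + d) mod L)}}" for a d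
  proof
    show "odd d" "3 \<le> d" "even L" "d + 3 \<le> L" "finite S"
      using d evenL finS by simp_all
    show "vs ! ((a + L) mod L) = vs ! ((a + 0) mod L)"
      by simp
    have rot: "vs ! ((a + k) mod L) = rotate a vs ! k" if "k < L" for k
      using that by (simp add: nth_rotate L_def)
    have "inj_on ((!) (rotate a vs)) {..<L}"
      using cyc(1) by (intro inj_on_nth) (simp_all add: is_cycle_def L_def)
    then show "inj_on (\<lambda>k. vs ! ((a + k) mod L)) {..<L}"
      by (rule inj_on_cong[THEN iffD1, rotated]) (simp add: rot)
    show "(vs ! ((a + k) mod L), vs ! ((a + Suc k) mod L)) \<in> adjacency S" for k
      using edge[of "a + k"] by simp
    have im: "(\<lambda>k. vs ! ((a + k) mod L)) ` {..<L} \<subseteq> set vs"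
      using L0 by (auto simp: L_def)
    fix p q assume pq: "p \<in> (\<lambda>k. vs ! ((a + k) mod L)) ` {..<L}" "q \<in> (\<lambda>k. vs ! ((a + k) mod L)) ` {..<L}"
      "(p, q) \<in> adjacency S"
    have "{p, q} \<in> cycle_edges vs \<or> {p, q} \<in> chords ?G vs"
      by (rule chord) (use pq im in auto)
    then show "(\<exists>k<L. {p, q} = {vs ! ((a + k) mod L), vs ! ((a + Suc k) mod L)}) \<or>
        {p, q} = {vs ! ((a + 0) mod L), vs ! ((a + d) mod L)}"
    proof
      assume "{p, q} \<in> chords ?G vs"
      then show ?thesis using ch by auto
    next
      assume "{p, q} \<in> cycle_edges vs"
      then obtain k where k: "k < L" "{p, q} = {vs ! k, vs ! (Suc k mod L)}"
        by (auto simp: cycle_edges_def L_def)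
      \<comment> \<open>Adding \<open>L * Suc a\<close> first makes the subtraction of
        \<open>a\<close> exact on natural numbers.\<close>
      define l where "l = (k + L * Suc a - a) mod L"
      have "a \<le> L * Suc a"
        using L0 by (cases L) auto
      then have "a + (k + L * Suc a - a) = k + L * Suc a"
        by linarith
      then have "(a + l) mod L = (k + L * Suc a) mod L"
        by (simp only: l_def mod_add_right_eq)
      also have "\<dots> = k"
        using k(1) by (simp only: mod_mult_self2 mod_less)
      finally have "(a + l) mod L = k" .
      moreover from this have "(a + Suc l) mod L = Suc k mod L"
        by (metis add_Suc_right mod_Suc_eq)
      moreover have "l < L"
        using L0 by (simp add: l_def)
      ultimately show ?thesis
        using k(2) by auto
    qed
  qed
  have "finite (chords ?G vs)"
    by (rule finite_subset[of _ "Pow (set vs)"]) (auto simp: chords_def)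
  with few consider "chords ?G vs = {}" | e where "chords ?G vs = {e}"
    by (metis One_nat_def Suc_1 Suc_leI card_0_eq card_1_singletonE gr0I linorder_neqE_nat
        less_antisym not_less_eq order_refl not_less)
  then show ?thesis
  proof cases
    case 1
    \<comment> \<open>Without a chord any admissible cut serves; 3 leaves at least 3 edges for the
      other arc.\<close>
    then show ?thesis
      using rotated[of 3 0] cyc(2) by (auto simp: L_def)
  next
    case (2 e)
    then have e: "e \<in> snd ?G" "e \<subseteq> set vs" "e \<notin> cycle_edges vs"
      by (auto simp: chords_def)
    then obtain i j where ij: "e = {Inl i, Inr j}"
      by (auto simp: bipartite_graph_def)
    then obtain a b where ab: "a < L" "b < L" "vs ! a = Inl i" "vs ! b = Inr j"
      using e(2) by (auto simp: in_set_conv_nth L_def)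
    define d where "d = (b + L - a) mod L"
    have dL: "d < L"
      using L0 by (simp add: d_def)
    have adb: "(a + d) mod L = b"
      using ab by (simp add: d_def mod_add_right_eq)
    have "even a \<longleftrightarrow> odd (a + d)"
      using par[of "a + d"] par[of a] ab adb by auto
    then have "odd d"
      by auto
    moreover have "d \<noteq> 1"
    proof
      assume "d = 1"
      then have "Suc a mod L = b"
        using adb by simp
      then have "e \<in> cycle_edges vs"
        using cycle_edgesI[of a vs] ab ij by (simp add: L_def)
      with e(3) show False by simp
    qed
    moreover have "d \<noteq> L - 1"
    proof
      assume "d = L - 1"
      then have "Suc b mod L = (a + L) mod L"
        using adb L0 by (metis Suc_diff_1 add_Suc_right mod_Suc_eq)
      then have "Suc b mod L = a"
        using ab(1) by simp
      then have "e \<in> cycle_edges vs"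
        using cycle_edgesI[of b vs] ab ij by (simp add: L_def insert_commute)
      with e(3) show False by simp
    qed
    ultimately have "3 \<le> d" "d + 3 \<le> L"
      using dL evenL by presburger+
    then show ?thesis
      using rotated[of d a] \<open>odd d\<close> 2 ij ab adb by auto
  qed
qed

definition ends :: "index \<Rightarrow> (nat + nat) set" where
  "ends e = {Inl (fst e), Inr (snd e)}"

lemma ends_eq_iff: "ends e = ends e' \<longleftrightarrow> e = e'"
  by (auto simp: ends_def doubleton_eq_iff prod_eq_iff)

lemma ends_adjacency: "(p, q) \<in> adjacency S \<longleftrightarrow> (\<exists>e\<in>S. ends e = {p, q})"
  by (cases p; cases q) (force simp: ends_def doubleton_eq_iff)+

text \<open>The vertices \<open>v 0\<close> and \<open>v d\<close> cut the cycle into two arcs. The weights have orders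
  \<open>1, 3, \<dots>, 3, 1\<close> along the first arc, \<open>0, 2, \<dots>, 2, 0\<close> along the second one, and order \<open>0\<close>
  elsewhere. Let \<open>y\<close>, \<open>y'\<close> be the fitted values of the outer edges of the second arc and \<open>x\<close> the
  product of the parameters of \<open>v 0\<close> and \<open>v d\<close>. The margins make \<open>y - y'\<close> bounded and fix the orders
  of all other fitted values on the cycle; alternating products along the arcs give \<open>x N\<^sup>3 \<sim> N\<^sup>2\<close>
  and \<open>y y' \<sim> x N\<^sup>2\<close>. Hence \<open>y\<^sup>2\<close> has order \<open>1\<close>.\<close>

context theta_cycle
begin

definition edge :: "nat \<Rightarrow> index" where
  "edge l = (SOME e. e \<in> S \<and> ends e = {v l, v (Suc l)})"

lemma edge: "l < L \<Longrightarrow> edge l \<in> S" "l < L \<Longrightarrow> ends (edge l) = {v l, v (Suc l)}"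
proof -
  assume "l < L"
  then have "\<exists>e. e \<in> S \<and> ends e = {v l, v (Suc l)}"
    using adj ends_adjacency by blast
  then have "edge l \<in> S \<and> ends (edge l) = {v l, v (Suc l)}"
    unfolding edge_def by (rule someI_ex)
  then show "edge l \<in> S" "ends (edge l) = {v l, v (Suc l)}"
    by simp_all
qed

lemma v_eq_iff: "k < L \<Longrightarrow> l < L \<Longrightarrow> v k = v l \<longleftrightarrow> k = l"
  using inj by (auto dest: inj_onD)

lemma v_Suc_eq_iff: "k < L \<Longrightarrow> l < L \<Longrightarrow> v (Suc k) = v l \<longleftrightarrow> Suc k = l \<or> Suc k = L \<and> l = 0"
  using v_eq_iff[of "Suc k" l] v_eq_iff[of 0 l] closed L by (cases "Suc k = L") auto

lemma mem_ends_edge: "k < L \<Longrightarrow> l < L \<Longrightarrow> v l \<in> ends (edge k) \<longleftrightarrow> k = l \<or> Suc k = l \<or> Suc k = L \<and> l = 0"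
  using v_eq_iff[of k l] v_Suc_eq_iff[of k l] by (auto simp: edge(2))

lemma edge_inj: "inj_on edge {..<L}"
proof (rule inj_onI)
  fix k l assume kl: "k \<in> {..<L}" "l \<in> {..<L}" "edge k = edge l"
  then have "v k \<in> ends (edge l)" "v l \<in> ends (edge k)"
    using edge(2)[of k] edge(2)[of l] by auto
  then have "(l = k \<or> Suc l = k \<or> Suc l = L \<and> k = 0) \<and> (k = l \<or> Suc k = l \<or> Suc k = L \<and> l = 0)"
    using mem_ends_edge[of k l] mem_ends_edge[of l k] kl by simp
  then show "k = l"
    using L d by linarith
qed

lemma edge_eq_iff: "k < L \<Longrightarrow> l < L \<Longrightarrow> edge k = edge l \<longleftrightarrow> k = l"
  using edge_inj by (auto dest: inj_onD)

text \<open>The inner orders 3 and 2 exceed the order 1 that bounds all deviations on the cycle, so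
  inner fitted values keep the order of the counts. That they differ by 1 is what makes the final
  order odd: \<open>x\<close> gets order 1 + 1 - 3 = -1, and \<open>y y'\<close> gets -1 + 2 =
  1.\<close>

definition expo :: "index \<Rightarrow> nat" where
  "expo e = (if e = edge 0 \<or> e = edge (d - 1) then 1
     else if e \<in> edge ` {0<..<d - 1} then 3 else if e \<in> edge ` {d<..<L - 1} then 2 else 0)"

lemma expo_edge:
  "expo (edge 0) = 1" "expo (edge (d - 1)) = 1" "expo (edge d) = 0" "expo (edge (L - 1)) = 0"
  "0 < l \<Longrightarrow> l < d - 1 \<Longrightarrow> expo (edge l) = 3" "d < l \<Longrightarrow> l < L - 1 \<Longrightarrow> expo (edge l) = 2"
proof -
  have *: "edge l \<in> edge ` A \<longleftrightarrow> l \<in> A" if "l < L" "A \<subseteq> {..<L}" for l A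
    using inj_on_image_mem_iff[OF edge_inj] that by blast
  have **: "expo (edge l) = (if l = 0 \<or> l = d - 1 then 1 else if l \<in> {0<..<d - 1} then 3
      else if l \<in> {d<..<L - 1} then 2 else 0)" if "l < L" for l
  proof -
    have "{0<..<d - 1} \<subseteq> {..<L}" "{d<..<L - 1} \<subseteq> {..<L}" "0 < L" "d - 1 < L"
      using d L by auto
    then show ?thesis
      unfolding expo_def using that by (simp only: * edge_eq_iff)
  qed
  show "expo (edge 0) = 1" "expo (edge (d - 1)) = 1" "expo (edge d) = 0" "expo (edge (L - 1)) = 0"
    "0 < l \<Longrightarrow> l < d - 1 \<Longrightarrow> expo (edge l) = 3" "d < l \<Longrightarrow> l < L - 1 \<Longrightarrow> expo (edge l) = 2"
    using d L by (auto simp: **)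
qed

lemma expo_off_cycle: "e \<notin> edge ` {..<L} \<Longrightarrow> expo e = 0"
proof -
  assume "e \<notin> edge ` {..<L}"
  moreover have "{0<..<d - 1} \<subseteq> {..<L}" "{d<..<L - 1} \<subseteq> {..<L}" "0 \<in> {..<L}" "d - 1 \<in> {..<L}"
    using d L by auto
  moreover have "e \<notin> edge ` A" if "A \<subseteq> {..<L}" for A
    using image_mono[OF that, of edge] calculation(1) by blast
  moreover from this[of "{0}"] this[of "{d - 1}"] have "e \<noteq> edge 0" "e \<noteq> edge (d - 1)"
    using d L by auto
  ultimately show "expo e = 0"
    unfolding expo_def by simp
qed

text \<open>This makes the margins at both branch vertices, and hence all fitted values there, of
  order at most 1.\<close>

lemma expo_at_branch:
  assumes "v 0 \<in> ends e \<or> v d \<in> ends e"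
  shows "expo e \<le> 1"
proof (cases "e \<in> edge ` {..<L}")
  case True
  then obtain k where k: "k < L" "e = edge k" by auto
  then have "k = 0 \<or> Suc k = L \<or> k = d \<or> Suc k = d"
    using assms mem_ends_edge[of k 0] mem_ends_edge[of k d] L d by auto
  then have "k = 0 \<or> k = L - 1 \<or> k = d \<or> k = d - 1"
    by auto
  then show ?thesis
    using k expo_edge by auto
next
  case False
  then show ?thesis
    by (simp add: expo_off_cycle)
qed

definition core :: "index set" where
  "core = edge ` {..<L} \<union> {e. ends e = {v 0, v d}}"

text \<open>Such an edge has an end off the cycle, where the margin is bounded. This decouples the
  cycle from the rest of the graph up to bounded errors.\<close>

lemma off_core:
  assumes e: "e \<in> S" "e \<notin> core"
  obtains z where "z \<in> ends e" "\<And>e'. z \<in> ends e' \<Longrightarrow> expo e' = 0"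
proof -
  have "\<exists>z\<in>ends e. z \<notin> v ` {..<L}"
  proof (rule ccontr)
    assume "\<not> (\<exists>z\<in>ends e. z \<notin> v ` {..<L})"
    then have "Inl (fst e) \<in> v ` {..<L}" "Inr (snd e) \<in> v ` {..<L}"
      by (auto simp: ends_def)
    then have "(\<exists>k<L. ends e = {v k, v (Suc k)}) \<or> ends e = {v 0, v d}"
      using chord e(1) unfolding ends_def by simp
    then show False
    proof
      assume "\<exists>k<L. ends e = {v k, v (Suc k)}"
      then obtain k where "k < L" "ends e = ends (edge k)"
        using edge(2) by auto
      then show False
        using e(2) ends_eq_iff by (auto simp: core_def)
    qed (use e(2) in \<open>simp add: core_def\<close>)
  qed
  then obtain z where z: "z \<in> ends e" "z \<notin> v ` {..<L}" by blast
  have "expo e' = 0" if "z \<in> ends e'" for e'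
  proof (rule expo_off_cycle, rule notI)
    assume "e' \<in> edge ` {..<L}"
    then obtain k where k: "k < L" "e' = edge k"
      by auto
    then have "z = v k \<or> z = v (Suc k)"
      using that edge(2)[OF k(1)] by simp
    with k(1) have "z \<in> v ` {..<L}"
      using closed by (cases "Suc k = L") auto
    with z(2) show False by simp
  qed
  with z(1) show thesis by (rule that)
qed

end

section \<open>Orders of growth of the fitted counts\<close>

lemma same_margins_ends:
  assumes "same_margins S P Q"
  shows "(\<Sum>e | e \<in> S \<and> z \<in> ends e. P e) = (\<Sum>e | e \<in> S \<and> z \<in> ends e. Q e)"
  using assms unfolding same_margins_def by (cases z) (auto simp: ends_def eq_commute)

text \<open>The identity \<open>(f + g)^2 = 4 f g + (f - g)^2\<close> bounds the sum, and
  \<open>f\<close> is half of sum plus difference.\<close>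

lemma bigo_half_power:
  fixes f g :: "nat \<Rightarrow> real"
  assumes "(\<lambda>N. f N * g N) \<in> O(\<lambda>N. pw 1 N)" "(\<lambda>N. f N - g N) \<in> O(\<lambda>N. pw 0 N)"
  shows "f \<in> O(\<lambda>N. pw (1 / 2) N)"
proof -
  have "(\<lambda>N. (f N - g N) * (f N - g N)) \<in> O(\<lambda>N. pw 0 N * pw 0 N)"
    by (rule landau_o.big.mult[OF assms(2,2)])
  then have "(\<lambda>N. (f N - g N) * (f N - g N)) \<in> O(pw 0)"
    by (simp add: pw_mult)
  then have "(\<lambda>N. (f N - g N) * (f N - g N)) \<in> O(pw 1)"
    by (rule bigo_pw_mono) simp
  then have "(\<lambda>N. 4 * (f N * g N) + (f N - g N) * (f N - g N)) \<in> O(\<lambda>N. pw 1 N)"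
    using assms(1) by (intro sum_in_bigo) simp_all
  then have "(\<lambda>N. (f N + g N) ^ 2) \<in> O(\<lambda>N. pw 1 N)"
    by (simp add: power2_eq_square algebra_simps)
  then have "(\<lambda>N. \<bar>(f N + g N) ^ 2\<bar> powr (1 / 2)) \<in> O(\<lambda>N. \<bar>pw 1 N\<bar> powr (1 / 2))"
    by (rule bigo_powr) simp
  then have "(\<lambda>N. \<bar>f N + g N\<bar>) \<in> O(\<lambda>N. pw (1 / 2) N)"
    by (simp add: powr_half_sqrt pw_def)
  then have "(\<lambda>N. f N + g N) \<in> O(\<lambda>N. pw (1 / 2) N)"
    by simp
  moreover have "(\<lambda>N. f N - g N) \<in> O(\<lambda>N. pw (1 / 2) N)"
    by (rule bigo_pw_mono[OF assms(2)]) simp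
  ultimately have "(\<lambda>N. (f N + g N) + (f N - g N)) \<in> O(\<lambda>N. pw (1 / 2) N)"
    by (rule sum_in_bigo)
  then show ?thesis by simp
qed

text \<open>On a path of odd length the alternating product of the edge values telescopes to the
  product of the two end parameters. The inner edges all have order \<open>h\<close> and cancel in
  pairs, except for one.\<close>

lemma arc_order:
  fixes T :: "nat \<Rightarrow> nat \<Rightarrow> real"
  assumes nz: "\<forall>\<^sub>F N in sequentially. h N \<noteq> 0"
    and inner: "\<And>l. 0 < l \<Longrightarrow> l < 2 * a + 2 \<Longrightarrow> (\<lambda>N. T N l * T N (Suc l)) \<in> \<Theta>(h)"
  shows "(\<lambda>N. (T N 0 * T N 1) * (T N (2 * a + 2) * T N (2 * a + 3))) \<in> \<Theta>(\<lambda>N. (T N 0 * T N (2 * a + 3)) * h N)"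
proof -
  have step: "(\<lambda>N. T N 0 * T N (2 * b + 1)) \<in> \<Theta>(\<lambda>N. T N 0 * T N 1)" if "b \<le> a" for b
    using that
  proof (induction b)
    case (Suc b)
    have "(\<lambda>N. T N (2 * b + 2) * T N (Suc (2 * b + 2))) \<in> \<Theta>(h)"
      by (rule inner) (use Suc.prems in auto)
    then have "(\<lambda>N. (T N 0 * T N (2 * b + 1)) * (T N (2 * b + 2) * T N (Suc (2 * b + 2)))) \<in> \<Theta>(\<lambda>N. (T N 0 * T N 1) * h N)"
      by (rule landau_theta.mult[OF Suc.IH[OF Suc_leD[OF Suc.prems]]])
    moreover have "(T N 0 * T N (2 * b + 1)) * (T N (2 * b + 2) * T N (Suc (2 * b + 2))) =
        (T N 0 * T N (2 * Suc b + 1)) * (T N (2 * b + 1) * T N (Suc (2 * b + 1)))" for N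
      by (simp add: mult_ac)
    ultimately have "(\<lambda>N. (T N 0 * T N (2 * Suc b + 1)) * (T N (2 * b + 1) * T N (Suc (2 * b + 1)))) \<in> \<Theta>(\<lambda>N. (T N 0 * T N 1) * h N)"
      by (simp only:)
    moreover have "(\<lambda>N. T N (2 * b + 1) * T N (Suc (2 * b + 1))) \<in> \<Theta>(h)"
      using Suc by (intro inner) auto
    ultimately show ?case
      using landau_theta.mult_cancel_right[OF _ nz] by blast
  qed simp
  have "(\<lambda>N. (T N 0 * T N (2 * a + 1)) * (T N (2 * a + 2) * T N (2 * a + 3)))
      \<in> \<Theta>(\<lambda>N. (T N 0 * T N 1) * (T N (2 * a + 2) * T N (2 * a + 3)))"
    by (intro landau_theta.mult step) auto
  moreover have "(\<lambda>N. (T N 0 * T N (2 * a + 3)) * (T N (2 * a + 1) * T N (Suc (2 * a + 1)))) \<in> \<Theta>(\<lambda>N. (T N 0 * T N (2 * a + 3)) * h N)"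
    by (intro landau_theta.mult inner) auto
  then have "(\<lambda>N. (T N 0 * T N (2 * a + 1)) * (T N (2 * a + 2) * T N (2 * a + 3))) \<in> \<Theta>(\<lambda>N. (T N 0 * T N (2 * a + 3)) * h N)"
    by (simp add: mult_ac)
  ultimately show ?thesis
    using bigtheta_sym landau_theta.bigtheta_trans1 by blast
qed

text \<open>\<open>P N\<close> plays the estimate scaled by the sample size. The conditions are
  eventual because the estimate is only controlled for large \<open>N\<close>.\<close>

locale theta_cycle_fit = theta_cycle +
  fixes w :: "index \<Rightarrow> nat" and P :: "nat \<Rightarrow> index \<Rightarrow> real" and T :: "nat \<Rightarrow> nat + nat \<Rightarrow> real"
  assumes w: "\<And>e. e \<in> S \<Longrightarrow> 1 \<le> w e"
    and marg: "\<forall>\<^sub>F N in sequentially. same_margins S (\<lambda>e. real (w e) * pw (real (expo e)) N) (P N)"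
    and pos: "\<forall>\<^sub>F N in sequentially. \<forall>e\<in>S. 0 < P N e"
    and param: "\<forall>\<^sub>F N in sequentially. \<forall>e\<in>S. P N e = T N (Inl (fst e)) * T N (Inr (snd e))"
begin

definition u :: "nat \<Rightarrow> index \<Rightarrow> real" where
  "u N e = real (w e) * pw (real (expo e)) N"

definition D :: "nat \<Rightarrow> index \<Rightarrow> real" where
  "D N e = P N e - u N e"

lemma u_bigtheta: "e \<in> S \<Longrightarrow> (\<lambda>N. u N e) \<in> \<Theta>(\<lambda>N. pw (real (expo e)) N)"
  using w[of e] by (simp add: u_def)

lemma margin: "\<forall>\<^sub>F N in sequentially. (\<Sum>e | e \<in> S \<and> z \<in> ends e. P N e) = (\<Sum>e | e \<in> S \<and> z \<in> ends e. u N e)"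
  using marg by eventually_elim (simp add: same_margins_ends[symmetric] u_def)

text \<open>By positivity a fitted value is at most its margin, which it shares with the
  counts.\<close>

lemma P_le_margin:
  assumes "e \<in> S" "z \<in> ends e" "\<And>e'. e' \<in> S \<Longrightarrow> z \<in> ends e' \<Longrightarrow> expo e' \<le> k"
  shows "(\<lambda>N. P N e) \<in> O(\<lambda>N. pw (real k) N)"
proof (rule bigoI[of _ "\<Sum>e | e \<in> S \<and> z \<in> ends e. real (w e)"])
  show "\<forall>\<^sub>F N in sequentially. norm (P N e) \<le> (\<Sum>e | e \<in> S \<and> z \<in> ends e. real (w e)) * norm (pw (real k) N)"
    using margin[of z] pos eventually_ge_at_top[of 1]
  proof eventually_elim
    case (elim N)
    have "P N e \<le> (\<Sum>e | e \<in> S \<and> z \<in> ends e. P N e)"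
      using assms elim(2) fin by (intro member_le_sum) (auto intro: less_imp_le)
    also have "\<dots> = (\<Sum>e | e \<in> S \<and> z \<in> ends e. u N e)"
      by (rule elim(1))
    also have "\<dots> \<le> (\<Sum>e | e \<in> S \<and> z \<in> ends e. real (w e) * pw (real k) N)"
      unfolding u_def using assms(3) elim(3) by (intro sum_mono mult_left_mono pw_mono) auto
    finally show ?case
      using elim(2) assms(1) by (auto simp: sum_distrib_right less_imp_le pw_nonneg)
  qed
qed

lemma u_bigo: "e \<in> S \<Longrightarrow> expo e \<le> k \<Longrightarrow> (\<lambda>N. u N e) \<in> O(\<lambda>N. pw (real k) N)"
proof -
  assume "e \<in> S" "expo e \<le> k"
  show ?thesis
    by (rule bigo_pw_mono[OF bigthetaD1[OF u_bigtheta[OF \<open>e \<in> S\<close>]]]) (use \<open>expo e \<le> k\<close> in simp)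
qed

lemma D_bigo_margin:
  assumes "e \<in> S" "z \<in> ends e" "\<And>e'. e' \<in> S \<Longrightarrow> z \<in> ends e' \<Longrightarrow> expo e' \<le> k"
  shows "(\<lambda>N. D N e) \<in> O(\<lambda>N. pw (real k) N)"
  unfolding D_def using P_le_margin[OF assms] u_bigo[OF assms(1) assms(3)[OF assms(1,2)]]
  by (rule sum_in_bigo)

lemma D_off_core: "e \<in> S \<Longrightarrow> e \<notin> core \<Longrightarrow> (\<lambda>N. D N e) \<in> O(\<lambda>N. pw 0 N)"
  using off_core[of e] D_bigo_margin[of e _ 0] by (metis le_numeral_extra(3) of_nat_0)

lemma D_branch: "e \<in> S \<Longrightarrow> v 0 \<in> ends e \<or> v d \<in> ends e \<Longrightarrow> (\<lambda>N. D N e) \<in> O(\<lambda>N. pw 1 N)"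
  using D_bigo_margin[of e _ 1] expo_at_branch by (metis of_nat_1)

lemma P_branch: "e \<in> S \<Longrightarrow> v 0 \<in> ends e \<or> v d \<in> ends e \<Longrightarrow> (\<lambda>N. P N e) \<in> O(\<lambda>N. pw 1 N)"
  using P_le_margin[of e _ 1] expo_at_branch by (metis of_nat_1)

text \<open>The deviations at a vertex add up to zero, and those outside the core are
  bounded.\<close>

lemma D_vertex:
  assumes A: "A = {e \<in> S \<inter> core. z \<in> ends e}"
  shows "(\<lambda>N. \<Sum>e\<in>A. D N e) \<in> O(\<lambda>N. pw 0 N)"
proof -
  let ?R = "{e \<in> S - core. z \<in> ends e}"
  have "\<forall>\<^sub>F N in sequentially. (\<Sum>e\<in>A. D N e) = - (\<Sum>e\<in>?R. D N e)"
    using margin[of z]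
  proof eventually_elim
    case (elim N)
    have "{e. e \<in> S \<and> z \<in> ends e} = A \<union> ?R"
      using A by auto
    moreover have "sum (D N) (A \<union> ?R) = sum (D N) A + sum (D N) ?R"
      using A fin by (intro sum.union_disjoint) auto
    ultimately have "(\<Sum>e | e \<in> S \<and> z \<in> ends e. D N e) = sum (D N) A + sum (D N) ?R"
      by simp
    moreover have "(\<Sum>e | e \<in> S \<and> z \<in> ends e. D N e) = 0"
      using elim by (simp add: D_def sum_subtractf)
    ultimately show ?case by simp
  qed
  moreover have "(\<lambda>N. - (\<Sum>e\<in>?R. D N e)) \<in> O(\<lambda>N. pw 0 N)"
    using D_off_core by (simp, intro big_sum_in_bigo) auto
  ultimately show ?thesis
    by (subst landau_o.big.in_cong)
qed

text \<open>Only two core edges meet at an inner vertex of an arc, so deviations alternate in sign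
  along an arc up to bounded errors. The hypotheses keep away from the branch vertices
  \<open>v d\<close> and \<open>v L\<close>.\<close>

lemma D_step:
  assumes "Suc l < L" "Suc l \<noteq> d"
  shows "(\<lambda>N. D N (edge l) + D N (edge (Suc l))) \<in> O(\<lambda>N. pw 0 N)"
proof -
  have "{edge l, edge (Suc l)} = {e \<in> S \<inter> core. v (Suc l) \<in> ends e}"
  proof (intro equalityI subsetI)
    fix e assume "e \<in> {edge l, edge (Suc l)}"
    then show "e \<in> {e \<in> S \<inter> core. v (Suc l) \<in> ends e}"
      using assms(1) edge[of l] edge[of "Suc l"] by (auto simp: core_def)
  next
    fix e assume e: "e \<in> {e \<in> S \<inter> core. v (Suc l) \<in> ends e}"
    have "ends e \<noteq> {v 0, v d}"
      using e assms v_eq_iff[of "Suc l" 0] v_eq_iff[of "Suc l" d] L by auto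
    then obtain k where "k < L" "e = edge k"
      using e by (auto simp: core_def)
    then show "e \<in> {edge l, edge (Suc l)}"
      using e mem_ends_edge[of k "Suc l"] assms(1) by auto
  qed
  from D_vertex[OF this] show ?thesis
    using edge_eq_iff[of l "Suc l"] assms(1) by simp
qed

text \<open>A set with at most one element, so that the chordless case needs no separate
  treatment.\<close>

abbreviation chord_edge :: "index set" where
  "chord_edge \<equiv> {e \<in> S. ends e = {v 0, v d}}"

lemma chord_edge_off_cycle: "e \<in> chord_edge \<Longrightarrow> e \<notin> edge ` {..<L}"
proof
  assume e: "e \<in> chord_edge" "e \<in> edge ` {..<L}"
  then obtain k where k: "k < L" "e = edge k" by auto
  then have "v 0 \<in> ends (edge k)" "v d \<in> ends (edge k)"
    using e(1) by auto
  then show False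
    using mem_ends_edge[of k 0] mem_ends_edge[of k d] k(1) L d by auto
qed

lemma D_branch_sum:
  "(\<lambda>N. D N (edge 0) + D N (edge (L - 1)) + (\<Sum>e\<in>chord_edge. D N e)) \<in> O(\<lambda>N. pw 0 N)"
  "(\<lambda>N. D N (edge (d - 1)) + D N (edge d) + (\<Sum>e\<in>chord_edge. D N e)) \<in> O(\<lambda>N. pw 0 N)"
proof -
  have aux: "(\<lambda>N. D N (edge a) + D N (edge b) + (\<Sum>e\<in>chord_edge. D N e)) \<in> O(\<lambda>N. pw 0 N)"
    if ab: "a < L" "b < L" "a \<noteq> b" and z: "z = v 0 \<or> z = v d"
      and inc: "\<And>k. k < L \<Longrightarrow> z \<in> ends (edge k) \<longleftrightarrow> k = a \<or> k = b" for a b z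
  proof -
    have "{edge a, edge b} \<union> chord_edge = {e \<in> S \<inter> core. z \<in> ends e}"
      using ab z inc edge(1) unfolding core_def by auto
    from D_vertex[OF this] have "(\<lambda>N. \<Sum>e\<in>{edge a, edge b} \<union> chord_edge. D N e) \<in> O(\<lambda>N. pw 0 N)" .
    moreover have "(\<Sum>e\<in>{edge a, edge b} \<union> chord_edge. D N e) = (\<Sum>e\<in>{edge a, edge b}. D N e) + (\<Sum>e\<in>chord_edge. D N e)" for N
      using fin chord_edge_off_cycle[of "edge a"] chord_edge_off_cycle[of "edge b"] ab(1,2)
      by (intro sum.union_disjoint) auto
    moreover have "edge a \<noteq> edge b"
      using edge_eq_iff ab by simp
    ultimately show ?thesis by simp
  qed
  show "(\<lambda>N. D N (edge 0) + D N (edge (L - 1)) + (\<Sum>e\<in>chord_edge. D N e)) \<in> O(\<lambda>N. pw 0 N)"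
    by (rule aux[of _ _ "v 0"]) (use L d mem_ends_edge[of _ 0] in auto)
  show "(\<lambda>N. D N (edge (d - 1)) + D N (edge d) + (\<Sum>e\<in>chord_edge. D N e)) \<in> O(\<lambda>N. pw 0 N)"
    by (rule aux[of _ _ "v d"]) (use L d mem_ends_edge[of _ d] in auto)
qed

text \<open>The bound holds for the first edge of the arc, which touches a branch vertex, and
  \<open>D_step\<close> passes it on.\<close>

lemma D_arc:
  assumes "a = 0 \<and> b = d \<or> a = d \<and> b = L" "a \<le> l" "l < b"
  shows "(\<lambda>N. D N (edge l)) \<in> O(\<lambda>N. pw 1 N)"
  using assms(2,3)
proof (induction l rule: dec_induct)
  case base
  have "edge a \<in> S" "v 0 \<in> ends (edge a) \<or> v d \<in> ends (edge a)"
    using assms L d edge[of a] by auto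
  then show ?case by (rule D_branch)
next
  case (step l)
  have "(\<lambda>N. D N (edge l) + D N (edge (Suc l))) \<in> O(\<lambda>N. pw 1 N)"
    by (rule bigo_pw_mono, rule D_step) (use step assms(1) L d in auto)
  moreover have "(\<lambda>N. D N (edge l)) \<in> O(\<lambda>N. pw 1 N)"
    using step by simp
  ultimately have "(\<lambda>N. (D N (edge l) + D N (edge (Suc l))) - D N (edge l)) \<in> O(\<lambda>N. pw 1 N)"
    by (rule sum_in_bigo)
  then show ?case by simp
qed

lemma P_inner:
  assumes "0 < l" "l < L" "l \<noteq> d - 1" "l \<noteq> d" "l \<noteq> L - 1"
  shows "(\<lambda>N. P N (edge l)) \<in> \<Theta>(\<lambda>N. pw (real (expo (edge l))) N)"
proof -
  have "1 < expo (edge l)"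
    using assms expo_edge(5)[of l] expo_edge(6)[of l] by (cases "l < d") auto
  moreover have "(\<lambda>N. D N (edge l)) \<in> O(pw 1)"
    using D_arc[of 0 d l] D_arc[of d L l] assms by (cases "l < d") auto
  ultimately have "(\<lambda>N. P N (edge l) - u N (edge l)) \<in> o(pw (real (expo (edge l))))"
    unfolding D_def by (intro bigo_pw_smallo[of _ 1]) simp_all
  then show ?thesis
    by (rule bigtheta_perturb[OF u_bigtheta[OF edge(1)[OF assms(2)]]])
qed

lemma P_edge: "l < L \<Longrightarrow> \<forall>\<^sub>F N in sequentially. P N (edge l) = T N (v l) * T N (v (Suc l))"
  using param
proof eventually_elim
  case (elim N)
  then have "P N (edge l) = T N (Inl (fst (edge l))) * T N (Inr (snd (edge l)))"
    using edge(1) by blast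
  moreover have "(v l = Inl (fst (edge l)) \<and> v (Suc l) = Inr (snd (edge l))) \<or>
      (v l = Inr (snd (edge l)) \<and> v (Suc l) = Inl (fst (edge l)))"
    using edge(2)[OF elim(1)] by (auto simp: ends_def doubleton_eq_iff)
  ultimately show ?case by (auto simp: mult.commute)
qed

lemma arcs:
  "(\<lambda>N. P N (edge 0) * P N (edge (d - 1))) \<in> \<Theta>(\<lambda>N. (T N (v 0) * T N (v d)) * pw 3 N)"
  "(\<lambda>N. P N (edge d) * P N (edge (L - 1))) \<in> \<Theta>(\<lambda>N. (T N (v 0) * T N (v d)) * pw 2 N)"
proof -
  have aux: "(\<lambda>N. P N (edge s) * P N (edge (r - 1))) \<in> \<Theta>(\<lambda>N. (T N (v s) * T N (v r)) * pw k N)"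
    if sr: "odd (r - s)" "s + 3 \<le> r" "r \<le> L"
      and k: "\<And>l. s < l \<Longrightarrow> l < r - 1 \<Longrightarrow> (\<lambda>N. P N (edge l)) \<in> \<Theta>(\<lambda>N. pw k N)" for s r k
  proof -
    from sr(1) obtain c where "r - s = 2 * c + 1"
      by (elim oddE)
    then have c: "r = s + 2 * (c - 1) + 3" "c \<noteq> 0"
      using sr(2) by auto
    define a where "a = c - 1"
    have r: "r = s + 2 * a + 3"
      using c by (simp add: a_def)
    have "(\<lambda>N. (T N (v (s + 0)) * T N (v (s + 1))) * (T N (v (s + (2 * a + 2))) * T N (v (s + (2 * a + 3))))) \<in>
        \<Theta>(\<lambda>N. (T N (v (s + 0)) * T N (v (s + (2 * a + 3)))) * pw k N)"
    proof (rule arc_order[OF pw_eventually_nonzero])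
      fix l assume l: "0 < l" "l < 2 * a + 2"
      have "(\<lambda>N. P N (edge (s + l))) \<in> \<Theta>(\<lambda>N. pw k N)"
        using l r by (intro k) auto
      then show "(\<lambda>N. T N (v (s + l)) * T N (v (s + Suc l))) \<in> \<Theta>(\<lambda>N. pw k N)"
        using landau_theta.in_cong[OF P_edge[of "s + l"]] l r sr(3) by simp
    qed
    note main = this
    have ev: "\<forall>\<^sub>F N in sequentially. P N (edge s) * P N (edge (r - 1)) =
        (T N (v (s + 0)) * T N (v (s + 1))) * (T N (v (s + (2 * a + 2))) * T N (v (s + (2 * a + 3))))"
    proof -
      have "s < L" "r - 1 < L"
        using r sr(3) by auto
      from P_edge[OF this(1)] P_edge[OF this(2)] show ?thesis
        by eventually_elim (simp add: r numeral_3_eq_3)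
    qed
    have r': "s + (2 * a + 3) = r" "s + 0 = s"
      using r by simp_all
    show ?thesis
      using iffD2[OF landau_theta.in_cong[OF ev] main] unfolding r' .
  qed
  have "(\<lambda>N. P N (edge l)) \<in> \<Theta>(\<lambda>N. pw 3 N)" if "0 < l" "l < d - 1" for l
    using P_inner[of l] that L d by (simp add: expo_edge(5))
  then show "(\<lambda>N. P N (edge 0) * P N (edge (d - 1))) \<in> \<Theta>(\<lambda>N. (T N (v 0) * T N (v d)) * pw 3 N)"
    by (intro aux) (use L d in auto)
  have "(\<lambda>N. P N (edge l)) \<in> \<Theta>(\<lambda>N. pw 2 N)" if "d < l" "l < L - 1" for l
    using P_inner[of l] that L d by (simp add: expo_edge(6))
  then have "(\<lambda>N. P N (edge d) * P N (edge (L - 1))) \<in> \<Theta>(\<lambda>N. (T N (v d) * T N (v L)) * pw 2 N)"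
    by (intro aux) (use L d in auto)
  then show "(\<lambda>N. P N (edge d) * P N (edge (L - 1))) \<in> \<Theta>(\<lambda>N. (T N (v 0) * T N (v d)) * pw 2 N)"
    by (simp add: closed mult_ac)
qed

text \<open>The second arc has an odd number of edges, so the alternation gives its two outer edges
  the same sign; their counts are bounded.\<close>

lemma difference: "(\<lambda>N. P N (edge d) - P N (edge (L - 1))) \<in> O(\<lambda>N. pw 0 N)"
proof -
  have "(\<lambda>N. D N (edge (d + 2 * k)) - D N (edge d)) \<in> O(\<lambda>N. pw 0 N)" if "d + 2 * k < L" for k
    using that
  proof (induction k)
    case (Suc k)
    have "(\<lambda>N. D N (edge (d + 2 * k)) + D N (edge (Suc (d + 2 * k)))) \<in> O(\<lambda>N. pw 0 N)"
      "(\<lambda>N. D N (edge (Suc (d + 2 * k))) + D N (edge (Suc (Suc (d + 2 * k))))) \<in> O(\<lambda>N. pw 0 N)"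
      by (rule D_step; use Suc.prems in simp)+
    note steps = this
    have "(\<lambda>N. D N (edge (d + 2 * k)) - D N (edge d)) \<in> O(\<lambda>N. pw 0 N)"
      using Suc by simp
    then have "(\<lambda>N. (D N (edge (d + 2 * k)) - D N (edge d)) +
        ((D N (edge (Suc (d + 2 * k))) + D N (edge (Suc (Suc (d + 2 * k))))) -
         (D N (edge (d + 2 * k)) + D N (edge (Suc (d + 2 * k)))))) \<in> O(\<lambda>N. pw 0 N)"
      by (rule sum_in_bigo(1)[OF _ sum_in_bigo(2)[OF steps(2,1)]])
    then show ?case by simp
  qed simp
  moreover have "even (L - 1 - d)"
    using L d by simp
  then obtain k where "L - 1 - d = 2 * k"
    by (elim evenE)
  then have "L - 1 = d + 2 * k"
    using L by simp
  ultimately have "(\<lambda>N. D N (edge (L - 1)) - D N (edge d)) \<in> O(pw 0)"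
    using L by simp
  moreover have "(\<lambda>N. u N (edge d)) \<in> O(pw 0)" "(\<lambda>N. u N (edge (L - 1))) \<in> O(pw 0)"
    using u_bigo[of _ 0] edge(1) expo_edge(3,4) L by simp_all
  ultimately have "(\<lambda>N. (u N (edge d) - u N (edge (L - 1))) - (D N (edge (L - 1)) - D N (edge d))) \<in> O(pw 0)"
    using sum_in_bigo(2) by blast
  then show ?thesis
    by (simp add: D_def)
qed

text \<open>Two passes. The trivial bound on the outer edges of the first arc gives \<open>X\<close>
  order at most -1, hence \<open>y\<close> order at most 1/2. This makes the deviations of those
  outer edges negligible against their counts, so they have order exactly 1, and the same chain of
  relations becomes exact. Finally \<open>y^2\<close> differs from \<open>y y'\<close> by
  \<open>y (y - y')\<close>, of order at most 1/2.\<close>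

theorem fitted_square_order: "(\<lambda>N. P N (edge d) ^ 2) \<in> \<Theta>(\<lambda>N. pw 1 N)"
proof -
  define X where "X N = T N (v 0) * T N (v d)" for N
  note A1 = arcs(1)[folded X_def] and A2 = arcs(2)[folded X_def]
  have lt: "0 < L" "d < L" "d - 1 < L" "L - 1 < L"
    using L d by auto
  have inc: "v 0 \<in> ends (edge 0)" "v d \<in> ends (edge (d - 1))" "v d \<in> ends (edge d)" "v 0 \<in> ends (edge (L - 1))"
    using lt L d mem_ends_edge by auto
  have small: "f \<in> o(\<lambda>N. pw 1 N)" if "f \<in> O(\<lambda>N. pw a N)" "a < 1" for f :: "nat \<Rightarrow> real" and a
    using that by (rule bigo_pw_smallo)
  have "(\<lambda>N. P N (edge 0) * P N (edge (d - 1))) \<in> O(\<lambda>N. pw 1 N * pw 1 N)"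
    using inc lt by (intro landau_o.big.mult P_branch edge(1)) auto
  then have "(\<lambda>N. X N * pw 3 N) \<in> O(\<lambda>N. pw 1 N * pw 1 N)"
    using landau_o.big.in_cong_bigtheta[OF A1] by blast
  then have "(\<lambda>N. X N * pw 3 N) \<in> O(\<lambda>N. pw (-1) N * pw 3 N)"
    by (simp only: pw_mult) simp
  then have X: "X \<in> O(\<lambda>N. pw (-1) N)"
    using landau_o.big.mult_cancel_right[OF bigtheta_refl pw_eventually_nonzero] by blast
  have "(\<lambda>N. X N * pw 2 N) \<in> O(\<lambda>N. pw (-1) N * pw 2 N)"
    using X by (intro landau_o.big.mult) auto
  then have "(\<lambda>N. X N * pw 2 N) \<in> O(\<lambda>N. pw 1 N)"
    by (simp only: pw_mult) simp
  then have yy: "(\<lambda>N. P N (edge d) * P N (edge (L - 1))) \<in> O(\<lambda>N. pw 1 N)"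
    using landau_o.big.in_cong_bigtheta[OF A2] by blast
  have y: "(\<lambda>N. P N (edge d)) \<in> O(\<lambda>N. pw (1 / 2) N)"
    by (rule bigo_half_power[OF yy difference])
  have "(\<lambda>N. P N (edge (L - 1)) * P N (edge d)) \<in> O(\<lambda>N. pw 1 N)"
    using yy by (simp add: mult.commute)
  moreover have "(\<lambda>N. P N (edge (L - 1)) - P N (edge d)) \<in> O(\<lambda>N. pw 0 N)"
    using difference landau_o.big.uminus_in_iff[of "\<lambda>N. P N (edge d) - P N (edge (L - 1))"] by simp
  ultimately have y': "(\<lambda>N. P N (edge (L - 1))) \<in> O(\<lambda>N. pw (1 / 2) N)"
    by (rule bigo_half_power)
  have u0: "(\<lambda>N. u N e) \<in> o(\<lambda>N. pw 1 N)" if "e \<in> S" "expo e = 0" for e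
    using small[of _ 0] u_bigo[of e 0] that by simp
  have Dy: "(\<lambda>N. D N (edge d)) \<in> o(\<lambda>N. pw 1 N)" "(\<lambda>N. D N (edge (L - 1))) \<in> o(\<lambda>N. pw 1 N)"
    unfolding D_def using small[OF y] small[OF y'] u0 edge(1) lt expo_edge(3,4)
    by (intro sum_in_smallo; simp)+
  \<comment> \<open>The fitted value of the chord is \<open>X N\<close> and its count has order 0,
    so the chord does not disturb the balance at the branch vertices.\<close>
  have "(\<lambda>N. D N e) \<in> o(\<lambda>N. pw 1 N)" if e: "e \<in> chord_edge" for e
  proof -
    have "\<forall>\<^sub>F N in sequentially. P N e = X N"
      using param
    proof eventually_elim
      case (elim N)
      moreover have "(v 0 = Inl (fst e) \<and> v d = Inr (snd e)) \<or> (v 0 = Inr (snd e) \<and> v d = Inl (fst e))"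
        using e by (auto simp: ends_def doubleton_eq_iff)
      ultimately show ?case
        using e by (auto simp: X_def mult.commute)
    qed
    then have "(\<lambda>N. P N e) \<in> o(\<lambda>N. pw 1 N)"
      using small[OF X] landau_o.small.in_cong by fastforce
    moreover have "(\<lambda>N. u N e) \<in> o(\<lambda>N. pw 1 N)"
      using e expo_off_cycle[OF chord_edge_off_cycle[OF e]] by (intro u0) auto
    ultimately show ?thesis
      unfolding D_def by (rule sum_in_smallo)
  qed
  then have chord_small: "(\<lambda>N. \<Sum>e\<in>chord_edge. D N e) \<in> o(\<lambda>N. pw 1 N)"
    by (rule big_sum_in_smallo)
  have "(\<lambda>N. (D N (edge 0) + D N (edge (L - 1)) + (\<Sum>e\<in>chord_edge. D N e)) - D N (edge (L - 1)) - (\<Sum>e\<in>chord_edge. D N e)) \<in> o(\<lambda>N. pw 1 N)"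
    by (intro sum_in_smallo Dy chord_small small[OF D_branch_sum(1)]) simp
  moreover have "(\<lambda>N. (D N (edge (d - 1)) + D N (edge d) + (\<Sum>e\<in>chord_edge. D N e)) - D N (edge d) - (\<Sum>e\<in>chord_edge. D N e)) \<in> o(\<lambda>N. pw 1 N)"
    by (intro sum_in_smallo Dy chord_small small[OF D_branch_sum(2)]) simp
  ultimately have D1: "(\<lambda>N. D N (edge 0)) \<in> o(\<lambda>N. pw 1 N)" "(\<lambda>N. D N (edge (d - 1))) \<in> o(\<lambda>N. pw 1 N)"
    by simp_all
  have P1: "(\<lambda>N. P N e) \<in> \<Theta>(\<lambda>N. pw 1 N)" if "e \<in> S" "expo e = 1" "(\<lambda>N. D N e) \<in> o(\<lambda>N. pw 1 N)" for e
  proof -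
    have u1: "(\<lambda>N. u N e) \<in> \<Theta>(\<lambda>N. pw 1 N)"
      using u_bigtheta[OF that(1)] that(2) by simp
    then show ?thesis
      using that(3) unfolding D_def by (rule bigtheta_perturb)
  qed
  have "(\<lambda>N. P N (edge 0) * P N (edge (d - 1))) \<in> \<Theta>(\<lambda>N. pw 1 N * pw 1 N)"
    using lt expo_edge(1,2) D1 by (intro landau_theta.mult P1 edge(1)) auto
  then have "(\<lambda>N. X N * pw 3 N) \<in> \<Theta>(\<lambda>N. pw 1 N * pw 1 N)"
    using landau_theta.in_cong_bigtheta[OF A1] by blast
  then have "(\<lambda>N. X N * pw 3 N) \<in> \<Theta>(\<lambda>N. pw (-1) N * pw 3 N)"
    by (simp only: pw_mult) simp
  then have X: "X \<in> \<Theta>(\<lambda>N. pw (-1) N)"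
    using landau_theta.mult_cancel_right[OF bigtheta_refl pw_eventually_nonzero] by blast
  have "(\<lambda>N. X N * pw 2 N) \<in> \<Theta>(\<lambda>N. pw (-1) N * pw 2 N)"
    using X by (intro landau_theta.mult) auto
  then have "(\<lambda>N. X N * pw 2 N) \<in> \<Theta>(\<lambda>N. pw 1 N)"
    by (simp only: pw_mult) simp
  then have yy: "(\<lambda>N. P N (edge d) * P N (edge (L - 1))) \<in> \<Theta>(\<lambda>N. pw 1 N)"
    using landau_theta.in_cong_bigtheta[OF A2] by blast
  have "(\<lambda>N. P N (edge d) * (P N (edge d) - P N (edge (L - 1)))) \<in> O(\<lambda>N. pw (1 / 2) N * pw 0 N)"
    by (rule landau_o.big.mult[OF y difference])
  then have "(\<lambda>N. P N (edge d) * (P N (edge d) - P N (edge (L - 1)))) \<in> O(\<lambda>N. pw (1 / 2) N)"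
    by (simp only: pw_mult) simp
  then have "(\<lambda>N. P N (edge d) * (P N (edge d) - P N (edge (L - 1)))) \<in> o(\<lambda>N. pw 1 N)"
    by (rule small) simp
  then have "(\<lambda>N. P N (edge d) ^ 2 - P N (edge d) * P N (edge (L - 1))) \<in> o(pw 1)"
    by (simp add: power2_eq_square algebra_simps)
  then show ?thesis
    by (rule bigtheta_perturb[OF yy])
qed

end

section \<open>Rationality of the maximum likelihood estimate\<close>

lemma same_margins_cong:
  "(\<And>e. e \<in> S \<Longrightarrow> P e = P' e) \<Longrightarrow> (\<And>e. e \<in> S \<Longrightarrow> Q e = Q' e) \<Longrightarrow> same_margins S P Q \<longleftrightarrow> same_margins S P' Q'"
proof -
  assume eq: "\<And>e. e \<in> S \<Longrightarrow> P e = P' e" "\<And>e. e \<in> S \<Longrightarrow> Q e = Q' e"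
  have "(\<Sum>e | e \<in> S \<and> R e. P e) = (\<Sum>e | e \<in> S \<and> R e. P' e)"
    "(\<Sum>e | e \<in> S \<and> R e. Q e) = (\<Sum>e | e \<in> S \<and> R e. Q' e)" for R
    using eq by (auto intro!: sum.cong)
  then show ?thesis
    by (simp add: same_margins_def)
qed

text \<open>Along the counts \<open>w e * N ^ expo e\<close> the sample size is a polynomial in
  \<open>N\<close> and a rational estimate is a rational function of \<open>N\<close>, which
  contradicts the order of the square of the scaled value at \<open>edge d\<close>.\<close>

theorem doubly_chordal_bipartite_if_rational:
  assumes S: "S \<subseteq> {1..m} \<times> {1..n}" and rat: "has_rational_mle m n S"
  shows "doubly_chordal_bipartite (bipartite_graph m n S)"
proof (rule ccontr)
  assume "\<not> doubly_chordal_bipartite (bipartite_graph m n S)"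
  then obtain vs where "is_cycle (bipartite_graph m n S) vs" "6 \<le> length vs"
    "\<not> 2 \<le> card (chords (bipartite_graph m n S) vs)"
    using bipartite_bipartite_graph[OF S] unfolding doubly_chordal_bipartite_def by blast
  then obtain v L d where "theta_cycle S v L d"
    using theta_cycle_if_few_chords[OF S] by blast
  then interpret theta_cycle S v L d .
  define a where "a = edge d"
  have a: "a \<in> S"
    using edge(1)[of d] L unfolding a_def by simp
  from rat obtain f g where
    fg': "\<forall>e\<in>S. polynomial_fun S (f e) \<and> polynomial_fun S (g e) \<and> (\<exists>x. g e x \<noteq> 0)"
    and "generically S (\<lambda>u. (\<forall>e\<in>S. g e (\<lambda>e'. real (u e')) \<noteq> 0) \<and>
      is_mle m n S u (\<lambda>e\<in>S. f e (\<lambda>e'. real (u e')) / g e (\<lambda>e'. real (u e'))))"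
    unfolding has_rational_mle_def by blast
  then obtain h where h: "polynomial_fun S h" "\<exists>x. h x \<noteq> 0"
    and gen: "\<forall>u \<in> S \<rightarrow>\<^sub>E UNIV. h (\<lambda>e. real (u e)) \<noteq> 0 \<longrightarrow> (\<forall>e\<in>S. g e (\<lambda>e'. real (u e')) \<noteq> 0) \<and>
      is_mle m n S u (\<lambda>e\<in>S. f e (\<lambda>e'. real (u e')) / g e (\<lambda>e'. real (u e')))"
    unfolding generically_def by blast
  have fg: "polynomial_fun S (f a)" "polynomial_fun S (g a)"
    using fg' a by blast+
  from h(2) obtain x where "h x \<noteq> 0" ..
  from polynomial_fun_nonzero_at_nat[OF h(1) this fin] obtain w :: "index \<Rightarrow> nat"
    where w: "\<And>e. 1 \<le> w e" "h (\<lambda>e. real (w e)) \<noteq> 0"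
    by blast
  define c where "c t e = real (w e) * t ^ expo e" for t :: real and e
  have c_poly: "\<exists>q. \<forall>t. c t e = poly q t" for e
    by (rule exI[of _ "monom (real (w e)) (expo e)"]) (simp add: c_def poly_monom)
  note along = polynomial_fun_along_curve[where x = c, OF _ c_poly]
  have "polynomial_fun S (\<lambda>x. \<Sum>e\<in>S. x e)"
    using fin by (intro polynomial_fun_sum polynomial_fun.coord)
  from along[OF this] obtain qU where qU: "(\<Sum>e\<in>S. c t e) = poly qU t" for t
    by blast
  obtain qf where qf: "f a (c t) = poly qf t" for t
    using along[OF fg(1)] by blast
  obtain qg where qg: "g a (c t) = poly qg t" for t
    using along[OF fg(2)] by blast
  obtain qh where qh: "h (c t) = poly qh t" for t
    using along[OF h(1)] by blast
  \<comment> \<open>At 1 the curve passes through \<open>w\<close>, where \<open>h\<close> does not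
    vanish; so the generic condition holds for all large \<open>N\<close>.\<close>
  have "poly qh 1 \<noteq> 0"
    using qh[of 1] w(2) by (simp add: c_def[abs_def])
  then have qh0: "qh \<noteq> 0"
    by auto
  define u where "u N = (\<lambda>e\<in>S. w e * N ^ expo e)" for N :: nat
  have u: "real (u N e) = c (real N) e" if "e \<in> S" for N e
    using that by (simp add: u_def c_def)
  define p where "p N = (\<lambda>e\<in>S. f e (\<lambda>e'. real (u N e')) / g e (\<lambda>e'. real (u N e')))" for N
  define good where "good N \<longleftrightarrow> 1 \<le> N \<and> poly qh (real N) \<noteq> 0" for N
  have good: "\<forall>\<^sub>F N in sequentially. good N"
    unfolding good_def using poly_eventually_nonzero[OF qh0] eventually_ge_at_top[of 1] by eventually_elim simp
  have g0: "g a (\<lambda>e. real (u N e)) \<noteq> 0" and mle: "is_mle m n S (u N) (p N)" if "good N" for N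
  proof -
    have "h (\<lambda>e. real (u N e)) = poly qh (real N)"
      using polynomial_fun_cong[OF h(1), of "\<lambda>e. real (u N e)" "c (real N)"] u qh by simp
    moreover have "u N \<in> S \<rightarrow>\<^sub>E UNIV"
      by (simp add: u_def)
    ultimately show "g a (\<lambda>e. real (u N e)) \<noteq> 0" "is_mle m n S (u N) (p N)"
      using gen[rule_format, of "u N"] that a unfolding good_def p_def by auto
  qed
  define P where "P N e = (\<Sum>e\<in>S. real (u N e)) * p N e" for N e
  have Pa: "P N a = poly (qU * qf) (real N) / poly qg (real N)" for N
    using polynomial_fun_cong[OF fg(1), of "\<lambda>e. real (u N e)" "c (real N)"]
      polynomial_fun_cong[OF fg(2), of "\<lambda>e. real (u N e)" "c (real N)"]
      u qf qg qU[of "real N"] a by (simp add: P_def p_def)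
  have "\<exists>T. good N \<longrightarrow> (\<forall>e\<in>S. P N e = T (Inl (fst e)) * T (Inr (snd e)) \<and> 0 < P N e)" for N
  proof (cases "good N")
    case True
    from is_mle_mem[OF mle[OF True]] obtain s t where
      st: "\<And>e. e \<in> S \<Longrightarrow> p N e = s (fst e) * t (snd e)" "\<And>e. e \<in> S \<Longrightarrow> 0 < p N e"
      by (rule qi_modelE) blast
    have "0 < (\<Sum>e\<in>S. real (u N e))"
    proof (rule sum_pos)
      fix e assume "e \<in> S"
      then show "0 < real (u N e)"
        using w(1)[of e] True by (simp add: u_def good_def)
    qed (use fin a in auto)
    \<comment> \<open>The sample size is absorbed into the row parameters.\<close>
    then show ?thesis
      using st by (intro exI[of _ "case_sum (\<lambda>i. (\<Sum>e\<in>S. real (u N e)) * s i) t"]) (simp add: P_def)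
  qed simp
  then obtain T where T: "\<And>N e. good N \<Longrightarrow> e \<in> S \<Longrightarrow> P N e = T N (Inl (fst e)) * T N (Inr (snd e)) \<and> 0 < P N e"
    by metis
  interpret theta_cycle_fit S v L d w P T
  proof
    show "1 \<le> w e" for e
      by (rule w)
    show "\<forall>\<^sub>F N in sequentially. same_margins S (\<lambda>e. real (w e) * pw (real (expo e)) N) (P N)"
      using good
    proof eventually_elim
      case (elim N)
      have "same_margins S (\<lambda>e. real (u N e)) (P N)"
        using same_margins_if_is_mle[OF S mle[OF elim]] unfolding P_def .
      moreover have "real (u N e) = real (w e) * pw (real (expo e)) N" if "e \<in> S" for e
        using u[OF that] elim by (simp add: good_def c_def pw_def powr_realpow)
      ultimately show ?case
        using same_margins_cong[of S "\<lambda>e. real (u N e)" "\<lambda>e. real (w e) * pw (real (expo e)) N" "P N" "P N"]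
        by simp
    qed
    show "\<forall>\<^sub>F N in sequentially. \<forall>e\<in>S. 0 < P N e"
      "\<forall>\<^sub>F N in sequentially. \<forall>e\<in>S. P N e = T N (Inl (fst e)) * T N (Inr (snd e))"
      using good by (eventually_elim, use T in blast)+
  qed
  have "qg \<noteq> 0"
  proof -
    obtain N where N: "good N"
      using good by (meson eventually_happens' sequentially_bot)
    have "g a (\<lambda>e. real (u N e)) = poly qg (real N)"
      using polynomial_fun_cong[OF fg(2), of "\<lambda>e. real (u N e)" "c (real N)"] u qg by simp
    then show ?thesis
      using g0[OF N] by auto
  qed
  then show False
    using rational_square_not_linear[of qg "qU * qf"] fitted_square_order Pa by (simp add: a_def)
qed

section \<open>The clique formula as a rational estimate\<close>

lemma row_sum_fst: "row_sum S u i = (\<Sum>e | e \<in> S \<and> fst e = i. real (u e))"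
  unfolding row_sum_def by (rule sum.reindex_bij_witness[where i = snd and j = "Pair i"]) auto

lemma col_sum_snd: "col_sum S u j = (\<Sum>e | e \<in> S \<and> snd e = j. real (u e))"
  unfolding col_sum_def by (rule sum.reindex_bij_witness[where i = fst and j = "\<lambda>i. (i, j)"]) auto

text \<open>Dividing the fitted counts by the sample size keeps the product form, and total 1
  follows from the equality of margins; Birch's theorem does the rest.\<close>

lemma clique_formula_mle:
  assumes S: "S \<subseteq> {1..m} \<times> {1..n}" "S \<noteq> {}"
    and dcb: "doubly_chordal_bipartite (bipartite_graph m n S)" and u: "\<And>e. e \<in> S \<Longrightarrow> 0 < u e"
  shows "is_mle m n S u (\<lambda>e\<in>S. clique_formula S (\<lambda>e. real (u e)) e / count_sum u S)"
proof -
  let ?F = "clique_formula S (\<lambda>e. real (u e))" and ?U = "count_sum u S"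
  have fin: "finite S"
    using S finite_subset by blast
  have "fits S (\<lambda>e. real (u e))"
    using doubly_chordal_bipartite_constructible[OF S(1) dcb] u by (intro constructible_fits) simp_all
  then obtain s t where st: "\<forall>i. 0 < s i" "\<forall>j. 0 < t j" "\<forall>e\<in>S. ?F e = s (fst e) * t (snd e)"
    and marg: "same_margins S (\<lambda>e. real (u e)) ?F"
    unfolding fits_def by blast
  have U: "0 < ?U"
    unfolding count_sum_def using fin S(2) u by (intro sum_pos) auto
  have "?U = (\<Sum>e\<in>S. ?F e)"
    using same_margins_sum[OF fin marg, of "\<lambda>_. 1" "\<lambda>_. 0"] by (simp add: count_sum_def)
  then have one: "(\<Sum>e\<in>S. ?F e / ?U) = 1"
    using U by (simp add: sum_divide_distrib[symmetric])
  show ?thesis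
  proof (rule is_mle_if_same_margins[OF S(1) _ _ U])
    show "(\<lambda>e\<in>S. ?F e / ?U) \<in> qi_model m n S"
      by (rule qi_modelI[OF S(1), where s = "\<lambda>i. s i / ?U" and t = t]) (use st U one in simp_all)
    show "same_margins S (\<lambda>e. real (u e)) (\<lambda>e. ?U * (\<lambda>e\<in>S. ?F e / ?U) e)"
      using marg U by (subst same_margins_cong[where P' = "\<lambda>e. real (u e)" and Q' = ?F]) simp_all
  qed
qed

text \<open>The excluding polynomial is the product of all coordinates, which for natural counts is
  nonzero exactly when all of them are positive.\<close>

lemma generically_if_positive:
  assumes "finite S" "\<And>u. (\<And>e. e \<in> S \<Longrightarrow> 0 < u e) \<Longrightarrow> P u"
  shows "generically S P"
  unfolding generically_def
proof (intro exI conjI ballI impI)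
  show "polynomial_fun S (\<lambda>x. \<Prod>e\<in>S. x e)"
    using assms(1) by (intro polynomial_fun_prod polynomial_fun.coord)
  show "(\<Prod>e\<in>S. (\<lambda>_. 1 :: real) e) \<noteq> 0"
    by simp
  fix u :: "index \<Rightarrow> nat" assume "(\<Prod>e\<in>S. real (u e)) \<noteq> 0"
  then show "P u"
    using assms by simp
qed

lemma rational_if_clique_formula:
  assumes fin: "finite S"
    and mle: "\<And>u. (\<And>e. e \<in> S \<Longrightarrow> 0 < u e) \<Longrightarrow>
      is_mle m n S u (\<lambda>e\<in>S. clique_formula S (\<lambda>e. real (u e)) e / count_sum u S)"
  shows "has_rational_mle m n S"
proof -
  define f :: "index \<Rightarrow> (index \<Rightarrow> real) \<Rightarrow> real" where
    "f e x = (\<Sum>e' | e' \<in> S \<and> fst e' = fst e. x e') * (\<Sum>e' | e' \<in> S \<and> snd e' = snd e. x e') *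
      (\<Prod>C\<in>Int_cliques S e. \<Sum>e'\<in>C. x e')" for e x
  define g :: "index \<Rightarrow> (index \<Rightarrow> real) \<Rightarrow> real" where
    "g e x = (\<Sum>e'\<in>S. x e') * (\<Prod>D\<in>Max_cliques S e. \<Sum>e'\<in>D. x e')" for e x
  have sums: "polynomial_fun S (\<lambda>x. \<Sum>e\<in>C. x e)" if "C \<subseteq> S" for C
    using finite_subset[OF that fin] that by (intro polynomial_fun_sum polynomial_fun.coord) auto
  have Int_prod: "polynomial_fun S (\<lambda>x. \<Prod>C\<in>Int_cliques S e. \<Sum>e'\<in>C. x e')" for e
    by (rule polynomial_fun_prod[OF finite_Int_cliques[OF fin]]) (rule sums, rule Int_cliques_subset)
  have Max_prod: "polynomial_fun S (\<lambda>x. \<Prod>D\<in>Max_cliques S e. \<Sum>e'\<in>D. x e')" for e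
    by (rule polynomial_fun_prod[OF finite_Max_cliques[OF fin]]) (rule sums, rule Max_cliques_subset)
  have g_pos: "0 < g e x" if "e \<in> S" "\<And>e. e \<in> S \<Longrightarrow> 0 < x e" for e x
    unfolding g_def using that fin by (intro mult_pos_pos sum_pos Max_prod_pos) auto
  show ?thesis
    unfolding has_rational_mle_def
  proof (rule exI[of _ f], rule exI[of _ g], intro conjI ballI generically_if_positive[OF fin])
    fix e assume e: "e \<in> S"
    show "polynomial_fun S (f e)"
      unfolding f_def by (intro polynomial_fun.mult sums Int_prod) auto
    show "polynomial_fun S (g e)"
      unfolding g_def by (intro polynomial_fun.mult sums Max_prod) auto
    show "\<exists>x. g e x \<noteq> 0"
      using g_pos[OF e, of "\<lambda>_. 1"] by (intro exI[of _ "\<lambda>_. 1"]) simp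
  next
    fix u :: "index \<Rightarrow> nat" and e assume "\<And>e. e \<in> S \<Longrightarrow> 0 < u e" "e \<in> S"
    then show "g e (\<lambda>e'. real (u e')) \<noteq> 0"
      using g_pos[of e "\<lambda>e'. real (u e')"] by simp
  next
    fix u :: "index \<Rightarrow> nat" assume u: "\<And>e. e \<in> S \<Longrightarrow> 0 < u e"
    have "f e (\<lambda>e'. real (u e')) / g e (\<lambda>e'. real (u e')) = clique_formula S (\<lambda>e. real (u e)) e / count_sum u S" for e
      by (simp add: f_def g_def clique_formula_def count_sum_def)
    then show "is_mle m n S u (\<lambda>e\<in>S. f e (\<lambda>e'. real (u e')) / g e (\<lambda>e'. real (u e')))"
      using mle[OF u] by simp
  qed
qed

theorem theorem5p4:
  fixes m n :: nat and S :: "(nat \<times> nat) set"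
  assumes "S \<subseteq> {1..m} \<times> {1..n}" and "S \<noteq> {}"
  shows "(has_rational_mle m n S \<longleftrightarrow> doubly_chordal_bipartite (bipartite_graph m n S)) \<and>
    (doubly_chordal_bipartite (bipartite_graph m n S) \<longrightarrow>
      generically S (\<lambda>u. is_mle m n S u
        (\<lambda>(i, j)\<in>S.
          (row_sum S u i * col_sum S u j * (\<Prod>C\<in>Int_cliques S (i, j). count_sum u C)) /
          (count_sum u S * (\<Prod>D\<in>Max_cliques S (i, j). count_sum u D)))))"
proof -
  have fin: "finite S"
    using assms(1) finite_subset by blast
  have formula: "(\<lambda>e\<in>S. clique_formula S (\<lambda>e. real (u e)) e / count_sum u S) =
      (\<lambda>(i, j)\<in>S. (row_sum S u i * col_sum S u j * (\<Prod>C\<in>Int_cliques S (i, j). count_sum u C)) /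
          (count_sum u S * (\<Prod>D\<in>Max_cliques S (i, j). count_sum u D)))" for u
    by (rule restrict_ext)
      (auto simp: clique_formula_def row_sum_fst col_sum_snd count_sum_def)
  show ?thesis
  proof (intro conjI iffI impI)
    assume "has_rational_mle m n S"
    then show "doubly_chordal_bipartite (bipartite_graph m n S)"
      by (rule doubly_chordal_bipartite_if_rational[OF assms(1)])
  next
    assume "doubly_chordal_bipartite (bipartite_graph m n S)"
    note mle = clique_formula_mle[OF assms this]
    show "has_rational_mle m n S"
      by (rule rational_if_clique_formula[OF fin mle])
    show "generically S (\<lambda>u. is_mle m n S u
        (\<lambda>(i, j)\<in>S.
          (row_sum S u i * col_sum S u j * (\<Prod>C\<in>Int_cliques S (i, j). count_sum u C)) /
          (count_sum u S * (\<Prod>D\<in>Max_cliques S (i, j). count_sum u D))))"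
      by (rule generically_if_positive[OF fin mle[unfolded formula]])
  qed
qed

end
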